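(* Let $n\ge3$, and let $H^3\times\mathbb{R}^{n-3}$ be the product of the three-dimensional Heisenberg group and the abelian Lie group, with Lie algebra $\mathfrak h_3\oplus\mathfrak g_{\mathbb{R}^{n-3}}$ having a basis $\{e_1,\dots,e_n\}$, where $\{e_1,e_2,e_3\}$ is a basis of $\mathfrak h_3$ with $[e_1,e_2]=e_3$, $\{e_4,\dots,e_n\}$ is a basis of $\mathfrak g_{\mathbb{R}^{n-3}}$, and all other brackets are trivial. Let $\{x_1,\dots,x_n\}$ be the dual basis, $g$ the left-invariant Riemannian metric for which $\{e_1,\dots,e_n\}$ is orthonormal, and $w_0:=x_1x_1+x_2x_2+x_3x_3\in S^2(\mathfrak h_3^* )$. Then: (1) The subspace $(\mathbb{R}w_0\odot S^1(\mathfrak g_{\mathbb{R}^{n-3}}^* ))\oplus S^3(\mathfrak g_{\mathbb{R}^{n-3}}^* )$ of $S^3((\mathfrak h_3\oplus\mathfrak g_{\mathbb{R}^{n-3}})^* )$ is a set of representatives for $\mathcal{ML}\mathrm{Stat}^{\mathrm{CS}}(H^3\times\mathbb{R}^{n-3})$. In particular, if $n=3$, this set of representatives is the singleton $\{0\}$, so a left-invariant conjugate symmetric statistical structure on $H^3$ is essentially unique (i.e. $\mathcal{ML}\mathrm{Stat}^{\mathrm{CS}}(H^3)$ is one point), and consists of a left-invariant Riemannian metric and its Levi-Civita connection. If $n\ge4$, then $\mathcal{ML}\mathrm{Stat}^{\mathrm{CS}}(H^3\times\mathbb{R}^{n-3})$ is homeomorphic to the orbit space of $(\mathbb{R}w_0\odot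 S^1(\mathfrak g_{\mathbb{R}^{n-3}}^* ))\oplus S^3(\mathfrak g_{\mathbb{R}^{n-3}}^* )$ under the action of $O(n-3)$. (2) There do not exist any left-invariant dually flat structures on $H^3\times\mathbb{R}^{n-3}$.
   Context: A statistical structure on a manifold $M$ is a pair $(g,\nabla)$ of a Riemannian metric $g$ and a torsion-free affine connection $\nabla$ such that the $(0,3)$-tensor field $C:=\nabla g$, $C(X,Y,Z)=(\nabla_X g)(Y,Z)$ (the cubic form), is totally symmetric. For fixed $g$, $\nabla\mapsto\nabla g$ is a bijection onto the symmetric $(0,3)$-tensor fields; $\nabla^{(g,C)}$ denotes the connection with $\nabla g=C$. The dual connection $\overline\nabla$ is defined by $Xg(Y,Z)=g(\nabla_XY,Z)+g(Y,\overline\nabla_XZ)$. With $R^\nabla$ the curvature tensor, $(g,\nabla)$ is conjugate symmetric if $R^\nabla=R^{\overline\nabla}$, and dually flat if $R^\nabla=0$. For a Lie group $G$ with Lie algebra $\mathfrak g$, a statistical structure $(g,\nabla)$ on $G$ is left-invariant if both $g$ and $\nabla$ are invariant under left translations. $\mathcal{L}\mathrm{Stat}(G)$ is the set of these; it is identified via $(g,\nabla)\mapsto(g,\nabla g)$ with $\widetilde{\mathfrak M}(G)\times S^3(\mathfrak g^* )$, where $\widetilde{\mathfrak M}(G)$ is the space of left-invariant Riemannian metrics (= inner products on $\mathfrak g$), and carries the corresponding topology. $\mathbb{R}_{>0}\times\mathrm{Aut}(G)$ acts on it by $(r,\varphi).(g,\nabla)=(r\,(\varphi^{-1})^*g,(\varphi^{-1})^*\nabla)$.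 $\mathcal{ML}\mathrm{Stat}^{\mathrm{CS}}(G)$ is the orbit space (quotient topology) of the invariant subset of conjugate symmetric left-invariant structures. $S^k(\mathfrak g^* )$ denotes symmetric $k$-tensors, $\odot$ is the symmetric product, with $(x_1\cdots x_k)(X_1,\dots,X_k)=\frac1{k!}\sum_{\sigma\in\mathfrak S_k}\prod_i x_{\sigma(i)}(X_i)$. Tensors on $\mathfrak h_3$ and $\mathfrak g_{\mathbb{R}^{n-3}}$ are regarded as tensors on the direct sum. $O(n-3)$ is the orthogonal group of $\mathrm{span}\{e_4,\dots,e_n\}$, acting naturally on $S^k(\mathfrak g_{\mathbb{R}^{n-3}}^* )$ and trivially on $w_0$. A subset $A\subset S^3(\mathfrak g^* )$ is a set of representatives for $\mathcal{ML}\mathrm{Stat}^{\mathrm{CS}}(G)$ (with respect to the fixed $g$) if $C\mapsto[(g,\nabla^{(g,C)})]$ maps $A$ onto it. *)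

theory Defs
  imports "HOL-Analysis.Analysis"
begin

section \<open>Calculus on a manifold with one global chart\<close>

text \<open>
  The Lie group of the theorem is diffeomorphic to \<open>\<real>\<^sup>n\<close>, so its underlying manifold is taken to be a
  Euclidean space \<open>'a\<close>, every tangent space being identified with \<open>'a\<close> by the chart.
\<close>

type_synonym 'a vfield = "'a \<Rightarrow> 'a"
type_synonym 'a metric = "'a \<Rightarrow> 'a \<Rightarrow> 'a \<Rightarrow> real"
type_synonym 'a connection = "'a vfield \<Rightarrow> 'a vfield \<Rightarrow> 'a vfield"
type_synonym 'a tensor3 = "'a \<Rightarrow> 'a \<Rightarrow> 'a \<Rightarrow> real"

primrec Ck :: "nat \<Rightarrow> ('a::euclidean_space \<Rightarrow> 'b::real_normed_vector) \<Rightarrow> bool" where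
  "Ck 0 f \<longleftrightarrow> continuous_on UNIV f"
| "Ck (Suc k) f \<longleftrightarrow> (\<forall>p. f differentiable (at p)) \<and>
     (\<forall>v. Ck k (\<lambda>p. frechet_derivative f (at p) v))"

definition smooth :: "('a::euclidean_space \<Rightarrow> 'b::real_normed_vector) \<Rightarrow> bool" where
  "smooth f \<longleftrightarrow> (\<forall>k. Ck k f)"

definition vf_deriv :: "'a::euclidean_space vfield \<Rightarrow> ('a \<Rightarrow> 'b::real_normed_vector) \<Rightarrow> 'a \<Rightarrow> 'b" where
  "vf_deriv X f p = frechet_derivative f (at p) (X p)"

definition vf_bracket :: "'a::euclidean_space vfield \<Rightarrow> 'a vfield \<Rightarrow> 'a vfield" where
  "vf_bracket X Y p = vf_deriv X Y p - vf_deriv Y X p"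

definition push_vf :: "('a::euclidean_space \<Rightarrow> 'a) \<Rightarrow> 'a vfield \<Rightarrow> 'a vfield" where
  "push_vf \<psi> X p = frechet_derivative \<psi> (at (inv \<psi> p)) (X (inv \<psi> p))"

definition riemannian_metric :: "'a::euclidean_space metric \<Rightarrow> bool" where
  "riemannian_metric g \<longleftrightarrow>
     (\<forall>u v. smooth (\<lambda>p. g p u v)) \<and>
     (\<forall>p. bilinear (g p) \<and> (\<forall>u v. g p u v = g p v u) \<and> (\<forall>u. u \<noteq> 0 \<longrightarrow> g p u u > 0))"

text \<open>
  A connection acts on smooth vector fields. Requiring the value \<open>0\<close> on all other arguments makes
  \<open>=\<close> on operators the equality of connections.
\<close>

definition affine_connection :: "'a::euclidean_space connection \<Rightarrow> bool" where
  "affine_connection D \<longleftrightarrow>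
     (\<forall>X Y. smooth X \<and> smooth Y \<longrightarrow> smooth (D X Y)) \<and>
     (\<forall>X X' Y. smooth X \<and> smooth X' \<and> smooth Y \<longrightarrow>
        D (\<lambda>p. X p + X' p) Y = (\<lambda>p. D X Y p + D X' Y p)) \<and>
     (\<forall>f X Y. smooth f \<and> smooth X \<and> smooth Y \<longrightarrow>
        D (\<lambda>p. f p *\<^sub>R X p) Y = (\<lambda>p. f p *\<^sub>R D X Y p)) \<and>
     (\<forall>X Y Y'. smooth X \<and> smooth Y \<and> smooth Y' \<longrightarrow>
        D X (\<lambda>p. Y p + Y' p) = (\<lambda>p. D X Y p + D X Y' p)) \<and>
     (\<forall>f X Y. smooth f \<and> smooth X \<and> smooth Y \<longrightarrow>
        D X (\<lambda>p. f p *\<^sub>R Y p) = (\<lambda>p. vf_deriv X f p *\<^sub>R Y p + f p *\<^sub>R D X Y p)) \<and>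
     (\<forall>X Y. \<not> (smooth X \<and> smooth Y) \<longrightarrow> D X Y = (\<lambda>p. 0))"

definition torsion_free :: "'a::euclidean_space connection \<Rightarrow> bool" where
  "torsion_free D \<longleftrightarrow>
     (\<forall>X Y p. smooth X \<and> smooth Y \<longrightarrow> D X Y p - D Y X p = vf_bracket X Y p)"

definition curvature ::
    "'a::euclidean_space connection \<Rightarrow> 'a vfield \<Rightarrow> 'a vfield \<Rightarrow> 'a vfield \<Rightarrow> 'a vfield" where
  "curvature D X Y Z p = D X (D Y Z) p - D Y (D X Z) p - D (vf_bracket X Y) Z p"


section \<open>Statistical structures\<close>

definition cubic_form ::
    "'a::euclidean_space metric \<Rightarrow> 'a connection \<Rightarrow> 'a vfield \<Rightarrow> 'a vfield \<Rightarrow> 'a vfield \<Rightarrow> 'a \<Rightarrow> real" where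
  "cubic_form g D X Y Z p =
     vf_deriv X (\<lambda>q. g q (Y q) (Z q)) p - g p (D X Y p) (Z p) - g p (Y p) (D X Z p)"

text \<open>The cubic form is tensorial, so its value at a point may be computed from constant fields.\<close>

definition cubic_at :: "'a::euclidean_space metric \<Rightarrow> 'a connection \<Rightarrow> 'a \<Rightarrow> 'a tensor3" where
  "cubic_at g D p u v w = cubic_form g D (\<lambda>_. u) (\<lambda>_. v) (\<lambda>_. w) p"

definition statistical_structure :: "'a::euclidean_space metric \<Rightarrow> 'a connection \<Rightarrow> bool" where
  "statistical_structure g D \<longleftrightarrow>
     riemannian_metric g \<and> affine_connection D \<and> torsion_free D \<and>
     (\<forall>X Y Z p. smooth X \<and> smooth Y \<and> smooth Z \<longrightarrow>
        cubic_form g D X Y Z p = cubic_form g D Y X Z p \<and>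
        cubic_form g D X Y Z p = cubic_form g D X Z Y p)"

definition connection_of :: "'a::euclidean_space metric \<Rightarrow> ('a \<Rightarrow> 'a tensor3) \<Rightarrow> 'a connection" where
  "connection_of g T = (THE D. affine_connection D \<and> torsion_free D \<and>
     (\<forall>X Y Z p. smooth X \<and> smooth Y \<and> smooth Z \<longrightarrow>
        cubic_form g D X Y Z p = T p (X p) (Y p) (Z p)))"

definition dual_connection :: "'a::euclidean_space metric \<Rightarrow> 'a connection \<Rightarrow> 'a connection" where
  "dual_connection g D = (THE D'. affine_connection D' \<and>
     (\<forall>X Y Z p. smooth X \<and> smooth Y \<and> smooth Z \<longrightarrow>
        vf_deriv X (\<lambda>q. g q (Y q) (Z q)) p = g p (D X Y p) (Z p) + g p (Y p) (D' X Z p)))"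

definition conjugate_symmetric :: "'a::euclidean_space metric \<Rightarrow> 'a connection \<Rightarrow> bool" where
  "conjugate_symmetric g D \<longleftrightarrow>
     (\<forall>X Y Z p. smooth X \<and> smooth Y \<and> smooth Z \<longrightarrow>
        curvature D X Y Z p = curvature (dual_connection g D) X Y Z p)"

definition dually_flat :: "'a::euclidean_space metric \<Rightarrow> 'a connection \<Rightarrow> bool" where
  "dually_flat g D \<longleftrightarrow>
     (\<forall>X Y Z p. smooth X \<and> smooth Y \<and> smooth Z \<longrightarrow> curvature D X Y Z p = 0)"

definition levi_civita :: "'a::euclidean_space metric \<Rightarrow> 'a connection \<Rightarrow> bool" where
  "levi_civita g D \<longleftrightarrow> affine_connection D \<and> torsion_free D \<and>
     (\<forall>X Y Z p. smooth X \<and> smooth Y \<and> smooth Z \<longrightarrow>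
        vf_deriv X (\<lambda>q. g q (Y q) (Z q)) p = g p (D X Y p) (Z p) + g p (Y p) (D X Z p))"

definition pull_metric :: "('a::euclidean_space \<Rightarrow> 'a) \<Rightarrow> 'a metric \<Rightarrow> 'a metric" where
  "pull_metric \<psi> g p u v =
     g (\<psi> p) (frechet_derivative \<psi> (at p) u) (frechet_derivative \<psi> (at p) v)"

definition pull_connection :: "('a::euclidean_space \<Rightarrow> 'a) \<Rightarrow> 'a connection \<Rightarrow> 'a connection" where
  "pull_connection \<psi> D X Y = push_vf (inv \<psi>) (D (push_vf \<psi> X) (push_vf \<psi> Y))"


section \<open>Left-invariant structures and their moduli\<close>

text \<open>
  From here on \<open>m\<close> is the multiplication of a Lie group with underlying manifold \<open>'a\<close> and unit \<open>0\<close>;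
  its Lie algebra is the tangent space at \<open>0\<close>, that is, \<open>'a\<close> itself. The left translation by \<open>a\<close>
  is \<open>m a\<close>.
\<close>

definition dleft :: "('a::euclidean_space \<Rightarrow> 'a \<Rightarrow> 'a) \<Rightarrow> 'a \<Rightarrow> 'a \<Rightarrow> 'a" where
  "dleft m p = frechet_derivative (m p) (at 0)"

definition left_inv_metric :: "('a::euclidean_space \<Rightarrow> 'a \<Rightarrow> 'a) \<Rightarrow> ('a \<Rightarrow> 'a \<Rightarrow> real) \<Rightarrow> 'a metric" where
  "left_inv_metric m b p u v = b (inv (dleft m p) u) (inv (dleft m p) v)"

definition left_inv_tensor3 :: "('a::euclidean_space \<Rightarrow> 'a \<Rightarrow> 'a) \<Rightarrow> 'a tensor3 \<Rightarrow> 'a \<Rightarrow> 'a tensor3" where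
  "left_inv_tensor3 m C p u v w = C (inv (dleft m p) u) (inv (dleft m p) v) (inv (dleft m p) w)"

definition LStat :: "('a::euclidean_space \<Rightarrow> 'a \<Rightarrow> 'a) \<Rightarrow> ('a metric \<times> 'a connection) set" where
  "LStat m = {(g, D). statistical_structure g D \<and>
     (\<forall>a. pull_metric (m a) g = g \<and> pull_connection (m a) D = D)}"

definition LStatCS :: "('a::euclidean_space \<Rightarrow> 'a \<Rightarrow> 'a) \<Rightarrow> ('a metric \<times> 'a connection) set" where
  "LStatCS m = {(g, D) \<in> LStat m. conjugate_symmetric g D}"

definition Aut :: "('a::euclidean_space \<Rightarrow> 'a \<Rightarrow> 'a) \<Rightarrow> ('a \<Rightarrow> 'a) set" where
  "Aut m = {\<phi>. bij \<phi> \<and> smooth \<phi> \<and> smooth (inv \<phi>) \<and> (\<forall>p q. \<phi> (m p q) = m (\<phi> p) (\<phi> q))}"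

definition stat_act ::
    "real \<Rightarrow> ('a::euclidean_space \<Rightarrow> 'a) \<Rightarrow> 'a metric \<times> 'a connection \<Rightarrow> 'a metric \<times> 'a connection" where
  "stat_act r \<phi> s =
     ((\<lambda>p u v. r * pull_metric (inv \<phi>) (fst s) p u v), pull_connection (inv \<phi>) (snd s))"

definition stat_orbit ::
    "('a::euclidean_space \<Rightarrow> 'a \<Rightarrow> 'a) \<Rightarrow> 'a metric \<times> 'a connection \<Rightarrow> ('a metric \<times> 'a connection) set" where
  "stat_orbit m s = {stat_act r \<phi> s |r \<phi>. r > 0 \<and> \<phi> \<in> Aut m}"

definition quotient_topology :: "'x topology \<Rightarrow> ('x \<Rightarrow> 'y) \<Rightarrow> 'y topology" where
  "quotient_topology T f =
     topology (\<lambda>U. U \<subseteq> f ` topspace T \<and> openin T {x \<in> topspace T. f x \<in> U})"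

text \<open>
  The topology of \<open>LStat\<close> is induced by \<open>(g, \<nabla>) \<mapsto> (g, \<nabla>g)\<close>, evaluated at the unit. On a
  finite-dimensional space of multilinear forms the usual vector space topology is the one of
  pointwise convergence, which is \<open>euclidean\<close> on function types.
\<close>

definition LStat_topology ::
    "('a::euclidean_space \<Rightarrow> 'a \<Rightarrow> 'a) \<Rightarrow> ('a metric \<times> 'a connection) topology" where
  "LStat_topology m = pullback_topology (LStat m) (\<lambda>(g, D). (g 0, cubic_at g D 0)) euclidean"

definition MLStatCS ::
    "('a::euclidean_space \<Rightarrow> 'a \<Rightarrow> 'a) \<Rightarrow> ('a metric \<times> 'a connection) set topology" where
  "MLStatCS m = quotient_topology (subtopology (LStat_topology m) (LStatCS m)) (stat_orbit m)"

definition sym_tensors3 :: "'a::real_vector tensor3 set" where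
  "sym_tensors3 = {T. (\<forall>u v. linear (T u v)) \<and>
     (\<forall>u v w. T u v w = T v u w \<and> T u v w = T u w v)}"

definition set_of_representatives ::
    "('a::euclidean_space \<Rightarrow> 'a \<Rightarrow> 'a) \<Rightarrow> 'a metric \<Rightarrow> 'a tensor3 set \<Rightarrow> bool" where
  "set_of_representatives m g A \<longleftrightarrow> A \<subseteq> sym_tensors3 \<and>
     (\<lambda>C. stat_orbit m (g, connection_of g (left_inv_tensor3 m C))) ` A = topspace (MLStatCS m)"


section \<open>The group and its tensors\<close>

definition heis_bracket :: "(nat \<Rightarrow> 'a::euclidean_space) \<Rightarrow> 'a \<Rightarrow> 'a \<Rightarrow> 'a" where
  "heis_bracket e u v = ((u \<bullet> e 1) * (v \<bullet> e 2) - (u \<bullet> e 2) * (v \<bullet> e 1)) *\<^sub>R e 3"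

text \<open>
  For an orthonormal basis \<open>e 1, \<dots>, e n\<close> of \<open>'a\<close>, the group \<open>H\<^sup>3 \<times> \<real>\<^sup>n\<^sup>-\<^sup>3\<close> in exponential
  coordinates: on the first three coordinates
  \<open>(x, y, z) (x', y', z') = (x + x', y + y', z + z' + (x y' - y x') / 2)\<close>, on the others addition.
\<close>

definition heis_mult :: "(nat \<Rightarrow> 'a::euclidean_space) \<Rightarrow> 'a \<Rightarrow> 'a \<Rightarrow> 'a" where
  "heis_mult e p q = p + q + (1/2) *\<^sub>R heis_bracket e p q"

lemma heis_mult_unit: "heis_mult e 0 p = p" "heis_mult e p 0 = p"
  by (simp_all add: heis_mult_def heis_bracket_def)

lemma heis_mult_inverse: "heis_mult e (- p) p = 0" "heis_mult e p (- p) = 0"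
  by (simp_all add: heis_mult_def heis_bracket_def)

lemma heis_mult_assoc:
  assumes "e 3 \<bullet> e 1 = 0" "e 3 \<bullet> e 2 = 0"
  shows "heis_mult e (heis_mult e p q) r = heis_mult e p (heis_mult e q r)"
  using assms
  by (simp add: heis_mult_def heis_bracket_def inner_simps algebra_simps flip: scaleR_add_left)

lemma heis_mult_dleft: "dleft (heis_mult e) p v = v + (1/2) *\<^sub>R heis_bracket e p v"
proof -
  have "(heis_mult e p has_derivative (\<lambda>v. v + (1/2) *\<^sub>R heis_bracket e p v)) (at 0)"
    unfolding heis_mult_def heis_bracket_def by (auto intro!: derivative_eq_intros)
  then show ?thesis
    unfolding dleft_def using frechet_derivative_at by metis
qed

text \<open>The Lie algebra of this group has the bracket \<open>heis_bracket\<close>.\<close>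

lemma heis_mult_lie_algebra:
  assumes "e 3 \<bullet> e 1 = 0" "e 3 \<bullet> e 2 = 0"
  shows "vf_bracket (\<lambda>p. dleft (heis_mult e) p u) (\<lambda>p. dleft (heis_mult e) p v) =
    (\<lambda>p. dleft (heis_mult e) p (heis_bracket e u v))"
proof
  fix p
  have D: "frechet_derivative (\<lambda>p. dleft (heis_mult e) p w) (at p) =
      (\<lambda>h. (1/2) *\<^sub>R heis_bracket e h w)" for w
  proof -
    have "((\<lambda>p. dleft (heis_mult e) p w) has_derivative
        (\<lambda>h. (1/2) *\<^sub>R heis_bracket e h w)) (at p)"
      unfolding heis_mult_dleft heis_bracket_def by (auto intro!: derivative_eq_intros)
    then show ?thesis
      using frechet_derivative_at by metis
  qed
  show "vf_bracket (\<lambda>p. dleft (heis_mult e) p u) (\<lambda>p. dleft (heis_mult e) p v) p =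
      dleft (heis_mult e) p (heis_bracket e u v)"
    unfolding vf_bracket_def vf_deriv_def D
    using assms
    by (simp add: heis_mult_dleft heis_bracket_def inner_simps algebra_simps flip: scaleR_add_left)
qed

definition sym_prod11 :: "('a \<Rightarrow> real) \<Rightarrow> ('a \<Rightarrow> real) \<Rightarrow> 'a \<Rightarrow> 'a \<Rightarrow> real" where
  "sym_prod11 a b X Y = (a X * b Y + a Y * b X) / 2"

definition sym_prod21 :: "('a \<Rightarrow> 'a \<Rightarrow> real) \<Rightarrow> ('a \<Rightarrow> real) \<Rightarrow> 'a tensor3" where
  "sym_prod21 w a X Y Z =
     (w X Y * a Z + w X Z * a Y + w Y X * a Z + w Y Z * a X + w Z X * a Y + w Z Y * a X) / 6"

definition w0 :: "(nat \<Rightarrow> 'a::euclidean_space) \<Rightarrow> 'a \<Rightarrow> 'a \<Rightarrow> real" where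
  "w0 e X Y = (\<Sum>i=1..3. sym_prod11 (\<lambda>v. v \<bullet> e i) (\<lambda>v. v \<bullet> e i) X Y)"

text \<open>
  Tensors on the abelian factor, the span of \<open>e 4, \<dots>, e n\<close>, are regarded as tensors on the whole
  Lie algebra that factor through the projection onto it.
\<close>

definition abelian_proj :: "(nat \<Rightarrow> 'a::euclidean_space) \<Rightarrow> nat \<Rightarrow> 'a \<Rightarrow> 'a" where
  "abelian_proj e n v = (\<Sum>i=4..n. (v \<bullet> e i) *\<^sub>R e i)"

definition S1_abelian :: "(nat \<Rightarrow> 'a::euclidean_space) \<Rightarrow> nat \<Rightarrow> ('a \<Rightarrow> real) set" where
  "S1_abelian e n = {a. linear a \<and> (\<forall>X. a X = a (abelian_proj e n X))}"

definition S3_abelian :: "(nat \<Rightarrow> 'a::euclidean_space) \<Rightarrow> nat \<Rightarrow> 'a tensor3 set" where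
  "S3_abelian e n = {T \<in> sym_tensors3.
     \<forall>X Y Z. T X Y Z = T (abelian_proj e n X) (abelian_proj e n Y) (abelian_proj e n Z)}"

definition w0_S1 :: "(nat \<Rightarrow> 'a::euclidean_space) \<Rightarrow> nat \<Rightarrow> 'a tensor3 set" where
  "w0_S1 e n = {sym_prod21 (\<lambda>X Y. c * w0 e X Y) a |c a. a \<in> S1_abelian e n}"

definition rep_space :: "(nat \<Rightarrow> 'a::euclidean_space) \<Rightarrow> nat \<Rightarrow> 'a tensor3 set" where
  "rep_space e n = {(\<lambda>X Y Z. S X Y Z + T X Y Z) |S T. S \<in> w0_S1 e n \<and> T \<in> S3_abelian e n}"

text \<open>
  \<open>O(n - 3)\<close>: an orthogonal map of the span of \<open>e 4, \<dots>, e n\<close> is represented by its extension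
  by the identity on the span of \<open>e 1, e 2, e 3\<close>.
\<close>

definition orth_abelian :: "(nat \<Rightarrow> 'a::euclidean_space) \<Rightarrow> ('a \<Rightarrow> 'a) set" where
  "orth_abelian e = {k. orthogonal_transformation k \<and> (\<forall>i\<in>{1..3}. k (e i) = e i)}"

definition rep_orbit :: "(nat \<Rightarrow> 'a::euclidean_space) \<Rightarrow> nat \<Rightarrow> 'a tensor3 \<Rightarrow> 'a tensor3 set" where
  "rep_orbit e n A =
     {(\<lambda>X Y Z. sym_prod21 (\<lambda>X Y. c * w0 e X Y) (\<lambda>X. a (inv k X)) X Y Z +
               T (inv k X) (inv k Y) (inv k Z)) |k c a T.
        k \<in> orth_abelian e \<and> a \<in> S1_abelian e n \<and> T \<in> S3_abelian e n \<and>
        A = (\<lambda>X Y Z. sym_prod21 (\<lambda>X Y. c * w0 e X Y) a X Y Z + T X Y Z)}"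

end

theory Submission
  imports Defs
begin

text \<open>
  Left-invariant objects on the group are constant in the frame of left-invariant vector fields, so
  everything reduces to algebra on the Lie algebra. A left-invariant connection is \<open>d + B\<close> in this
  frame for a bilinear product \<open>B\<close>, a left-invariant metric is an inner product \<open>b\<close>, and the
  conditions of the theorem become conditions on the pair \<open>(b, B)\<close>: torsion-freeness says that the
  commutator of \<open>B\<close> is the Lie bracket, the cubic form is an algebraic expression in \<open>b\<close> and \<open>B\<close>,
  and the second-order terms cancel when the curvatures of \<open>B\<close> and of its dual are compared, so
  that conjugate symmetry says that all curvature operators of \<open>B\<close> are skew for \<open>b\<close>
  (\<open>LStat_eq\<close>, \<open>LStatCS_eq\<close>). Smooth automorphisms of the group are linear in exponential
  coordinates (\<open>Aut_eq\<close>), so the scaling and automorphism action is algebraic as well.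

  A Gram-Schmidt process along the flag \<open>e 3\<close>, centre, whole algebra turns each inner product,
  up to scale, into the standard one by an automorphism that depends continuously on it
  (\<open>normalising_section\<close>). Thus only the standard inner product matters. For it, conjugate symmetry
  of the connection with cubic form \<open>C\<close> is the Codazzi equation for \<open>C\<close> (\<open>alg_cs_iff_codazzi\<close>),
  which is linear. Along the abelian directions it says that the forms \<open>C(z, \<cdot>, \<cdot>)\<close> are
  invariant under the Levi-Civita operators, which span the rotations of the Heisenberg part; along
  the Heisenberg directions it forces the purely Heisenberg components to vanish. Its solution space
  is exactly \<open>rep_space\<close> (\<open>rep_space_codazzi\<close>, \<open>codazzi_rep_space\<close>).

  Two solutions give the same orbit if and only if an element of the stabiliser of the standard inner
  product carries one to the other. The stabiliser contains no proper scaling, and since \<open>w0\<close> is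
  invariant under it, it acts on \<open>rep_space\<close> through \<open>O(n - 3)\<close> (\<open>stabiliser\<close>). The inclusion of
  \<open>rep_space\<close> and the continuous normalisation are therefore inverse to each other on orbit spaces,
  which gives the homeomorphism. Finally, a flat structure is conjugate symmetric, hence may be
  normalised to some \<open>C\<close> in \<open>rep_space\<close>; but then the Gauss-type curvature term in the plane of
  \<open>e 1\<close> and \<open>e 3\<close> is \<open>A \<bullet> A / 4 + 1 / 4\<close>, which is positive (\<open>rep_space_not_flat\<close>).
\<close>

section \<open>Calculus of smooth maps\<close>

lemma Ck_mono: "Ck (Suc k) f \<Longrightarrow> Ck k f"
proof (induction k arbitrary: f)
  case 0
  then show ?case
    by (auto simp: continuous_on_eq_continuous_at differentiable_imp_continuous_within)
qed auto

lemma Ck_const: "Ck k (\<lambda>p. c)"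
  by (induction k arbitrary: c) auto

lemma Ck_add: "Ck k f \<Longrightarrow> Ck k g \<Longrightarrow> Ck k (\<lambda>p. f p + g p)"
proof (induction k arbitrary: f g)
  case 0
  then show ?case by (auto intro: continuous_intros)
next
  case (Suc k)
  have D: "((\<lambda>p. f p + g p) has_derivative
      (\<lambda>v. frechet_derivative f (at p) v + frechet_derivative g (at p) v)) (at p)" for p
    by (rule has_derivative_add) (use Suc.prems in \<open>auto simp: frechet_derivative_works[symmetric]\<close>)
  have d: "frechet_derivative (\<lambda>p. f p + g p) (at p) v =
      frechet_derivative f (at p) v + frechet_derivative g (at p) v" for p v
    using frechet_derivative_at[OF D] by metis
  show ?case using Suc D by (auto simp: d differentiable_def)
qed

lemma Ck_bounded_bilinear:
  assumes h: "bounded_bilinear h"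
  shows "Ck k f \<Longrightarrow> Ck k g \<Longrightarrow> Ck k (\<lambda>p. h (f p) (g p))"
proof (induction k arbitrary: f g)
  case 0
  then show ?case
    by (auto intro: bounded_bilinear.continuous_on[OF h])
next
  case (Suc k)
  interpret h: bounded_bilinear h by fact
  have D: "((\<lambda>p. h (f p) (g p)) has_derivative
      (\<lambda>v. h (f p) (frechet_derivative g (at p) v) + h (frechet_derivative f (at p) v) (g p))) (at p)" for p
    by (rule h.FDERIV) (use Suc.prems in \<open>auto simp: frechet_derivative_works[symmetric]\<close>)
  have d: "frechet_derivative (\<lambda>p. h (f p) (g p)) (at p) v =
      h (f p) (frechet_derivative g (at p) v) + h (frechet_derivative f (at p) v) (g p)" for p v
    using frechet_derivative_at[OF D] by metis
  have "Ck k f" "Ck k g"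
    using Suc.prems Ck_mono by auto
  then show ?case
    using Suc.prems D by (auto simp: d differentiable_def intro!: Ck_add Suc.IH)
qed

lemma Ck_compose_affine:
  assumes A: "bounded_linear A"
  shows "Ck k f \<Longrightarrow> Ck k (\<lambda>p. f (A p + c))"
proof (induction k arbitrary: f)
  case 0
  have "continuous_on UNIV (\<lambda>p. A p + c)"
    by (intro continuous_intros bounded_linear.continuous_on[OF A])
  then show ?case
    using 0 by (auto intro: continuous_on_compose2)
next
  case (Suc k)
  have D: "((\<lambda>p. f (A p + c)) has_derivative (\<lambda>v. frechet_derivative f (at (A p + c)) (A v))) (at p)" for p
  proof -
    have "((\<lambda>p. A p + c) has_derivative A) (at p)"
      by (auto intro!: derivative_eq_intros bounded_linear.has_derivative[OF A])
    moreover have "(f has_derivative frechet_derivative f (at (A p + c))) (at (A p + c))"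
      using Suc.prems by (auto simp: frechet_derivative_works[symmetric])
    ultimately show ?thesis
      using has_derivative_compose by blast
  qed
  have d: "frechet_derivative (\<lambda>p. f (A p + c)) (at p) v = frechet_derivative f (at (A p + c)) (A v)" for p v
    using frechet_derivative_at[OF D] by metis
  show ?case
    using Suc D by (auto simp: d differentiable_def)
qed

lemma smooth_const [simp]: "smooth (\<lambda>p. c)"
  by (simp add: smooth_def Ck_const)

lemma smooth_add: "smooth f \<Longrightarrow> smooth g \<Longrightarrow> smooth (\<lambda>p. f p + g p)"
  by (simp add: smooth_def Ck_add)

lemma smooth_bounded_bilinear:
  "bounded_bilinear h \<Longrightarrow> smooth f \<Longrightarrow> smooth g \<Longrightarrow> smooth (\<lambda>p. h (f p) (g p))"
  by (simp add: smooth_def Ck_bounded_bilinear)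

lemma smooth_bilinear:
  fixes h :: "'a::euclidean_space \<Rightarrow> 'b::euclidean_space \<Rightarrow> 'c::real_normed_vector"
  shows "bilinear h \<Longrightarrow> smooth f \<Longrightarrow> smooth g \<Longrightarrow> smooth (\<lambda>p. h (f p) (g p))"
  by (simp add: smooth_bounded_bilinear bilinear_conv_bounded_bilinear)

lemma smooth_scaleR: "smooth f \<Longrightarrow> smooth g \<Longrightarrow> smooth (\<lambda>p. f p *\<^sub>R g p)"
  by (rule smooth_bounded_bilinear[OF bounded_bilinear_scaleR])

lemma smooth_inner: "smooth f \<Longrightarrow> smooth g \<Longrightarrow> smooth (\<lambda>p. f p \<bullet> g p)"
  by (rule smooth_bounded_bilinear[OF bounded_bilinear_inner])

lemma smooth_sum: "(\<And>i. i \<in> I \<Longrightarrow> smooth (f i)) \<Longrightarrow> smooth (\<lambda>p. \<Sum>i\<in>I. f i p)"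
  by (induction I rule: infinite_finite_induct) (auto intro: smooth_add)

lemma smooth_diff: "smooth f \<Longrightarrow> smooth g \<Longrightarrow> smooth (\<lambda>p. f p - g p)"
  using smooth_add[of f "\<lambda>p. (-1) *\<^sub>R g p"] smooth_scaleR[of "\<lambda>_. -1" g] by simp

lemma smooth_compose_affine: "bounded_linear A \<Longrightarrow> smooth f \<Longrightarrow> smooth (\<lambda>p. f (A p + c))"
  by (simp add: smooth_def Ck_compose_affine)

lemma smooth_linear:
  fixes A :: "'a::euclidean_space \<Rightarrow> 'b::euclidean_space"
  assumes "linear A"
  shows "smooth A"
proof -
  have A: "bounded_linear A"
    using assms linear_conv_bounded_linear by blast
  have D: "(A has_derivative A) (at p)" for p
    by (simp add: bounded_linear_imp_has_derivative[OF A])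
  then have "frechet_derivative A (at p) = A" for p
    using frechet_derivative_at by metis
  then have "Ck k A" for k
    using D A by (cases k) (auto simp: Ck_const differentiable_def
        intro: linear_continuous_on)
  then show ?thesis
    by (simp add: smooth_def)
qed

lemma smooth_id: "smooth (\<lambda>p. p)"
  by (simp add: smooth_linear linear_id[unfolded id_def])

text \<open>
  Expanding linear maps in the basis reduces their smoothness and continuity to that of finitely many
  coordinates.
\<close>

lemma linear_eq_sum_Basis:
  fixes A :: "'b::euclidean_space \<Rightarrow> 'c::real_vector"
  assumes "linear A"
  shows "A x = (\<Sum>i\<in>Basis. (x \<bullet> i) *\<^sub>R A i)"
proof -
  have "A x = A (\<Sum>i\<in>Basis. (x \<bullet> i) *\<^sub>R i)"
    by (simp only: euclidean_representation)
  also have "\<dots> = (\<Sum>i\<in>Basis. A ((x \<bullet> i) *\<^sub>R i))"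
    by (rule linear_sum[OF assms])
  finally show ?thesis
    by (simp only: linear_scale[OF assms])
qed

lemma smooth_linear_compose:
  fixes A :: "'b::euclidean_space \<Rightarrow> 'c::euclidean_space"
  assumes "linear A" "smooth f"
  shows "smooth (\<lambda>p. A (f p))"
proof -
  have "A (f p) = (\<Sum>i\<in>Basis. (f p \<bullet> i) *\<^sub>R A i)" for p
    by (rule linear_eq_sum_Basis[OF assms(1)])
  moreover have "smooth (\<lambda>p. \<Sum>i\<in>Basis. (f p \<bullet> i) *\<^sub>R A i)"
    by (intro smooth_sum smooth_scaleR smooth_inner assms smooth_const)
  ultimately show ?thesis by presburger
qed

lemma smooth_has_derivative:
  "smooth f \<Longrightarrow> (f has_derivative frechet_derivative f (at p)) (at p)"
  unfolding smooth_def frechet_derivative_works[symmetric] using Ck.simps(2) by blast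

lemma smooth_vf_deriv:
  assumes "smooth X" "smooth f"
  shows "smooth (vf_deriv X f)"
proof -
  have "vf_deriv X f p = (\<Sum>i\<in>Basis. (X p \<bullet> i) *\<^sub>R frechet_derivative f (at p) i)" for p
  proof -
    have "linear (frechet_derivative f (at p))"
      using smooth_has_derivative[OF assms(2)] has_derivative_linear by blast
    then show ?thesis
      unfolding vf_deriv_def by (rule linear_eq_sum_Basis)
  qed
  then have *: "vf_deriv X f = (\<lambda>p. \<Sum>i\<in>Basis. (X p \<bullet> i) *\<^sub>R frechet_derivative f (at p) i)"
    by blast
  have "smooth (\<lambda>p. frechet_derivative f (at p) i)" for i
    using assms(2) unfolding smooth_def by (metis Ck.simps(2))
  then have "smooth (\<lambda>p. \<Sum>i\<in>Basis. (X p \<bullet> i) *\<^sub>R frechet_derivative f (at p) i)"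
    by (intro smooth_sum smooth_scaleR smooth_inner assms smooth_const)
  then show ?thesis unfolding * .
qed

lemma smooth_vf_bracket: "smooth X \<Longrightarrow> smooth Y \<Longrightarrow> smooth (vf_bracket X Y)"
  unfolding vf_bracket_def[abs_def] by (intro smooth_diff smooth_vf_deriv)

lemma vf_derivI: "(f has_derivative f') (at p) \<Longrightarrow> vf_deriv X f p = f' (X p)"
  unfolding vf_deriv_def by (metis frechet_derivative_at)

lemma vf_deriv_const [simp]: "vf_deriv X (\<lambda>q. c) p = 0"
  by (simp add: vf_deriv_def)

lemma vf_deriv_linear_in_field:
  assumes "smooth f"
  shows "vf_deriv (\<lambda>p. X p + Y p) f p = vf_deriv X f p + vf_deriv Y f p"
    and "vf_deriv (\<lambda>p. h p *\<^sub>R X p) f p = h p *\<^sub>R vf_deriv X f p"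
  using has_derivative_linear[OF smooth_has_derivative[OF assms, of p]]
  by (simp_all add: vf_deriv_def linear_add linear_scale)

lemma vf_deriv_add:
  "smooth f \<Longrightarrow> smooth g \<Longrightarrow> vf_deriv X (\<lambda>q. f q + g q) p = vf_deriv X f p + vf_deriv X g p"
  by (rule vf_derivI[THEN trans, OF has_derivative_add[OF smooth_has_derivative smooth_has_derivative]])
    (auto simp: vf_deriv_def)

lemma vf_deriv_diff:
  "smooth f \<Longrightarrow> smooth g \<Longrightarrow> vf_deriv X (\<lambda>q. f q - g q) p = vf_deriv X f p - vf_deriv X g p"
  by (rule vf_derivI[THEN trans, OF has_derivative_diff[OF smooth_has_derivative smooth_has_derivative]])
    (auto simp: vf_deriv_def)

lemma vf_deriv_bounded_bilinear:
  assumes "bounded_bilinear h" "smooth f" "smooth g"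
  shows "vf_deriv X (\<lambda>q. h (f q) (g q)) p = h (f p) (vf_deriv X g p) + h (vf_deriv X f p) (g p)"
  by (rule vf_derivI[THEN trans, OF bounded_bilinear.FDERIV[OF assms(1)
          smooth_has_derivative[OF assms(2)] smooth_has_derivative[OF assms(3)]]])
    (auto simp: vf_deriv_def)

lemma vf_deriv_bilinear:
  fixes h :: "'a::euclidean_space \<Rightarrow> 'b::euclidean_space \<Rightarrow> 'c::real_normed_vector"
  shows "bilinear h \<Longrightarrow> smooth f \<Longrightarrow> smooth g \<Longrightarrow>
    vf_deriv X (\<lambda>q. h (f q) (g q)) p = h (f p) (vf_deriv X g p) + h (vf_deriv X f p) (g p)"
  by (simp add: vf_deriv_bounded_bilinear bilinear_conv_bounded_bilinear)

lemma vf_deriv_scaleR: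
  "smooth f \<Longrightarrow> smooth g \<Longrightarrow>
    vf_deriv X (\<lambda>q. f q *\<^sub>R g q) p = f p *\<^sub>R vf_deriv X g p + vf_deriv X f p *\<^sub>R g p"
  by (rule vf_deriv_bounded_bilinear[OF bounded_bilinear_scaleR])

lemma vf_deriv_linear:
  assumes "bounded_linear A" "smooth f"
  shows "vf_deriv X (\<lambda>q. A (f q)) p = A (vf_deriv X f p)"
  by (rule vf_derivI[THEN trans, OF bounded_linear.has_derivative[OF assms(1) smooth_has_derivative[OF assms(2)]]])
    (simp add: vf_deriv_def)

lemma vf_deriv_id: "vf_deriv X (\<lambda>q. q) p = X p"
  by (rule vf_derivI[THEN trans, OF has_derivative_ident]) simp

section \<open>The left-invariant frame\<close>

locale heisenberg_frame =
  fixes e :: "nat \<Rightarrow> 'a::euclidean_space" and n :: nat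
  assumes n_ge_3: "n \<ge> 3" and dim: "DIM('a) = n"
    and orthonormal: "\<forall>i\<in>{1..n}. \<forall>j\<in>{1..n}. e i \<bullet> e j = (if i = j then 1 else 0)"
begin

abbreviation br :: "'a \<Rightarrow> 'a \<Rightarrow> 'a" where "br \<equiv> heis_bracket e"
abbreviation m :: "'a \<Rightarrow> 'a \<Rightarrow> 'a" where "m \<equiv> heis_mult e"

lemma e_inner: "i \<in> {1..n} \<Longrightarrow> j \<in> {1..n} \<Longrightarrow> e i \<bullet> e j = (if i = j then 1 else 0)"
  using orthonormal by blast

lemma e_inner_heis [simp]:
  "e 1 \<bullet> e 1 = 1" "e 2 \<bullet> e 2 = 1" "e 3 \<bullet> e 3 = 1"
  "e 1 \<bullet> e 2 = 0" "e 1 \<bullet> e 3 = 0" "e 2 \<bullet> e 3 = 0"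
  "e 2 \<bullet> e 1 = 0" "e 3 \<bullet> e 1 = 0" "e 3 \<bullet> e 2 = 0"
  "e (Suc 0) \<bullet> e (Suc 0) = 1" "e (Suc 0) \<bullet> e 2 = 0" "e (Suc 0) \<bullet> e 3 = 0"
  "e 2 \<bullet> e (Suc 0) = 0" "e 3 \<bullet> e (Suc 0) = 0"
  using n_ge_3 by (simp_all add: e_inner)

lemma br_bilinear: "bilinear br"
  by (auto simp: bilinear_def linear_iff heis_bracket_def inner_simps algebra_simps)

lemmas br_simps =
  bilinear_ladd[OF br_bilinear] bilinear_radd[OF br_bilinear]
  bilinear_lsub[OF br_bilinear] bilinear_rsub[OF br_bilinear]
  bilinear_lmul[OF br_bilinear] bilinear_rmul[OF br_bilinear]
  bilinear_lzero[OF br_bilinear] bilinear_rzero[OF br_bilinear]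
  bilinear_lneg[OF br_bilinear] bilinear_rneg[OF br_bilinear]

text \<open>
  The bracket takes values in the line of \<open>e 3\<close>, which is central. This two-step nilpotency is why
  exponential coordinates make left translations affine and the left-invariant frame polynomial of
  degree one.
\<close>

lemma br_br [simp]: "br u (br v w) = 0" "br (br v w) u = 0"
  by (simp_all add: heis_bracket_def)

lemma br_skew: "br u v = - br v u"
  by (simp add: heis_bracket_def algebra_simps flip: scaleR_minus_left)

lemma br_self [simp]: "br u u = 0"
  by (simp add: heis_bracket_def)

lemma e_independent: "inj_on e {1..n}" "independent (e ` {1..n})"
proof -
  show "inj_on e {1..n}"
    using e_inner by (metis inj_onI zero_neq_one)
  have "pairwise orthogonal (e ` {1..n})"
    by (auto simp: pairwise_def orthogonal_def e_inner)
  moreover have "0 \<notin> e ` {1..n}"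
    using e_inner by fastforce
  ultimately show "independent (e ` {1..n})"
    using pairwise_orthogonal_independent by blast
qed

lemma span_e: "span (e ` {1..n}) = UNIV"
proof -
  have "card (e ` {1..n}) = DIM('a)"
    using card_image[OF e_independent(1)] dim by simp
  then show ?thesis
    using e_independent(2) card_eq_dim[of "e ` {1..n}" UNIV] by auto
qed

lemma e_expansion: "x = (\<Sum>i=1..n. (x \<bullet> e i) *\<^sub>R e i)"
proof -
  have "orthogonal (x - (\<Sum>i=1..n. (x \<bullet> e i) *\<^sub>R e i)) y" if "y \<in> e ` {1..n}" for y
    using that
    by (auto simp: orthogonal_def inner_diff_left inner_sum_left e_inner if_distrib cong: if_cong)
  then have "orthogonal (x - (\<Sum>i=1..n. (x \<bullet> e i) *\<^sub>R e i)) y" for y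
    using orthogonal_to_span[of y "e ` {1..n}" "x - (\<Sum>i=1..n. (x \<bullet> e i) *\<^sub>R e i)"] span_e by auto
  then have "x - (\<Sum>i=1..n. (x \<bullet> e i) *\<^sub>R e i) = 0"
    using orthogonal_self by blast
  then show ?thesis by (rule eq_iff_diff_eq_0[THEN iffD2])
qed

text \<open>
  \<open>dl p\<close> is the differential at the unit of the left translation by \<open>p\<close>, and \<open>fl p\<close> is its inverse.
  Accordingly \<open>E u\<close> is the left-invariant field with value \<open>u\<close> at the unit, and \<open>flat X\<close> is the field
  \<open>X\<close> written as a map into the Lie algebra by means of the left-invariant frame.
\<close>

definition fl :: "'a \<Rightarrow> 'a \<Rightarrow> 'a" where "fl p v = v - (1/2) *\<^sub>R br p v"
definition dl :: "'a \<Rightarrow> 'a \<Rightarrow> 'a" where "dl p v = v + (1/2) *\<^sub>R br p v"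

abbreviation flat :: "'a vfield \<Rightarrow> 'a vfield" where "flat X \<equiv> \<lambda>p. fl p (X p)"
abbreviation E :: "'a \<Rightarrow> 'a vfield" where "E u \<equiv> \<lambda>p. dl p u"

lemma dleft_eq: "dleft m p = dl p"
  by (auto simp: heis_mult_dleft dl_def)

lemma fl_dl [simp]: "fl p (dl p v) = v" and dl_fl [simp]: "dl p (fl p v) = v"
  by (simp_all add: fl_def dl_def br_simps)

lemma fl_br [simp]: "fl p (br u v) = br u v" and dl_br [simp]: "dl p (br u v) = br u v"
  by (simp_all add: fl_def dl_def br_simps)

lemma fl_0 [simp]: "fl 0 v = v" and dl_0 [simp]: "dl 0 v = v"
  by (simp_all add: fl_def dl_def br_simps)

lemma inv_dl: "inv (dl p) = fl p"
  by (rule inv_equality) simp_all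

lemma linear_fl: "linear (fl p)" and linear_dl: "linear (dl p)"
  by (auto simp: linear_iff fl_def dl_def br_simps algebra_simps)

lemma smooth_flat: "smooth X \<Longrightarrow> smooth (flat X)"
  unfolding fl_def
  by (intro smooth_diff smooth_scaleR smooth_const smooth_bilinear[OF br_bilinear] smooth_id)

lemma smooth_sharp: "smooth X \<Longrightarrow> smooth (\<lambda>p. dl p (X p))"
  unfolding dl_def
  by (intro smooth_add smooth_scaleR smooth_const smooth_bilinear[OF br_bilinear] smooth_id)

lemma smooth_E: "smooth (E u)"
  by (intro smooth_sharp smooth_const)

text \<open>
  This is the Maurer-Cartan equation: differentiating the frame itself contributes the pointwise
  Lie bracket.
\<close>

lemma flat_vf_bracket:
  assumes "smooth X" "smooth Y"
  shows "fl p (vf_bracket X Y p) =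
    vf_deriv X (flat Y) p - vf_deriv Y (flat X) p + br (fl p (X p)) (fl p (Y p))"
proof -
  \<comment> \<open>The frame is linear in the base point, whence the term \<open>br (X p) (Y p)\<close>.\<close>
  have *: "vf_deriv X (flat Y) p = vf_deriv X Y p - (1/2) *\<^sub>R (br (X p) (Y p) + br p (vf_deriv X Y p))"
    if "smooth X" "smooth Y" for X Y :: "'a vfield"
  proof -
    have "vf_deriv X (\<lambda>q. br q (Y q)) p = br p (vf_deriv X Y p) + br (X p) (Y p)"
      using vf_deriv_bilinear[OF br_bilinear smooth_id that(2)] by (simp add: vf_deriv_id)
    moreover have "smooth (\<lambda>q. br q (Y q))"
      by (intro smooth_bilinear[OF br_bilinear] smooth_id that)
    ultimately show ?thesis
      unfolding fl_def using that
      by (simp add: vf_deriv_diff vf_deriv_scaleR smooth_scaleR)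
  qed
  show ?thesis
    unfolding *[OF assms] *[OF assms(2) assms(1)]
    by (simp add: vf_bracket_def fl_def br_simps algebra_simps br_skew[of "Y p"])
      (metis field_sum_of_halves scaleR_add_left scaleR_one)
qed

text \<open>
  The connection \<open>d + B\<close> in the left-invariant frame. The value on fields that are not smooth is the
  default required by \<open>affine_connection\<close>.
\<close>

definition conn :: "('a \<Rightarrow> 'a \<Rightarrow> 'a) \<Rightarrow> 'a connection" where
  "conn B X Y = (if smooth X \<and> smooth Y
     then (\<lambda>p. dl p (vf_deriv X (flat Y) p + B (fl p (X p)) (fl p (Y p)))) else (\<lambda>p. 0))"

lemma flat_conn:
  "smooth X \<Longrightarrow> smooth Y \<Longrightarrow> fl p (conn B X Y p) = vf_deriv X (flat Y) p + B (fl p (X p)) (fl p (Y p))"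
  by (simp add: conn_def)

lemma smooth_conn:
  assumes "bilinear B"
  shows "smooth (conn B X Y)"
proof (cases "smooth X \<and> smooth Y")
  case True
  then have "smooth (\<lambda>p. dl p (vf_deriv X (flat Y) p + B (fl p (X p)) (fl p (Y p))))"
    by (intro smooth_sharp smooth_add smooth_vf_deriv smooth_flat smooth_bilinear[OF assms]) simp_all
  then show ?thesis
    using True by (simp add: conn_def)
qed (auto simp: conn_def)

lemma affine_connection_conn:
  assumes "bilinear B"
  shows "affine_connection (conn B)"
  unfolding affine_connection_def
proof (intro conjI allI impI; (elim conjE)?)
  note lin = linear_add[OF linear_fl] linear_scale[OF linear_fl]
    linear_add[OF linear_dl] linear_scale[OF linear_dl]
    bilinear_ladd[OF assms] bilinear_radd[OF assms] bilinear_lmul[OF assms] bilinear_rmul[OF assms]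
  fix X X' Y Y' :: "'a vfield" and f :: "'a \<Rightarrow> real"
  show "smooth (conn B X Y)"
    by (rule smooth_conn[OF assms])
  { assume s: "smooth X" "smooth X'" "smooth Y"
    show "conn B (\<lambda>p. X p + X' p) Y = (\<lambda>p. conn B X Y p + conn B X' Y p)"
      using s by (auto simp: conn_def smooth_add vf_deriv_linear_in_field smooth_flat lin) }
  { assume s: "smooth f" "smooth X" "smooth Y"
    show "conn B (\<lambda>p. f p *\<^sub>R X p) Y = (\<lambda>p. f p *\<^sub>R conn B X Y p)"
      using s by (auto simp: conn_def smooth_scaleR vf_deriv_linear_in_field smooth_flat lin
          scaleR_add_right) }
  { assume s: "smooth X" "smooth Y" "smooth Y'"
    show "conn B X (\<lambda>p. Y p + Y' p) = (\<lambda>p. conn B X Y p + conn B X Y' p)"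
      using s by (auto simp: conn_def smooth_add vf_deriv_add smooth_flat lin) }
  { assume s: "smooth f" "smooth X" "smooth Y"
    show "conn B X (\<lambda>p. f p *\<^sub>R Y p) = (\<lambda>p. vf_deriv X f p *\<^sub>R Y p + f p *\<^sub>R conn B X Y p)"
      using s by (auto simp: conn_def smooth_scaleR vf_deriv_scaleR smooth_flat lin scaleR_add_right) }
  { assume "\<not> (smooth X \<and> smooth Y)"
    then show "conn B X Y = (\<lambda>p. 0)"
      by (auto simp: conn_def) }
qed

end

lemma affine_connectionD:
  assumes "affine_connection D"
  shows "smooth X \<Longrightarrow> smooth Y \<Longrightarrow> smooth (D X Y)"
    and "smooth X \<Longrightarrow> smooth X' \<Longrightarrow> smooth Y \<Longrightarrow>
      D (\<lambda>p. X p + X' p) Y = (\<lambda>p. D X Y p + D X' Y p)"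
    and "smooth f \<Longrightarrow> smooth X \<Longrightarrow> smooth Y \<Longrightarrow>
      D (\<lambda>p. f p *\<^sub>R X p) Y = (\<lambda>p. f p *\<^sub>R D X Y p)"
    and "smooth X \<Longrightarrow> smooth Y \<Longrightarrow> smooth Y' \<Longrightarrow>
      D X (\<lambda>p. Y p + Y' p) = (\<lambda>p. D X Y p + D X Y' p)"
    and "smooth f \<Longrightarrow> smooth X \<Longrightarrow> smooth Y \<Longrightarrow>
      D X (\<lambda>p. f p *\<^sub>R Y p) = (\<lambda>p. vf_deriv X f p *\<^sub>R Y p + f p *\<^sub>R D X Y p)"
    and "\<not> (smooth X \<and> smooth Y) \<Longrightarrow> D X Y = (\<lambda>p. 0)"
  subgoal using assms unfolding affine_connection_def by simp
  subgoal using assms unfolding affine_connection_def by simp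
  subgoal using assms unfolding affine_connection_def by simp
  subgoal using assms unfolding affine_connection_def by simp
  subgoal using assms unfolding affine_connection_def by simp
  subgoal using assms unfolding affine_connection_def by simp
  done

text \<open>
  Together with its counterpart for the second argument, this makes a connection computable from its
  values on a frame.
\<close>

lemma affine_connection_sum_left:
  assumes D: "affine_connection D" and Y: "smooth Y"
    and s: "\<And>i. i \<in> I \<Longrightarrow> smooth (f i)" "\<And>i. i \<in> I \<Longrightarrow> smooth (X i)" and "finite I"
  shows "D (\<lambda>p. \<Sum>i\<in>I. f i p *\<^sub>R X i p) Y = (\<lambda>p. \<Sum>i\<in>I. f i p *\<^sub>R D (X i) Y p)"
  using \<open>finite I\<close> s
proof (induction I rule: finite_induct)
  case empty
  have "D (\<lambda>p. 0 *\<^sub>R 0) Y = (\<lambda>p. 0 *\<^sub>R D (\<lambda>p. 0) Y p)"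
    using affine_connectionD(3)[OF D smooth_const[of 0] smooth_const[of 0] Y] .
  then show ?case by simp
next
  case (insert i I)
  have "D (\<lambda>p. f i p *\<^sub>R X i p + (\<Sum>i\<in>I. f i p *\<^sub>R X i p)) Y =
      (\<lambda>p. D (\<lambda>p. f i p *\<^sub>R X i p) Y p + D (\<lambda>p. \<Sum>i\<in>I. f i p *\<^sub>R X i p) Y p)"
    by (intro affine_connectionD(2)[OF D] smooth_sum smooth_scaleR Y insert.prems insertI1 insertI2)
  moreover have "D (\<lambda>p. f i p *\<^sub>R X i p) Y = (\<lambda>p. f i p *\<^sub>R D (X i) Y p)"
    by (intro affine_connectionD(3)[OF D] Y insert.prems insertI1)
  ultimately show ?case
    using insert.hyps insert.IH[OF insert.prems] by simp
qed

lemma affine_connection_sum_right: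
  assumes D: "affine_connection D" and X: "smooth X"
    and s: "\<And>i. i \<in> I \<Longrightarrow> smooth (f i)" "\<And>i. i \<in> I \<Longrightarrow> smooth (Y i)" and "finite I"
  shows "D X (\<lambda>p. \<Sum>i\<in>I. f i p *\<^sub>R Y i p) =
    (\<lambda>p. \<Sum>i\<in>I. vf_deriv X (f i) p *\<^sub>R Y i p + f i p *\<^sub>R D X (Y i) p)"
  using \<open>finite I\<close> s
proof (induction I rule: finite_induct)
  case empty
  have "D X (\<lambda>p. 0 *\<^sub>R 0) = (\<lambda>p. vf_deriv X (\<lambda>q. 0::real) p *\<^sub>R 0 + 0 *\<^sub>R D X (\<lambda>p. 0) p)"
    using affine_connectionD(5)[OF D smooth_const[of 0] X smooth_const[of 0]] .
  then show ?case by simp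
next
  case (insert i I)
  have "D X (\<lambda>p. f i p *\<^sub>R Y i p + (\<Sum>i\<in>I. f i p *\<^sub>R Y i p)) =
      (\<lambda>p. D X (\<lambda>p. f i p *\<^sub>R Y i p) p + D X (\<lambda>p. \<Sum>i\<in>I. f i p *\<^sub>R Y i p) p)"
    by (intro affine_connectionD(4)[OF D] smooth_sum smooth_scaleR X insert.prems insertI1 insertI2)
  moreover have "D X (\<lambda>p. f i p *\<^sub>R Y i p) =
      (\<lambda>p. vf_deriv X (f i) p *\<^sub>R Y i p + f i p *\<^sub>R D X (Y i) p)"
    by (intro affine_connectionD(5)[OF D] X insert.prems insertI1)
  ultimately show ?case
    using insert.hyps insert.IH[OF insert.prems] by (simp add: add.assoc)
qed

context heisenberg_frame
begin

section \<open>The algebra of a left-invariant structure\<close>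

text \<open>
  The curvature of the connection \<open>d + B\<close> on left-invariant fields.
\<close>

definition alg_curv :: "('a \<Rightarrow> 'a \<Rightarrow> 'a) \<Rightarrow> 'a \<Rightarrow> 'a \<Rightarrow> 'a \<Rightarrow> 'a" where
  "alg_curv B u v w = B u (B v w) - B v (B u w) - B (br u v) w"

definition inner_product :: "('a \<Rightarrow> 'a \<Rightarrow> real) \<Rightarrow> bool" where
  "inner_product b \<longleftrightarrow> bilinear b \<and> (\<forall>u v. b u v = b v u) \<and> (\<forall>u. u \<noteq> 0 \<longrightarrow> b u u > 0)"

text \<open>
  On left-invariant fields the derivative of the metric coefficients vanishes, so this is the cubic form
  of the metric given by \<open>b\<close> and the connection given by \<open>B\<close>.
\<close>

definition cubic :: "('a \<Rightarrow> 'a \<Rightarrow> real) \<Rightarrow> ('a \<Rightarrow> 'a \<Rightarrow> 'a) \<Rightarrow> 'a tensor3" where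
  "cubic b B u v w = - b (B u v) w - b v (B u w)"

definition alg_stat :: "('a \<Rightarrow> 'a \<Rightarrow> real) \<Rightarrow> ('a \<Rightarrow> 'a \<Rightarrow> 'a) \<Rightarrow> bool" where
  "alg_stat b B \<longleftrightarrow> inner_product b \<and> bilinear B \<and> (\<forall>u v. B u v - B v u = br u v) \<and>
     (\<forall>u v w. cubic b B u v w = cubic b B v u w \<and> cubic b B u v w = cubic b B u w v)"

text \<open>
  The curvature of the dual product is minus the \<open>b\<close>-adjoint of the curvature of \<open>B\<close>
  (see \<open>alg_curv_dual\<close>). Equality of the two curvatures is therefore skewness of the curvature
  operators, a condition on \<open>b\<close> and \<open>B\<close> alone.
\<close>

definition alg_cs :: "('a \<Rightarrow> 'a \<Rightarrow> real) \<Rightarrow> ('a \<Rightarrow> 'a \<Rightarrow> 'a) \<Rightarrow> bool" where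
  "alg_cs b B \<longleftrightarrow> (\<forall>u v w x. b (alg_curv B u v w) x + b w (alg_curv B u v x) = 0)"

abbreviation linv :: "('a \<Rightarrow> 'a \<Rightarrow> real) \<Rightarrow> 'a metric" where "linv b \<equiv> left_inv_metric m b"

lemma linv_apply: "linv b p u v = b (fl p u) (fl p v)"
  by (simp add: left_inv_metric_def dleft_eq inv_dl)

lemma linv_0 [simp]: "linv b 0 = b"
  by (intro ext) (simp add: linv_apply)

lemma conn_E_0: "bilinear B \<Longrightarrow> conn B (E u) (E v) 0 = B u v"
  by (simp add: conn_def smooth_E)

text \<open>
  The second-order part of the curvature is the same for all products \<open>B\<close>. Hence the difference of the
  curvatures of two left-invariant connections is tensorial and algebraic.
\<close>

lemma flat_curvature:
  assumes B: "bilinear B" and s: "smooth X" "smooth Y" "smooth Z"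
  shows "fl p (curvature (conn B) X Y Z p) =
    vf_deriv X (vf_deriv Y (flat Z)) p - vf_deriv Y (vf_deriv X (flat Z)) p
      - vf_deriv (vf_bracket X Y) (flat Z) p
    + alg_curv B (fl p (X p)) (fl p (Y p)) (fl p (Z p))"
proof -
  have *: "fl p (conn B X (conn B Y Z) p) =
      vf_deriv X (vf_deriv Y (flat Z)) p + B (fl p (Y p)) (vf_deriv X (flat Z) p)
      + B (vf_deriv X (flat Y) p) (fl p (Z p))
      + B (fl p (X p)) (vf_deriv Y (flat Z) p) + B (fl p (X p)) (B (fl p (Y p)) (fl p (Z p)))"
    if "smooth X" "smooth Y" for X Y
  proof -
    have "flat (conn B Y Z) = (\<lambda>q. vf_deriv Y (flat Z) q + B (fl q (Y q)) (fl q (Z q)))"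
      using that s by (intro ext flat_conn)
    moreover have "smooth (\<lambda>q. B (fl q (Y q)) (fl q (Z q)))"
      using smooth_bilinear[OF B] that s smooth_flat by blast
    moreover have "fl p (conn B Y Z p) = vf_deriv Y (flat Z) p + B (fl p (Y p)) (fl p (Z p))"
      using that s by (intro flat_conn)
    ultimately show ?thesis
      using that s smooth_conn[OF B, of Y Z]
      by (simp add: flat_conn vf_deriv_add vf_deriv_bilinear[OF B] smooth_flat smooth_vf_deriv
          bilinear_radd[OF B])
  qed
  have "fl p (conn B (vf_bracket X Y) Z p) = vf_deriv (vf_bracket X Y) (flat Z) p
      + B (vf_deriv X (flat Y) p - vf_deriv Y (flat X) p + br (fl p (X p)) (fl p (Y p))) (fl p (Z p))"
    using s by (simp add: flat_conn smooth_vf_bracket flat_vf_bracket)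
  then show ?thesis
    unfolding curvature_def alg_curv_def linear_diff[OF linear_fl] *[OF s(1,2)] *[OF s(2,1)]
    by (simp add: bilinear_ladd[OF B] bilinear_lsub[OF B])
qed

lemma curvature_E_0:
  assumes "bilinear B"
  shows "curvature (conn B) (E u) (E v) (E w) 0 = alg_curv B u v w"
proof -
  have "vf_deriv (E u) (vf_deriv (E v) (flat (E w))) 0 = 0" for u v
  proof -
    have "vf_deriv (E v) (flat (E w)) = (\<lambda>p. 0)"
      by (intro ext) simp
    then show ?thesis by simp
  qed
  then show ?thesis
    using flat_curvature[OF assms smooth_E smooth_E smooth_E, of 0 u v w] by simp
qed

lemma torsion_free_conn_iff:
  assumes "bilinear B"
  shows "torsion_free (conn B) \<longleftrightarrow> (\<forall>u v. B u v - B v u = br u v)"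
proof
  assume t: "torsion_free (conn B)"
  have "vf_bracket (E u) (E v) 0 = br u v" for u v
    using flat_vf_bracket[OF smooth_E smooth_E, of 0 u v] by simp
  then show "\<forall>u v. B u v - B v u = br u v"
    using t smooth_E conn_E_0[OF assms] unfolding torsion_free_def by metis
next
  assume *: "\<forall>u v. B u v - B v u = br u v"
  show "torsion_free (conn B)"
    unfolding torsion_free_def
  proof (intro allI impI)
    fix X Y :: "'a vfield" and p
    assume s: "smooth X \<and> smooth Y"
    have "fl p (conn B X Y p - conn B Y X p) = fl p (vf_bracket X Y p)"
      using s * by (simp add: linear_diff[OF linear_fl] flat_conn flat_vf_bracket flip: *[rule_format])
    then show "conn B X Y p - conn B Y X p = vf_bracket X Y p"
      by (metis dl_fl)
  qed
qed

lemma vf_deriv_linv: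
  assumes "bilinear b" "smooth Y" "smooth Z"
  shows "vf_deriv X (\<lambda>q. linv b q (Y q) (Z q)) p =
    b (fl p (Y p)) (vf_deriv X (flat Z) p) + b (vf_deriv X (flat Y) p) (fl p (Z p))"
  unfolding linv_apply by (intro vf_deriv_bilinear assms smooth_flat)

text \<open>
  The product rule for \<open>b\<close> cancels the derivative parts of the two covariant derivatives.
\<close>

lemma cubic_form_conn:
  assumes b: "bilinear b" and B: "bilinear B" and s: "smooth X" "smooth Y" "smooth Z"
  shows "cubic_form (linv b) (conn B) X Y Z p = cubic b B (fl p (X p)) (fl p (Y p)) (fl p (Z p))"
  unfolding cubic_form_def vf_deriv_linv[OF b s(2,3)]
  using s by (simp add: linv_apply flat_conn cubic_def bilinear_ladd[OF b] bilinear_radd[OF b])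

lemma cubic_at_conn:
  "bilinear b \<Longrightarrow> bilinear B \<Longrightarrow> cubic_at (linv b) (conn B) 0 = cubic b B"
  by (intro ext) (simp add: cubic_at_def cubic_form_conn)

lemma riemannian_metric_linv_iff: "riemannian_metric (linv b) \<longleftrightarrow> inner_product b"
proof
  assume "riemannian_metric (linv b)"
  then show "inner_product b"
    unfolding riemannian_metric_def inner_product_def using linv_0 by metis
next
  assume b: "inner_product b"
  show "riemannian_metric (linv b)"
    unfolding riemannian_metric_def
  proof (intro conjI allI impI)
    show "smooth (\<lambda>p. linv b p u v)" for u v
      unfolding linv_apply
      by (rule smooth_bilinear) (use b in \<open>auto simp: inner_product_def intro: smooth_flat\<close>)
    show "bilinear (linv b p)" for p
      using b linear_compose[OF linear_fl[of p]] unfolding inner_product_def bilinear_def linv_apply[abs_def] o_def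
      by auto
    show "linv b p u v = linv b p v u" for p u v
      using b by (simp add: inner_product_def linv_apply)
    show "linv b p u u > 0" if "u \<noteq> 0" for p u
      using b that dl_fl[of p u] linear_0[OF linear_dl, of p]
      unfolding inner_product_def linv_apply by metis
  qed
qed

lemma statistical_structure_iff:
  assumes B: "bilinear B"
  shows "statistical_structure (linv b) (conn B) \<longleftrightarrow> alg_stat b B"
proof (cases "inner_product b")
  case True
  then have b: "bilinear b" by (simp add: inner_product_def)
  have "(\<forall>X Y Z p. smooth X \<and> smooth Y \<and> smooth Z \<longrightarrow>
        cubic_form (linv b) (conn B) X Y Z p = cubic_form (linv b) (conn B) Y X Z p \<and>
        cubic_form (linv b) (conn B) X Y Z p = cubic_form (linv b) (conn B) X Z Y p) \<longleftrightarrow>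
      (\<forall>u v w. cubic b B u v w = cubic b B v u w \<and> cubic b B u v w = cubic b B u w v)"
    (is "?l \<longleftrightarrow> ?r")
  proof
    assume l: ?l
    show ?r
    proof (intro allI)
      fix u v w
      show "cubic b B u v w = cubic b B v u w \<and> cubic b B u v w = cubic b B u w v"
        using l[rule_format, of "\<lambda>_. u" "\<lambda>_. v" "\<lambda>_. w" 0]
        by (simp add: cubic_form_conn[OF b B])
    qed
  next
    assume r: ?r
    show ?l
    proof (intro allI impI)
      fix X Y Z :: "'a vfield" and p assume s: "smooth X \<and> smooth Y \<and> smooth Z"
      show "cubic_form (linv b) (conn B) X Y Z p = cubic_form (linv b) (conn B) Y X Z p \<and>
        cubic_form (linv b) (conn B) X Y Z p = cubic_form (linv b) (conn B) X Z Y p"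
        using s r by (simp add: cubic_form_conn[OF b B])
    qed
  qed
  then show ?thesis
    using True by (simp add: statistical_structure_def alg_stat_def B affine_connection_conn
        torsion_free_conn_iff riemannian_metric_linv_iff)
next
  case False
  then show ?thesis
    by (simp add: statistical_structure_def alg_stat_def riemannian_metric_linv_iff)
qed

lemma inner_product_nondegenerate:
  assumes b: "inner_product b" and eq: "\<And>w. b u w = b v w"
  shows "u = v"
proof -
  have "b (u - v) (u - v) = 0"
    using b eq[of "u - v"] by (simp add: inner_product_def bilinear_lsub)
  then show ?thesis
    using b unfolding inner_product_def by (cases "u - v = 0") fastforce+
qed

text \<open>
  The Riesz isomorphism of \<open>b\<close>, as a linear map out of the coordinates of a functional; linearity
  is what makes the dual product of the next lemma bilinear.
\<close>

lemma inner_product_representation: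
  assumes b: "inner_product b"
  shows "\<exists>R. linear R \<and> (\<forall>f w. linear f \<longrightarrow> b (R (\<Sum>i\<in>Basis. f i *\<^sub>R i)) w = f w)"
proof -
  have bil: "bilinear b" using b by (simp add: inner_product_def)
  define A where "A y = (\<Sum>i\<in>Basis. b y i *\<^sub>R i)" for y :: 'a
  have A_inner: "A y \<bullet> i = b y i" if "i \<in> Basis" for y i
    using that by (simp add: A_def inner_sum_left inner_Basis if_distrib cong: if_cong)
  have lin: "linear (b y)" for y
    using bil by (simp add: bilinear_def)
  have linA: "linear A"
    by (auto simp: linear_iff A_def bilinear_ladd[OF bil] bilinear_lmul[OF bil]
        scaleR_add_left sum.distrib scaleR_sum_right)
  have "inj A"
  proof (rule linear_injective_0[OF linA, THEN iffD2], intro allI impI)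
    fix y assume "A y = 0"
    then have "b y i = 0" if "i \<in> Basis" for i
      using A_inner[OF that, of y] by simp
    then have "b y w = b 0 w" for w
      using linear_eq_sum_Basis[OF lin[of y], of w] bilinear_lzero[OF bil, of w] by simp
    then show "y = 0"
      using inner_product_nondegenerate[OF b] by blast
  qed
  then obtain R where R: "linear R" "\<forall>x. A (R x) = x"
    using linear_injective_isomorphism[OF linA] by blast
  have "b (R (\<Sum>i\<in>Basis. f i *\<^sub>R i)) w = f w" if "linear f" for f w
  proof -
    let ?x = "\<Sum>i\<in>Basis. f i *\<^sub>R i"
    have "b (R ?x) i = f i" if "i \<in> Basis" for i
      using A_inner[OF that, of "R ?x"] R that
      by (simp add: inner_sum_left inner_Basis if_distrib cong: if_cong)
    then show ?thesis
      using linear_eq_sum_Basis[OF lin[of "R ?x"], of w] linear_eq_sum_Basis[OF that, of w] by simp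
  qed
  with R show ?thesis by blast
qed

lemma algebraic_dual_exists:
  assumes b: "inner_product b" and B: "bilinear B"
  shows "\<exists>B'. bilinear B' \<and> (\<forall>u v w. b (B u v) w + b v (B' u w) = 0)"
proof -
  have bil: "bilinear b" and sym: "b u v = b v u" for u v
    using b by (auto simp: inner_product_def)
  obtain R where R: "linear R" "\<And>f w. linear f \<Longrightarrow> b (R (\<Sum>i\<in>Basis. f i *\<^sub>R i)) w = f w"
    using inner_product_representation[OF b] by auto
  define B' where "B' u w = R (\<Sum>i\<in>Basis. (- b (B u i) w) *\<^sub>R i)" for u w
  note lin = bilinear_ladd[OF bil] bilinear_radd[OF bil] bilinear_lmul[OF bil] bilinear_rmul[OF bil]
    bilinear_ladd[OF B] bilinear_radd[OF B] bilinear_lmul[OF B] bilinear_rmul[OF B]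
  have "linear (\<lambda>w. \<Sum>i\<in>Basis. (- b (B u i) w) *\<^sub>R i)"
      "linear (\<lambda>u. \<Sum>i\<in>Basis. (- b (B u i) w) *\<^sub>R i)" for u w
    by (intro linear_compose_sum ballI, simp add: linear_iff lin scaleR_add_left)+
  then have "bilinear B'"
    unfolding bilinear_def B'_def by (intro conjI allI linear_compose[OF _ R(1), unfolded o_def])
  moreover have "b (B u v) w + b v (B' u w) = 0" for u v w
  proof -
    have "linear (\<lambda>v. - b (B u v) w)"
      by (auto simp: linear_iff lin)
    from R(2)[OF this, of v] show ?thesis
      by (simp add: B'_def sym)
  qed
  ultimately show ?thesis by blast
qed

text \<open>
  Uniqueness holds because the defining equation, tested against arbitrary values at a point,
  determines the connection by nondegeneracy.
\<close>

lemma dual_connection_conn: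
  assumes b: "inner_product b" and B: "bilinear B" and B': "bilinear B'"
    and dual: "\<And>u v w. b (B u v) w + b v (B' u w) = 0"
  shows "dual_connection (linv b) (conn B) = conn B'"
  unfolding dual_connection_def
proof (rule the_equality)
  have bil: "bilinear b" using b by (simp add: inner_product_def)
  have sym: "b u v = b v u" for u v
    using b by (simp add: inner_product_def)
  have D: "vf_deriv X (\<lambda>q. linv b q (Y q) (Z q)) p =
      linv b p (conn B X Y p) (Z p) + linv b p (Y p) (conn B' X Z p)"
    if "smooth X" "smooth Y" "smooth Z" for X Y Z p
    unfolding vf_deriv_linv[OF bil that(2,3)]
    using that dual[of "fl p (X p)" "fl p (Y p)" "fl p (Z p)"]
    by (simp add: linv_apply flat_conn bilinear_ladd[OF bil] bilinear_radd[OF bil])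
  show "affine_connection (conn B') \<and> (\<forall>X Y Z p. smooth X \<and> smooth Y \<and> smooth Z \<longrightarrow>
      vf_deriv X (\<lambda>q. linv b q (Y q) (Z q)) p =
        linv b p (conn B X Y p) (Z p) + linv b p (Y p) (conn B' X Z p))"
    using D affine_connection_conn[OF B'] by blast
  fix D' assume D': "affine_connection D' \<and> (\<forall>X Y Z p. smooth X \<and> smooth Y \<and> smooth Z \<longrightarrow>
      vf_deriv X (\<lambda>q. linv b q (Y q) (Z q)) p =
        linv b p (conn B X Y p) (Z p) + linv b p (Y p) (D' X Z p))"
  show "D' = conn B'"
  proof (intro ext)
    fix X Z :: "'a vfield" and p
    show "D' X Z p = conn B' X Z p"
    proof (cases "smooth X \<and> smooth Z")
      case True
      have "b (fl p (D' X Z p)) w = b (fl p (conn B' X Z p)) w" for w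
      proof -
        have "linv b p (dl p w) (D' X Z p) = linv b p (dl p w) (conn B' X Z p)"
          using D'[THEN conjunct2, rule_format, of X "\<lambda>_. dl p w" Z p] D[of X "\<lambda>_. dl p w" Z p] True
          by simp
        then show ?thesis
          by (simp add: linv_apply sym)
      qed
      then show ?thesis
        using inner_product_nondegenerate[OF b] by (metis dl_fl)
    next
      case False
      then show ?thesis
        using D' affine_connectionD(6)[of D' X Z] by (auto simp: conn_def)
    qed
  qed
qed

text \<open>
  The operators of the dual product are minus the \<open>b\<close>-adjoints of those of \<open>B\<close>; passing to minus
  adjoints respects commutators.
\<close>

lemma alg_curv_dual:
  fixes b :: "'a \<Rightarrow> 'a \<Rightarrow> real"
  assumes b: "bilinear b" and dual: "\<And>u v w. b (B u v) w + b v (B' u w) = 0"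
  shows "b w (alg_curv B' u v x) = - b (alg_curv B u v w) x"
proof -
  have 1: "b v (B' u w) = - b (B u v) w" for u v w
    using dual[of u v w] by linarith
  show ?thesis
    by (simp add: alg_curv_def bilinear_lsub[OF b] bilinear_rsub[OF b] 1)
qed

lemma conjugate_symmetric_iff:
  assumes b: "inner_product b" and B: "bilinear B"
  shows "conjugate_symmetric (linv b) (conn B) \<longleftrightarrow> alg_cs b B"
proof -
  have bil: "bilinear b" and sym: "b u v = b v u" for u v
    using b by (auto simp: inner_product_def)
  obtain B' where B': "bilinear B'" and dual': "\<forall>u v w. b (B u v) w + b v (B' u w) = 0"
    using algebraic_dual_exists[OF b B] by metis
  note dual = dual'[rule_format]
  have curv: "b w (alg_curv B' u v x) = - b (alg_curv B u v w) x" for u v w x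
    by (rule alg_curv_dual[of b B B', OF bil dual])
  have dc: "dual_connection (linv b) (conn B) = conn B'"
    by (rule dual_connection_conn[of b B B', OF b B B' dual])
  have "conjugate_symmetric (linv b) (conn B) \<longleftrightarrow> (\<forall>u v w. alg_curv B u v w = alg_curv B' u v w)"
    unfolding conjugate_symmetric_def dc
  proof (rule iffI; intro allI impI)
    fix u v w
    assume *: "\<forall>X Y Z p. smooth X \<and> smooth Y \<and> smooth Z \<longrightarrow>
      curvature (conn B) X Y Z p = curvature (conn B') X Y Z p"
    show "alg_curv B u v w = alg_curv B' u v w"
      using *[rule_format, of "E u" "E v" "E w" 0] smooth_E
      by (simp add: curvature_E_0 B B')
  next
    fix X Y Z :: "'a vfield" and p
    assume "\<forall>u v w. alg_curv B u v w = alg_curv B' u v w" "smooth X \<and> smooth Y \<and> smooth Z"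
    then have "fl p (curvature (conn B) X Y Z p) = fl p (curvature (conn B') X Y Z p)"
      by (simp only: flat_curvature[OF B] flat_curvature[OF B'])
    then show "curvature (conn B) X Y Z p = curvature (conn B') X Y Z p"
      by (metis dl_fl)
  qed
  also have "\<dots> \<longleftrightarrow> alg_cs b B"
  proof
    assume eq: "\<forall>u v w. alg_curv B u v w = alg_curv B' u v w"
    show "alg_cs b B"
      unfolding alg_cs_def
    proof (intro allI)
      fix u v w x
      have "b w (alg_curv B u v x) = b w (alg_curv B' u v x)"
        by (simp only: eq[rule_format])
      then show "b (alg_curv B u v w) x + b w (alg_curv B u v x) = 0"
        using curv by simp
    qed
  next
    assume cs: "alg_cs b B"
    show "\<forall>u v w. alg_curv B u v w = alg_curv B' u v w"
    proof (intro allI inner_product_nondegenerate[OF b])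
      fix u v w x
      have "b (alg_curv B' u v w) x = - b w (alg_curv B u v x)"
        using curv[of x u v w] sym by metis
      then show "b (alg_curv B u v w) x = b (alg_curv B' u v w) x"
        using cs[unfolded alg_cs_def, rule_format, of u v w x] by linarith
    qed
  qed
  finally show ?thesis .
qed

lemma dually_flat_imp:
  "bilinear B \<Longrightarrow> dually_flat g (conn B) \<Longrightarrow> alg_curv B u v w = 0"
  unfolding dually_flat_def using curvature_E_0[of B u v w] smooth_E by simp

section \<open>Invariance and the reduction to the Lie algebra\<close>

lemma affine_map_facts:
  fixes A A' :: "'a \<Rightarrow> 'a" and c :: 'a
  assumes A: "linear A" "linear A'" "\<And>v. A' (A v) = v" "\<And>v. A (A' v) = v"
    and psi: "\<psi> = (\<lambda>q. A q + c)"
  shows "inv \<psi> = (\<lambda>p. A' p + - A' c)" "bij \<psi>"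
    "frechet_derivative \<psi> (at q) = A"
    "push_vf \<psi> X = (\<lambda>p. A (X (inv \<psi> p)))"
    "smooth X \<Longrightarrow> smooth (push_vf \<psi> X)"
proof -
  have bl: "bounded_linear A" "bounded_linear A'"
    using A linear_conv_bounded_linear by auto
  show i: "inv \<psi> = (\<lambda>p. A' p + - A' c)"
    by (rule inv_equality) (simp_all add: psi A(3,4) linear_add[OF A(1)] linear_add[OF A(2)] linear_diff[OF A(1)])
  show "bij \<psi>"
    by (rule o_bij[of "\<lambda>p. A' p + - A' c"])
      (auto simp: psi A(3,4) linear_add[OF A(1)] linear_add[OF A(2)] linear_diff[OF A(1)])
  show d: "frechet_derivative \<psi> (at q) = A" for q
  proof -
    have "(\<psi> has_derivative A) (at q)"
      unfolding psi by (auto intro!: derivative_eq_intros bounded_linear.has_derivative[OF bl(1)])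
    then show ?thesis
      using frechet_derivative_at by metis
  qed
  show p: "push_vf \<psi> X = (\<lambda>p. A (X (inv \<psi> p)))" for X
    by (simp add: push_vf_def fun_eq_iff d)
  show "smooth X \<Longrightarrow> smooth (push_vf \<psi> X)"
    unfolding p i by (intro smooth_linear_compose[OF A(1)] smooth_compose_affine[OF bl(2)])
qed

text \<open>
  Left translations and group automorphisms are both affine, with linear part \<open>A\<close>, and act on the
  left-invariant frame by a constant map \<open>L\<close>: the identity for a translation, the automorphism itself
  for an automorphism. This common generality serves both.
\<close>

lemma pull_affine:
  fixes A A' L :: "'a \<Rightarrow> 'a" and c :: 'a
  assumes A: "linear A" "linear A'" "\<And>v. A' (A v) = v" "\<And>v. A (A' v) = v"
    and psi: "\<psi> = (\<lambda>q. A q + c)" and L: "linear L"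
    and intertwine: "\<And>q v. fl (\<psi> q) (A v) = L (fl q v)"
  shows "pull_metric \<psi> (linv b') = linv (\<lambda>u v. b' (L u) (L v))"
    and "(\<And>u v. B' (L u) (L v) = L (B u v)) \<Longrightarrow> pull_connection \<psi> (conn B') = conn B"
proof -
  note F = affine_map_facts[OF A psi]
  show "pull_metric \<psi> (linv b') = linv (\<lambda>u v. b' (L u) (L v))"
    by (intro ext) (simp add: pull_metric_def linv_apply F(3) intertwine)
  assume BL: "\<And>u v. B' (L u) (L v) = L (B u v)"
  have ai: "\<psi> q = p \<longleftrightarrow> q = inv \<psi> p" for p q
    using F(2) by (metis bij_inv_eq_iff)
  have inv_inv: "inv (inv \<psi>) = \<psi>"
    using F(2) by (rule inv_inv_eq)
  note F' = affine_map_facts[OF A(2,1,4,3) F(1)]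
  have sm: "smooth (push_vf \<psi> X) \<longleftrightarrow> smooth X" for X
  proof
    assume "smooth (push_vf \<psi> X)"
    then have "smooth (push_vf (inv \<psi>) (push_vf \<psi> X))"
      by (rule F'(5))
    moreover have "push_vf (inv \<psi>) (push_vf \<psi> X) = X"
      unfolding F(4) F'(4) inv_inv by (simp add: A(3) inv_f_f bij_is_inj[OF F(2)])
    ultimately show "smooth X" by simp
  qed (rule F(5))
  have dlL: "dl (\<psi> q) (L w) = A (dl q w)" for q w
    using intertwine[of q "dl q w"] by (metis dl_fl fl_dl)
  show "pull_connection \<psi> (conn B') = conn B"
  proof (intro ext)
    fix X Y :: "'a vfield" and p
    show "pull_connection \<psi> (conn B') X Y p = conn B X Y p"
    proof (cases "smooth X \<and> smooth Y")
      case True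
      have fp: "fl q (push_vf \<psi> X q) = L (fl (inv \<psi> q) (X (inv \<psi> q)))" for X q
        using intertwine[of "inv \<psi> q" "X (inv \<psi> q)"]
        by (simp add: F(4) bij_is_surj[OF F(2)] surj_f_inv_f)
      have "vf_deriv (push_vf \<psi> X) (flat (push_vf \<psi> Y)) (\<psi> p) = L (vf_deriv X (flat Y) p)"
      proof -
        have "((\<lambda>q. L (fl (inv \<psi> q) (Y (inv \<psi> q)))) has_derivative
            (\<lambda>v. L (frechet_derivative (flat Y) (at p) (A' v)))) (at (\<psi> p))"
        proof -
          have "bounded_linear A'" using A(2) linear_conv_bounded_linear by blast
          then have "(inv \<psi> has_derivative A') (at (\<psi> p))"
            unfolding F(1)
            using has_derivative_add[OF bounded_linear_imp_has_derivative has_derivative_const,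
                of A' "- A' c" "at (\<psi> p)"] by simp
          moreover have "inv \<psi> (\<psi> p) = p"
            by (simp add: inv_f_f bij_is_inj[OF F(2)])
          moreover have "(flat Y has_derivative frechet_derivative (flat Y) (at p)) (at p)"
            by (rule smooth_has_derivative) (use True smooth_flat in blast)
          ultimately have "((\<lambda>q. flat Y (inv \<psi> q)) has_derivative
              (\<lambda>v. frechet_derivative (flat Y) (at p) (A' v))) (at (\<psi> p))"
            using has_derivative_compose[of "inv \<psi>" A' "\<psi> p" UNIV "flat Y"] by simp
          moreover have "bounded_linear L" using L linear_conv_bounded_linear by blast
          ultimately show ?thesis
            using bounded_linear.has_derivative by blast
        qed
        from vf_derivI[OF this, of "push_vf \<psi> X"] show ?thesis
          unfolding fp by (simp add: F(4) A(3) inv_f_f bij_is_inj[OF F(2)] vf_deriv_def)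
      qed
      moreover have "inv \<psi> (\<psi> p) = p"
        by (simp add: inv_f_f bij_is_inj[OF F(2)])
      ultimately have "conn B' (push_vf \<psi> X) (push_vf \<psi> Y) (\<psi> p) = A (conn B X Y p)"
        using True by (simp add: conn_def sm fp BL dlL flip: linear_add[OF L])
      then show ?thesis
        by (simp add: pull_connection_def F'(4) inv_inv A(3))
    next
      case False
      then show ?thesis
        by (auto simp: pull_connection_def F'(4) conn_def sm linear_0[OF A(2)])
    qed
  qed
qed

lemma translation_affine: "m a = (\<lambda>q. dl a q + a)"
  by (auto simp: heis_mult_def dl_def)

lemma dl_minus [simp]: "dl (- a) (dl a v) = v" "dl a (dl (- a) v) = v"
  by (simp_all add: dl_def br_simps)

lemma dl_mult: "dl (m a q) v = dl a (dl q v)"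
  by (simp add: dl_def heis_mult_def br_simps algebra_simps)

lemma translation_intertwine: "fl (m a q) (dl a v) = fl q v"
proof -
  have "dl a v = dl (m a q) (fl q v)"
    by (simp add: dl_mult)
  then show ?thesis by simp
qed

lemmas translation_facts =
  affine_map_facts[OF linear_dl linear_dl dl_minus translation_affine]

lemma pull_translation:
  "pull_metric (m a) (linv b) = linv b" "pull_connection (m a) (conn B) = conn B"
  using pull_affine[OF linear_dl linear_dl dl_minus translation_affine linear_id, of a]
  by (simp_all add: translation_intertwine)

lemma inv_translation: "inv (m a) = m (- a)"
  unfolding translation_facts(1) translation_affine[of "-a"] by (simp add: dl_def br_simps)

lemma push_translation_E: "push_vf (m a) (E u) = E u"
proof
  fix p
  have "dl p u = dl (m a (inv (m a) p)) u"
    by (simp add: surj_f_inv_f bij_is_surj[OF translation_facts(2)])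
  then show "push_vf (m a) (E u) p = E u p"
    by (simp add: translation_facts(4) dl_mult)
qed

lemma left_invariant_metric_eq:
  assumes "\<forall>a. pull_metric (m a) g = g"
  shows "g = linv (g 0)"
proof (intro ext)
  fix p u v
  have "g 0 (fl p u) (fl p v) = pull_metric (m p) g 0 (fl p u) (fl p v)"
    using assms by simp
  also have "\<dots> = g p u v"
    unfolding pull_metric_def translation_facts(3) by (simp add: heis_mult_unit)
  finally show "g p u v = linv (g 0) p u v"
    by (simp add: linv_apply)
qed

text \<open>
  Left-invariant fields are preserved by left translations, so the covariant derivative of one along
  another is again left-invariant; its value at the unit is the product \<open>B\<close>. The expansion of general
  fields in the frame then determines the connection.
\<close>

lemma left_invariant_connection_eq:
  assumes D: "affine_connection D" and inv: "\<forall>a. pull_connection (m a) D = D"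
  shows "\<exists>B. bilinear B \<and> D = conn B"
proof -
  define B where "B u v = D (E u) (E v) 0" for u v
  have DE: "D (E u) (E v) a = dl a (B u v)" for u v a
  proof -
    have "D (E u) (E v) = pull_connection (m a) D (E u) (E v)"
      using inv by simp
    also have "\<dots> = push_vf (m (- a)) (D (E u) (E v))"
      by (simp add: pull_connection_def push_translation_E inv_translation)
    finally have "D (E u) (E v) 0 = push_vf (m (- a)) (D (E u) (E v)) 0"
      by simp
    also have "\<dots> = dl (- a) (D (E u) (E v) a)"
      by (simp add: translation_facts(4) inv_translation heis_mult_unit)
    finally show ?thesis
      by (simp add: B_def)
  qed
  have E_lin: "E (u + u') = (\<lambda>p. E u p + E u' p)" "E (c *\<^sub>R u) = (\<lambda>p. c *\<^sub>R E u p)"  for u u' :: 'a and c :: real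
    by (simp_all add: linear_add[OF linear_dl] linear_scale[OF linear_dl])
  have bil: "bilinear B"
    unfolding bilinear_def linear_iff
  proof (intro conjI allI)
    show "B u (v + w) = B u v + B u w" "B (v + w) u = B v u + B w u" for u v w
      unfolding B_def E_lin
      using affine_connectionD(2,4)[OF D smooth_E smooth_E smooth_E] by simp_all
    show "B u (c *\<^sub>R v) = c *\<^sub>R B u v" "B (c *\<^sub>R v) u = c *\<^sub>R B v u" for u v and c :: real
      unfolding B_def E_lin
      using affine_connectionD(3,5)[OF D smooth_const[of c] smooth_E smooth_E] by simp_all
  qed
  have expand: "X = (\<lambda>p. \<Sum>i\<in>Basis. (fl p (X p) \<bullet> i) *\<^sub>R E i p)" for X :: "'a vfield"
  proof
    fix p
    show "X p = (\<Sum>i\<in>Basis. (fl p (X p) \<bullet> i) *\<^sub>R E i p)"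
      using linear_eq_sum_Basis[OF linear_dl, of p "fl p (X p)"] by simp
  qed
  have "D X Y p = conn B X Y p" for X Y p
  proof (cases "smooth X \<and> smooth Y")
    case True
    then have s: "smooth X" "smooth Y" by auto
    have coeff: "smooth (\<lambda>p. fl p (X p) \<bullet> i)" if "smooth X" for X i
      using that by (intro smooth_inner smooth_flat smooth_const)
    have DXE: "D X (E j) p = dl p (B (fl p (X p)) j)" for j
    proof -
      have "D X (E j) = (\<lambda>p. \<Sum>i\<in>Basis. (fl p (X p) \<bullet> i) *\<^sub>R D (E i) (E j) p)"
        by (subst expand[of X], rule affine_connection_sum_left[OF D smooth_E])
          (auto intro: coeff s smooth_E)
      moreover have "linear (\<lambda>v. dl p (B v j))"
        using bil linear_compose[OF _ linear_dl, unfolded o_def] unfolding bilinear_def by blast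
      ultimately show ?thesis
        using linear_eq_sum_Basis[of "\<lambda>v. dl p (B v j)" "fl p (X p)"] by (simp add: DE)
    qed
    have "D X Y = (\<lambda>p. \<Sum>j\<in>Basis. vf_deriv X (\<lambda>q. fl q (Y q) \<bullet> j) p *\<^sub>R E j p
        + (fl p (Y p) \<bullet> j) *\<^sub>R D X (E j) p)"
      by (subst expand[of Y], rule affine_connection_sum_right[OF D s(1)])
        (auto intro: coeff s smooth_E)
    then have "D X Y p = (\<Sum>j\<in>Basis. (vf_deriv X (flat Y) p \<bullet> j) *\<^sub>R dl p j)
        + (\<Sum>j\<in>Basis. (fl p (Y p) \<bullet> j) *\<^sub>R dl p (B (fl p (X p)) j))"
      by (simp add: sum.distrib DXE vf_deriv_linear[OF bounded_linear_inner_left smooth_flat[OF s(2)]])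
    moreover have "linear (\<lambda>v. dl p (B (fl p (X p)) v))"
      using bil linear_compose[OF _ linear_dl, unfolded o_def] unfolding bilinear_def by blast
    ultimately have "D X Y p = dl p (vf_deriv X (flat Y) p) + dl p (B (fl p (X p)) (fl p (Y p)))"
      using linear_eq_sum_Basis[OF linear_dl, of p "vf_deriv X (flat Y) p"]
        linear_eq_sum_Basis[of "\<lambda>v. dl p (B (fl p (X p)) v)" "fl p (Y p)"] by simp
    then show ?thesis
      using True by (simp add: conn_def linear_add[OF linear_dl])
  next
    case False
    then show ?thesis
      using affine_connectionD(6)[OF D, of X Y] by (auto simp: conn_def)
  qed
  then show ?thesis
    using bil by blast
qed

theorem LStat_eq: "LStat m = {(linv b, conn B) |b B. alg_stat b B}"
proof (intro set_eqI iffI)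
  fix s assume "s \<in> LStat m"
  then obtain g D where s: "s = (g, D)" and st: "statistical_structure g D"
    and inv: "\<forall>a. pull_metric (m a) g = g" "\<forall>a. pull_connection (m a) D = D"
    by (auto simp: LStat_def)
  obtain B where "bilinear B" "D = conn B"
    using left_invariant_connection_eq[OF _ inv(2)] st unfolding statistical_structure_def by blast
  moreover have "g = linv (g 0)"
    by (rule left_invariant_metric_eq[OF inv(1)])
  ultimately show "s \<in> {(linv b, conn B) |b B. alg_stat b B}"
    using st s statistical_structure_iff[of B "g 0"] by auto
next
  fix s assume "s \<in> {(linv b, conn B) |b B. alg_stat b B}"
  then show "s \<in> LStat m"
    using statistical_structure_iff pull_translation by (auto simp: LStat_def alg_stat_def)
qed

theorem LStatCS_eq: "LStatCS m = {(linv b, conn B) |b B. alg_stat b B \<and> alg_cs b B}"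
  unfolding LStatCS_def LStat_eq using conjugate_symmetric_iff by (auto simp: alg_stat_def)

text \<open>
  For uniqueness, the difference of two torsion-free connections with the same cubic form is symmetric
  in its two arguments, and skew after lowering the index; a tensor with both symmetries vanishes.
\<close>

lemma connection_of_eq:
  assumes st: "alg_stat b B"
  shows "connection_of (linv b) (left_inv_tensor3 m (cubic b B)) = conn B"
  unfolding connection_of_def
proof (rule the_equality)
  have b: "inner_product b" and bil: "bilinear b" and sym: "\<And>u v. b u v = b v u" and B: "bilinear B"
    and tor: "\<forall>u v. B u v - B v u = br u v"
    using st by (auto simp: alg_stat_def inner_product_def)
  have T: "left_inv_tensor3 m (cubic b B) p u v w = cubic b B (fl p u) (fl p v) (fl p w)" for p u v w
    by (simp add: left_inv_tensor3_def dleft_eq inv_dl)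
  show "affine_connection (conn B) \<and> torsion_free (conn B) \<and> (\<forall>X Y Z p. smooth X \<and> smooth Y \<and> smooth Z \<longrightarrow>
      cubic_form (linv b) (conn B) X Y Z p = left_inv_tensor3 m (cubic b B) p (X p) (Y p) (Z p))"
    using tor by (simp add: affine_connection_conn B torsion_free_conn_iff T cubic_form_conn bil)
  fix D
  assume D: "affine_connection D \<and> torsion_free D \<and> (\<forall>X Y Z p. smooth X \<and> smooth Y \<and> smooth Z \<longrightarrow>
      cubic_form (linv b) D X Y Z p = left_inv_tensor3 m (cubic b B) p (X p) (Y p) (Z p))"
  have tD: "torsion_free (conn B)"
    using tor torsion_free_conn_iff[OF B] by blast
  show "D = conn B"
  proof (intro ext)
    fix X Y :: "'a vfield" and p
    \<comment> \<open>The difference tensor at \<open>p\<close>: symmetric by \<open>symm\<close>, skew after lowering by \<open>skew\<close>.\<close>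
    define S where "S X Y = D X Y p - conn B X Y p" for X Y
    have skew: "linv b p (S X Y) (Z p) = - linv b p (S X Z) (Y p)"
      if "smooth X" "smooth Y" "smooth Z" for X Y Z
    proof -
      have "cubic_form (linv b) D X Y Z p = cubic_form (linv b) (conn B) X Y Z p"
        using D that by (simp add: T cubic_form_conn bil B)
      then show ?thesis
        by (simp add: cubic_form_def S_def linv_apply linear_diff[OF linear_fl]
            bilinear_lsub[OF bil] sym[of "fl p (Y p)"])
    qed
    have symm: "S X Y = S Y X" if "smooth X" "smooth Y" for X Y
    proof -
      have "D X Y p - D Y X p = conn B X Y p - conn B Y X p"
        using D tD that unfolding torsion_free_def by simp
      then show ?thesis
        by (simp add: S_def algebra_simps)
    qed
    show "D X Y p = conn B X Y p"
    proof (cases "smooth X \<and> smooth Y")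
      case True
      then have s: "smooth X" "smooth Y" by auto
      have "b (fl p (S X Y)) w = b 0 w" for w
      proof -
        define Z :: "'a vfield" where "Z = (\<lambda>_. dl p w)"
        have sZ: "smooth Z" by (simp add: Z_def)
        have "linv b p (S X Y) (Z p) = - linv b p (S X Y) (Z p)"
          by (metis add.inverse_inverse skew symm s sZ)
        then show ?thesis
          by (simp add: Z_def linv_apply bilinear_lzero[OF bil])
      qed
      then have "fl p (S X Y) = 0"
        by (rule inner_product_nondegenerate[OF b])
      then have "S X Y = 0"
        by (metis dl_fl linear_0 linear_dl)
      then show ?thesis
        by (simp add: S_def)
    next
      case False
      then show ?thesis
        using D affine_connectionD(6)[of D X Y] by (auto simp: conn_def)
    qed
  qed
qed

lemma levi_civita_conn:
  assumes "alg_stat b B" "cubic b B = (\<lambda>u v w. 0)"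
  shows "levi_civita (linv b) (conn B)"
proof -
  have bil: "bilinear b" and B: "bilinear B" and tor: "\<forall>u v. B u v - B v u = br u v"
    using assms(1) by (auto simp: alg_stat_def inner_product_def)
  have "vf_deriv X (\<lambda>q. linv b q (Y q) (Z q)) p =
      linv b p (conn B X Y p) (Z p) + linv b p (Y p) (conn B X Z p)"
    if "smooth X" "smooth Y" "smooth Z" for X Y Z p
    using cubic_form_conn[OF bil B that, of p] assms(2) by (simp add: cubic_form_def)
  then show ?thesis
    using tor by (simp add: levi_civita_def affine_connection_conn B torsion_free_conn_iff)
qed

section \<open>Automorphisms and orbits\<close>

definition lie_aut :: "('a \<Rightarrow> 'a) \<Rightarrow> bool" where
  "lie_aut \<phi> \<longleftrightarrow> linear \<phi> \<and> bij \<phi> \<and> (\<forall>u v. \<phi> (br u v) = br (\<phi> u) (\<phi> v))"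

text \<open>
  An element commutes with its multiples, so that \<open>\<phi> (k *\<^sub>R q) = k *\<^sub>R \<phi> q\<close> for natural \<open>k\<close>.
  Hence \<open>\<phi> p = k *\<^sub>R \<phi> (p /\<^sub>R k)\<close> for all positive \<open>k\<close>, and the right-hand side tends to the
  derivative of \<open>\<phi>\<close> at the unit, applied to \<open>p\<close>.
\<close>

lemma group_hom_linear:
  assumes s: "smooth \<phi>" and hom: "\<forall>p q. \<phi> (m p q) = m (\<phi> p) (\<phi> q)"
  shows "linear \<phi>"
proof -
  have m_self: "m (c *\<^sub>R q) q = (c + 1) *\<^sub>R q" for c and q :: 'a
    by (simp add: heis_mult_def br_simps algebra_simps)
  have zero: "\<phi> 0 = 0"
    using hom[rule_format, of 0 0] by (simp add: heis_mult_def br_simps)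
  have mult: "\<phi> (real k *\<^sub>R q) = real k *\<^sub>R \<phi> q" for k q
  proof (induction k)
    case (Suc k)
    have "\<phi> (real (Suc k) *\<^sub>R q) = \<phi> (m (real k *\<^sub>R q) q)"
      by (simp add: m_self add.commute)
    also have "\<dots> = m (real k *\<^sub>R \<phi> q) (\<phi> q)"
      by (simp only: hom Suc)
    finally show ?case
      by (simp add: m_self add.commute)
  qed (simp add: zero)
  define \<phi>' where "\<phi>' = frechet_derivative \<phi> (at 0)"
  have D: "(\<phi> has_derivative \<phi>') (at 0)"
    unfolding \<phi>'_def by (rule smooth_has_derivative[OF s])
  have lin: "linear \<phi>'"
    using D has_derivative_linear by blast
  have "\<phi> p = \<phi>' p" for p
  proof (rule euclidean_eqI)
    fix i :: 'a
    define f where "f t = \<phi> (t *\<^sub>R p) \<bullet> i" for t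
    have "((\<lambda>t. t *\<^sub>R p) has_derivative (\<lambda>t. t *\<^sub>R p)) (at 0)"
      by (auto intro!: derivative_eq_intros)
    from has_derivative_compose[OF this, of \<phi> \<phi>'] D
    have "((\<lambda>t. \<phi> (t *\<^sub>R p)) has_derivative (\<lambda>t. \<phi>' (t *\<^sub>R p))) (at 0)"
      by simp
    from has_derivative_inner_left[OF this, of i]
    have "(f has_derivative (\<lambda>t. (\<phi>' p \<bullet> i) * t)) (at 0)"
      by (simp add: f_def[abs_def] linear_scale[OF lin] mult.commute)
    then have "(f has_field_derivative \<phi>' p \<bullet> i) (at 0)"
      by (simp add: has_field_derivative_def)
    then have linv: "((\<lambda>h. f h / h) \<longlongrightarrow> \<phi>' p \<bullet> i) (at 0)"
      by (simp add: DERIV_def f_def zero)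
    \<comment> \<open>The sequence \<open>1 / (k + 1)\<close> along which the difference quotients are constant.\<close>
    have "filterlim (\<lambda>k. inverse (real (Suc k))) (at 0) sequentially"
      unfolding filterlim_at using LIMSEQ_inverse_real_of_nat by auto
    from filterlim_compose[OF linv this]
    have "(\<lambda>k. f (inverse (real (Suc k))) / inverse (real (Suc k))) \<longlonglongrightarrow> \<phi>' p \<bullet> i" .
    moreover have "f (inverse (real (Suc k))) / inverse (real (Suc k)) = \<phi> p \<bullet> i" for k
    proof -
      have "\<phi> p = real (Suc k) *\<^sub>R \<phi> (inverse (real (Suc k)) *\<^sub>R p)"
        by (simp flip: mult del: of_nat_Suc)
      then show ?thesis
        by (simp add: f_def divide_inverse mult.commute del: of_nat_Suc)
    qed
    ultimately show "\<phi> p \<bullet> i = \<phi>' p \<bullet> i"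
      by (simp add: LIMSEQ_const_iff)
  qed
  then have "\<phi> = \<phi>'" by blast
  then show ?thesis using lin by simp
qed

lemma linear_bij_inv:
  fixes \<phi> :: "'a \<Rightarrow> 'a"
  assumes "linear \<phi>" "bij \<phi>"
  shows "linear (inv \<phi>)" "inv \<phi> (\<phi> v) = v" "\<phi> (inv \<phi> v) = v"
proof -
  show *: "inv \<phi> (\<phi> v) = v" "\<phi> (inv \<phi> v) = v" for v
    using assms(2) by (simp_all add: bij_is_inj bij_is_surj surj_f_inv_f)
  show "linear (inv \<phi>)"
  proof (rule linearI)
    fix x y and c :: real
    have "\<phi> (inv \<phi> (x + y)) = \<phi> (inv \<phi> x + inv \<phi> y)"
      by (simp only: * linear_add[OF assms(1)])
    then show "inv \<phi> (x + y) = inv \<phi> x + inv \<phi> y"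
      using * by metis
    have "\<phi> (inv \<phi> (c *\<^sub>R x)) = \<phi> (c *\<^sub>R inv \<phi> x)"
      by (simp only: * linear_scale[OF assms(1)])
    then show "inv \<phi> (c *\<^sub>R x) = c *\<^sub>R inv \<phi> x"
      using * by metis
  qed
qed

lemma lie_autD:
  assumes "lie_aut \<phi>"
  shows "linear \<phi>" "bij \<phi>" "\<phi> (br u v) = br (\<phi> u) (\<phi> v)"
    "linear (inv \<phi>)" "inv \<phi> (\<phi> v) = v" "\<phi> (inv \<phi> v) = v"
  using assms linear_bij_inv[of \<phi>] by (auto simp: lie_aut_def)

lemma lie_aut_inv:
  assumes "lie_aut \<phi>"
  shows "lie_aut (inv \<phi>)"
proof -
  note F = lie_autD[OF assms]
  have "\<phi> (inv \<phi> (br u v)) = \<phi> (br (inv \<phi> u) (inv \<phi> v))" for u v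
    by (simp only: F)
  then have "inv \<phi> (br u v) = br (inv \<phi> u) (inv \<phi> v)" for u v
    by (metis F(5))
  then show ?thesis
    using F bij_imp_bij_inv by (auto simp: lie_aut_def)
qed

lemma lie_aut_comp: "lie_aut \<phi> \<Longrightarrow> lie_aut \<psi> \<Longrightarrow> lie_aut (\<phi> \<circ> \<psi>)"
  by (simp add: lie_aut_def linear_compose bij_comp)

lemma lie_aut_id: "lie_aut id"
  by (simp add: lie_aut_def linear_id)

theorem Aut_eq: "Aut m = {\<phi>. lie_aut \<phi>}"
proof (intro set_eqI iffI CollectI)
  fix \<phi> assume a: "\<phi> \<in> Aut m"
  then have lin: "linear \<phi>" and hom: "\<forall>p q. \<phi> (m p q) = m (\<phi> p) (\<phi> q)"
    using group_hom_linear by (auto simp: Aut_def)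
  have "\<phi> (br u v) = br (\<phi> u) (\<phi> v)" for u v
    using hom[rule_format, of u v]
    by (simp add: heis_mult_def linear_add[OF lin] linear_scale[OF lin])
  then show "lie_aut \<phi>"
    using a lin by (simp add: lie_aut_def Aut_def)
next
  fix \<phi> assume "\<phi> \<in> {\<phi>. lie_aut \<phi>}"
  then have "lie_aut \<phi>" by simp
  note F = lie_autD[OF this]
  show "\<phi> \<in> Aut m"
    by (simp add: Aut_def F smooth_linear heis_mult_def linear_add linear_scale)
qed

definition act_metric :: "real \<Rightarrow> ('a \<Rightarrow> 'a) \<Rightarrow> ('a \<Rightarrow> 'a \<Rightarrow> real) \<Rightarrow> 'a \<Rightarrow> 'a \<Rightarrow> real" where
  "act_metric r \<phi> b u v = r * b (inv \<phi> u) (inv \<phi> v)"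

definition act_product :: "('a \<Rightarrow> 'a) \<Rightarrow> ('a \<Rightarrow> 'a \<Rightarrow> 'a) \<Rightarrow> 'a \<Rightarrow> 'a \<Rightarrow> 'a" where
  "act_product \<phi> B u v = \<phi> (B (inv \<phi> u) (inv \<phi> v))"

lemma stat_act_eq:
  assumes "lie_aut \<phi>"
  shows "stat_act r \<phi> (linv b, conn B) = (linv (act_metric r \<phi> b), conn (act_product \<phi> B))"
proof -
  note F = lie_autD[OF assms] and F' = lie_autD[OF lie_aut_inv[OF assms]]
  have int: "fl (inv \<phi> q) (inv \<phi> v) = inv \<phi> (fl q v)" for q v
    by (simp add: fl_def linear_diff[OF F(4)] linear_scale[OF F(4)] F'(3))
  have psi: "inv \<phi> = (\<lambda>q. inv \<phi> q + 0)" by simp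
  note P = pull_affine[OF F(4,1,6,5) psi F(4) int]
  have "pull_connection (inv \<phi>) (conn B) = conn (act_product \<phi> B)"
    by (rule P(2)) (simp add: act_product_def F(5))
  moreover have "(\<lambda>p u v. r * pull_metric (inv \<phi>) (linv b) p u v) = linv (act_metric r \<phi> b)"
    unfolding P(1) by (intro ext) (simp add: linv_apply act_metric_def)
  ultimately show ?thesis
    by (simp add: stat_act_def)
qed

lemma cubic_act:
  assumes "lie_aut \<phi>"
  shows "cubic (act_metric r \<phi> b) (act_product \<phi> B) u v w =
    r * cubic b B (inv \<phi> u) (inv \<phi> v) (inv \<phi> w)"
  by (simp add: cubic_def act_metric_def act_product_def lie_autD(5)[OF assms] right_diff_distrib)

lemma alg_stat_act:
  assumes phi: "lie_aut \<phi>" and r: "r > 0" and st: "alg_stat b B"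
  shows "alg_stat (act_metric r \<phi> b) (act_product \<phi> B)"
proof -
  note F = lie_autD[OF phi] and F' = lie_autD[OF lie_aut_inv[OF phi]]
  have b: "bilinear b" "\<And>u v. b u v = b v u" "\<And>u. u \<noteq> 0 \<Longrightarrow> b u u > 0" and B: "bilinear B"
    and tor: "\<And>u v. B u v - B v u = br u v"
    and symm: "\<And>u v w. cubic b B u v w = cubic b B v u w" "\<And>u v w. cubic b B u v w = cubic b B u w v"
    using st by (simp_all add: alg_stat_def inner_product_def)
  have "inv \<phi> u \<noteq> 0" if "u \<noteq> 0" for u
    using that F(6)[of u] linear_0[OF F(1)] by auto
  moreover have "bilinear (act_metric r \<phi> b)"
    by (simp add: bilinear_def linear_iff act_metric_def linear_add[OF F(4)] linear_scale[OF F(4)]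
        bilinear_ladd[OF b(1)] bilinear_radd[OF b(1)] bilinear_lmul[OF b(1)] bilinear_rmul[OF b(1)]
        distrib_left mult.left_commute)
  ultimately have "inner_product (act_metric r \<phi> b)"
    using b(2,3) r by (simp add: inner_product_def act_metric_def)
  moreover have "bilinear (act_product \<phi> B)"
    by (simp add: bilinear_def linear_iff act_product_def linear_add[OF F(4)] linear_scale[OF F(4)]
        bilinear_ladd[OF B] bilinear_radd[OF B] bilinear_lmul[OF B] bilinear_rmul[OF B]
        linear_add[OF F(1)] linear_scale[OF F(1)])
  moreover have "act_product \<phi> B u v - act_product \<phi> B v u = br u v" for u v
    by (simp add: act_product_def linear_diff[OF F(1), symmetric] tor F)
  moreover note symm
  ultimately show ?thesis
    unfolding alg_stat_def cubic_act[OF phi] by simp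
qed

lemma alg_curv_act:
  assumes phi: "lie_aut \<phi>"
  shows "alg_curv (act_product \<phi> B) u v w = \<phi> (alg_curv B (inv \<phi> u) (inv \<phi> v) (inv \<phi> w))"
  using lie_autD[OF phi] lie_autD(3)[OF lie_aut_inv[OF phi]]
  by (simp add: alg_curv_def act_product_def linear_diff)

lemma alg_cs_act:
  assumes phi: "lie_aut \<phi>" and cs: "alg_cs b B"
  shows "alg_cs (act_metric r \<phi> b) (act_product \<phi> B)"
  unfolding alg_cs_def act_metric_def alg_curv_act[OF phi] lie_autD(5)[OF phi]
    distrib_left[symmetric] cs[unfolded alg_cs_def, rule_format] by simp

lemma act_comp:
  assumes "lie_aut \<phi>" "lie_aut \<psi>"
  shows "act_metric r \<phi> (act_metric r' \<psi> b) = act_metric (r * r') (\<phi> \<circ> \<psi>) b"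
    "act_product \<phi> (act_product \<psi> B) = act_product (\<phi> \<circ> \<psi>) B"
  using lie_autD(2)[OF assms(1)] lie_autD(2)[OF assms(2)]
  by (simp_all add: fun_eq_iff act_metric_def act_product_def o_inv_distrib)

lemma act_id: "act_metric 1 id b = b" "act_product id B = B"
  by (simp_all add: fun_eq_iff act_metric_def act_product_def)

lemma stat_orbit_eq:
  "stat_orbit m (linv b, conn B) =
    {(linv (act_metric r \<phi> b), conn (act_product \<phi> B)) |r \<phi>. r > 0 \<and> lie_aut \<phi>}"
  unfolding stat_orbit_def Aut_eq mem_Collect_eq
  by (intro Collect_cong arg_cong[of _ _ Ex] ext) (auto simp: stat_act_eq)

lemma stat_orbit_self: "(linv b, conn B) \<in> stat_orbit m (linv b, conn B)"
proof -
  have "(linv b, conn B) = (linv (act_metric 1 id b), conn (act_product id B)) \<and> (1::real) > 0 \<and> lie_aut id"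
    by (simp add: act_id lie_aut_id)
  then show ?thesis
    unfolding stat_orbit_eq by blast
qed

text \<open>
  One inclusion is composition of actions; the other is the same inclusion for the inverse.
\<close>

lemma stat_orbit_act:
  assumes phi: "lie_aut \<phi>" and r: "r > 0"
  shows "stat_orbit m (linv (act_metric r \<phi> b), conn (act_product \<phi> B)) = stat_orbit m (linv b, conn B)"
proof -
  have sub: "stat_orbit m (linv (act_metric r \<phi> b), conn (act_product \<phi> B)) \<subseteq> stat_orbit m (linv b, conn B)"
    if phi: "lie_aut \<phi>" and r: "r > 0" for r \<phi> b B
  proof
    fix s assume "s \<in> stat_orbit m (linv (act_metric r \<phi> b), conn (act_product \<phi> B))"
    then obtain r' \<psi> where "r' > 0" "lie_aut \<psi>"
      "s = (linv (act_metric (r' * r) (\<psi> \<circ> \<phi>) b), conn (act_product (\<psi> \<circ> \<phi>) B))"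
      unfolding stat_orbit_eq by (auto simp: act_comp phi)
    moreover have "r' * r > 0" "lie_aut (\<psi> \<circ> \<phi>)"
      using calculation r phi by (auto intro: lie_aut_comp)
    ultimately show "s \<in> stat_orbit m (linv b, conn B)"
      unfolding stat_orbit_eq by blast
  qed
  have "act_metric (1 / r) (inv \<phi>) (act_metric r \<phi> b) = b"
    "act_product (inv \<phi>) (act_product \<phi> B) = B"
    using r lie_autD[OF phi] lie_autD(5,6)[OF lie_aut_inv[OF phi]]
    by (simp_all add: fun_eq_iff act_metric_def act_product_def inv_inv_eq)
  with sub[OF lie_aut_inv[OF phi], of "1 / r" "act_metric r \<phi> b" "act_product \<phi> B"] sub[OF phi r]
  show ?thesis
    using r by (metis divide_pos_pos subset_antisym zero_less_one)
qed

lemma conn_inj: "bilinear B \<Longrightarrow> bilinear B' \<Longrightarrow> conn B = conn B' \<Longrightarrow> B = B'"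
  using conn_E_0 by (metis ext)

lemma linv_inj: "linv b = linv b' \<Longrightarrow> b = b'"
  by (metis linv_0)

section \<open>The standard inner product\<close>

abbreviation proj :: "'a \<Rightarrow> 'a" where "proj \<equiv> abelian_proj e n"

text \<open>
  The orthogonal projection onto the Heisenberg factor, complementary to \<open>proj\<close>.
\<close>

definition heis_part :: "'a \<Rightarrow> 'a" where
  "heis_part v = (v \<bullet> e 1) *\<^sub>R e 1 + (v \<bullet> e 2) *\<^sub>R e 2 + (v \<bullet> e 3) *\<^sub>R e 3"

lemma heis_part_plus_proj: "heis_part v + proj v = v"
proof -
  have "{1..n} = {1..3} \<union> {4..n}"
    using n_ge_3 by auto
  moreover have "{1..3::nat} = {1, 2, 3}" by auto
  ultimately have "(\<Sum>i=1..n. (v \<bullet> e i) *\<^sub>R e i) = heis_part v + proj v"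
    by (simp add: sum.union_disjoint heis_part_def abelian_proj_def add.assoc)
  then show ?thesis
    using e_expansion[of v] by simp
qed

lemma linear_proj: "linear proj"
  by (auto simp: linear_iff abelian_proj_def inner_simps scaleR_add_left sum.distrib scaleR_sum_right)

lemma proj_eq: "proj v = v - heis_part v"
  using heis_part_plus_proj[of v] by (simp add: algebra_simps)

lemma proj_heis [simp]: "proj (e 1) = 0" "proj (e 2) = 0" "proj (e 3) = 0" "proj (e (Suc 0)) = 0"
  by (simp_all add: proj_eq heis_part_def)

lemma proj_inner_heis [simp]:
  "proj v \<bullet> e 1 = 0" "proj v \<bullet> e 2 = 0" "proj v \<bullet> e 3 = 0" "proj v \<bullet> e (Suc 0) = 0"
  by (simp_all add: proj_eq heis_part_def inner_simps)

lemma proj_proj [simp]: "proj (proj v) = proj v"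
  by (simp add: proj_eq[of "proj v"] heis_part_def)

lemma proj_br [simp]: "proj (br u v) = 0"
  by (simp add: heis_bracket_def linear_scale[OF linear_proj])

lemma w0_eq: "w0 e X Y = (X \<bullet> e 1) * (Y \<bullet> e 1) + (X \<bullet> e 2) * (Y \<bullet> e 2) + (X \<bullet> e 3) * (Y \<bullet> e 3)"
proof -
  have "{1..3::nat} = {1, 2, 3}" by auto
  then show ?thesis by (simp add: w0_def sym_prod11_def algebra_simps)
qed

lemma w0_inner: "w0 e X Y = X \<bullet> Y - proj X \<bullet> proj Y"
proof -
  have "proj X \<bullet> proj Y = (X - heis_part X) \<bullet> proj Y"
    by (simp add: proj_eq[of X])
  also have "\<dots> = X \<bullet> proj Y"
    by (simp add: heis_part_def inner_simps inner_commute[of _ "proj Y"])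
  finally show ?thesis
    by (simp add: proj_eq[of Y] heis_part_def w0_eq inner_simps)
qed

lemma sym_tensors3D:
  assumes "C \<in> sym_tensors3"
  shows "linear (C u v)" "C u v w = C v u w" "C u v w = C u w v"
    "C (u + u') v w = C u v w + C u' v w" "C u (v + v') w = C u v w + C u v' w"
    "C u v (w + w') = C u v w + C u v w'"
    "C (c *\<^sub>R u) v w = c * C u v w" "C u (c *\<^sub>R v) w = c * C u v w" "C u v (c *\<^sub>R w) = c * C u v w"
    "C 0 v w = 0" "C u 0 w = 0" "C u v 0 = 0"
proof -
  show l: "linear (C u v)" and s: "C u v w = C v u w" "C u v w = C u w v" for u v w
    using assms unfolding sym_tensors3_def by blast+
  show a: "C u v (w + w') = C u v w + C u v w'" for u v w w' by (simp add: linear_add[OF l])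
  show m: "C u v (c *\<^sub>R w) = c * C u v w" for u v w c by (simp add: linear_scale[OF l])
  show z: "C u v 0 = 0" for u v by (simp add: linear_0[OF l])
  show a2: "C u (v + v') w = C u v w + C u v' w" for u v v' w using a s(2) by metis
  show m2: "C u (c *\<^sub>R v) w = c * C u v w" for u v w c using m s(2) by metis
  show z2: "C u 0 w = 0" for u w using z s(2) by metis
  show "C (u + u') v w = C u v w + C u' v w" using a2 s(1) by metis
  show "C (c *\<^sub>R u) v w = c * C u v w" using m2 s(1) by metis
  show "C 0 v w = 0" using z2 s(1) by metis
qed

text \<open>
  The Levi-Civita product of the standard inner product, from the Koszul formula: the only product
  with skew operators \<open>lc u\<close> (\<open>lc_skew\<close>) and commutator \<open>br\<close> (\<open>lc_torsion\<close>).
\<close>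

definition lc :: "'a \<Rightarrow> 'a \<Rightarrow> 'a" where
  "lc u v = (((v \<bullet> e 3) * (u \<bullet> e 2) + (u \<bullet> e 3) * (v \<bullet> e 2)) / 2) *\<^sub>R e 1
     - (((v \<bullet> e 3) * (u \<bullet> e 1) + (u \<bullet> e 3) * (v \<bullet> e 1)) / 2) *\<^sub>R e 2
     + (((u \<bullet> e 1) * (v \<bullet> e 2) - (u \<bullet> e 2) * (v \<bullet> e 1)) / 2) *\<^sub>R e 3"

definition raise :: "'a tensor3 \<Rightarrow> 'a \<Rightarrow> 'a \<Rightarrow> 'a" where
  "raise C u v = (\<Sum>i\<in>Basis. C u v i *\<^sub>R i)"

text \<open>
  The product with cubic form \<open>C\<close>: subtracting half of the index-raised tensor from a metric
  connection changes its cubic form from \<open>0\<close> to \<open>C\<close>.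
\<close>

definition prod_of :: "'a tensor3 \<Rightarrow> 'a \<Rightarrow> 'a \<Rightarrow> 'a" where
  "prod_of C u v = lc u v - (1/2) *\<^sub>R raise C u v"

lemma lc_bilinear: "bilinear lc"
  by (auto simp: bilinear_def linear_iff lc_def inner_simps algebra_simps add_divide_distrib diff_divide_distrib)

lemma lc_torsion: "lc u v - lc v u = br u v"
proof -
  have "lc u v - lc v u = ((((u \<bullet> e 1) * (v \<bullet> e 2) - (u \<bullet> e 2) * (v \<bullet> e 1)) / 2)
      - (((v \<bullet> e 1) * (u \<bullet> e 2) - (v \<bullet> e 2) * (u \<bullet> e 1)) / 2)) *\<^sub>R e 3"
    unfolding scaleR_diff_left by (simp add: lc_def add.commute)
  then show ?thesis
    by (simp add: heis_bracket_def mult.commute flip: diff_divide_distrib)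
qed

lemma lc_skew: "lc u v \<bullet> w = - (v \<bullet> lc u w)"
  by (simp add: lc_def inner_simps inner_commute[of "e 1" v] inner_commute[of "e 2" v]
      inner_commute[of "e 3" v] inner_commute[of "e 1" w] inner_commute[of "e 2" w]
      inner_commute[of "e 3" w] field_simps del: One_nat_def)

lemma proj_lc [simp]: "proj (lc u v) = 0"
  by (simp add: lc_def linear_scale[OF linear_proj] linear_diff[OF linear_proj] linear_add[OF linear_proj])

lemma raise_inner: "C \<in> sym_tensors3 \<Longrightarrow> raise C u v \<bullet> w = C u v w"
  using linear_eq_sum_Basis[OF sym_tensors3D(1), of C u v w]
  by (simp add: raise_def inner_sum_left inner_commute[of w] mult.commute)

lemma raise_bilinear: "C \<in> sym_tensors3 \<Longrightarrow> bilinear (raise C)"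
  by (simp add: bilinear_def linear_iff raise_def sym_tensors3D sum.distrib scaleR_add_left
      scaleR_sum_right)

lemma inner_product_inner: "inner_product (\<bullet>)"
  by (auto simp: inner_product_def inner_commute bilinear_def linear_iff inner_simps)

lemma prod_of_bilinear: "C \<in> sym_tensors3 \<Longrightarrow> bilinear (prod_of C)"
  using lc_bilinear raise_bilinear[of C]
  unfolding bilinear_def linear_iff prod_of_def by (simp add: algebra_simps)

lemma cubic_prod_of:
  assumes "C \<in> sym_tensors3"
  shows "cubic (\<bullet>) (prod_of C) = C"
proof (intro ext)
  fix u v w
  have "v \<bullet> raise C u w = C u v w"
    using assms by (metis inner_commute raise_inner sym_tensors3D(3))
  then show "cubic (\<bullet>) (prod_of C) u v w = C u v w"
    using assms by (simp add: cubic_def prod_of_def inner_simps raise_inner lc_skew)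
qed

lemma alg_stat_prod_of:
  assumes C: "C \<in> sym_tensors3"
  shows "alg_stat (\<bullet>) (prod_of C)"
proof -
  have "raise C u v = raise C v u" for u v
    by (simp add: raise_def sym_tensors3D(2)[OF C, of u v])
  then show ?thesis
    using sym_tensors3D(2,3)[OF C] lc_torsion
    by (simp add: alg_stat_def inner_product_inner prod_of_bilinear[OF C] cubic_prod_of[OF C])
      (simp add: prod_of_def)
qed

lemma cubic_sym_tensor:
  assumes "alg_stat b B"
  shows "cubic b B \<in> sym_tensors3"
proof -
  have b: "bilinear b" and B: "bilinear B"
    and s: "\<forall>u v w. cubic b B u v w = cubic b B v u w \<and> cubic b B u v w = cubic b B u w v"
    using assms by (auto simp: alg_stat_def inner_product_def)
  have "linear (cubic b B u v)" for u v
    by (simp add: linear_iff cubic_def bilinear_radd[OF b] bilinear_rmul[OF b]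
        bilinear_radd[OF B] bilinear_rmul[OF B] algebra_simps)
  with s show ?thesis by (simp add: sym_tensors3_def)
qed

text \<open>
  Over the standard inner product a structure is determined by its cubic form, by the uniqueness in
  \<open>connection_of_eq\<close>.
\<close>

lemma alg_stat_inner_eq:
  assumes "alg_stat (\<bullet>) B"
  shows "B = prod_of (cubic (\<bullet>) B)"
proof -
  have C: "cubic (\<bullet>) B \<in> sym_tensors3"
    by (rule cubic_sym_tensor[OF assms])
  have "conn B = conn (prod_of (cubic (\<bullet>) B))"
    using connection_of_eq[OF assms] connection_of_eq[OF alg_stat_prod_of[OF C]] cubic_prod_of[OF C]
    by simp
  then show ?thesis
    by (intro conn_inj) (use assms prod_of_bilinear[OF C] in \<open>auto simp: alg_stat_def\<close>)
qed

text \<open>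
  The covariant derivative of \<open>C\<close> for the Levi-Civita product is symmetric in its first two arguments.
  The terms with \<open>lc u v\<close> and \<open>lc v u\<close> in the first slot combine to the bracket, as \<open>lc\<close> has no torsion.
\<close>

definition codazzi :: "'a tensor3 \<Rightarrow> bool" where
  "codazzi C \<longleftrightarrow> (\<forall>u v w x. C v w (lc u x) + C v (lc u w) x - C u w (lc v x) - C u (lc v w) x
     + C (br u v) w x = 0)"

lemma prod_of_twice:
  assumes C: "C \<in> sym_tensors3"
  shows "prod_of C u (prod_of C v w) \<bullet> x = - (lc v w \<bullet> lc u x) + C v w (lc u x) / 2
    - C u x (lc v w) / 2 + raise C u x \<bullet> raise C v w / 4"
proof -
  note R = raise_inner[OF C]
  have "C u (prod_of C v w) x = raise C u x \<bullet> prod_of C v w"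
    by (simp only: R sym_tensors3D(3)[OF C, of u "prod_of C v w" x])
  also have "\<dots> = C u x (lc v w) - raise C u x \<bullet> raise C v w / 2"
    by (simp only: prod_of_def inner_diff_right inner_scaleR_right R mult_1 times_divide_eq_left)
  finally have 1: "C u (prod_of C v w) x = C u x (lc v w) - raise C u x \<bullet> raise C v w / 2" .
  have "prod_of C u (prod_of C v w) \<bullet> x = - (prod_of C v w \<bullet> lc u x) - C u (prod_of C v w) x / 2"
    by (simp add: prod_of_def[of C u] inner_diff_left R lc_skew[of u _ x])
  moreover have "prod_of C v w \<bullet> lc u x = lc v w \<bullet> lc u x - C v w (lc u x) / 2"
    by (simp add: prod_of_def inner_diff_left R)
  ultimately show ?thesis
    unfolding 1 by (simp add: field_simps)
qed

text \<open>
  With \<open>B = lc - raise C / 2\<close>, the curvature splits into terms of degree \<open>0\<close>, \<open>1\<close> and \<open>2\<close> in \<open>C\<close>. The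
  even ones are commutators of operators that are all skew, or all symmetric, and so are skew; the
  skewness of the curvature concerns the linear part only.
\<close>

lemma alg_cs_iff_codazzi:
  assumes C: "C \<in> sym_tensors3"
  shows "alg_cs (\<bullet>) (prod_of C) \<longleftrightarrow> codazzi C"
proof -
  have s: "C u x (lc v w) = C u (lc v w) x" for u v w x
    by (rule sym_tensors3D(3)[OF C])
  have br: "prod_of C (br u v) w \<bullet> x = lc (br u v) w \<bullet> x - C (br u v) w x / 2" for u v w x
    by (simp add: prod_of_def inner_simps raise_inner[OF C])
  have "alg_curv (prod_of C) u v w \<bullet> x + w \<bullet> alg_curv (prod_of C) u v x =
      C v w (lc u x) + C v (lc u w) x - C u w (lc v x) - C u (lc v w) x + C (br u v) w x" for u v w x
  proof -
    have skew: "lc (br u v) w \<bullet> x + lc (br u v) x \<bullet> w = 0"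
      using lc_skew[of "br u v" w x] by (simp add: inner_commute)
    have sy: "C v x (lc u w) = C v (lc u w) x" "C u x (lc v w) = C u (lc v w) x"
      "C (br u v) x w = C (br u v) w x"
      by (rule sym_tensors3D(3)[OF C])+
    have comm: "lc v w \<bullet> lc u x = lc u x \<bullet> lc v w" "lc v x \<bullet> lc u w = lc u w \<bullet> lc v x"
      "raise C u x \<bullet> raise C v w = raise C v w \<bullet> raise C u x"
      "raise C u w \<bullet> raise C v x = raise C v x \<bullet> raise C u w"
      by (rule inner_commute)+
    show ?thesis
      unfolding inner_commute[of w] alg_curv_def inner_diff_left prod_of_twice[OF C] br comm sy
      using skew by (simp add: field_simps)
  qed
  then show ?thesis
    by (simp add: alg_cs_def codazzi_def)
qed

lemma lc_heis [simp]:
  "lc (e 1) (e 1) = 0" "lc (e 2) (e 2) = 0" "lc (e 3) (e 3) = 0"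
  "lc (e 1) (e 2) = (1/2) *\<^sub>R e 3" "lc (e 2) (e 1) = - (1/2) *\<^sub>R e 3"
  "lc (e 1) (e 3) = - (1/2) *\<^sub>R e 2" "lc (e 3) (e 1) = - (1/2) *\<^sub>R e 2"
  "lc (e 2) (e 3) = (1/2) *\<^sub>R e 1" "lc (e 3) (e 2) = (1/2) *\<^sub>R e 1"
  by (simp_all add: lc_def heis_bracket_def del: One_nat_def)

lemma br_heis [simp]:
  "br (e 1) (e 2) = e 3" "br (e 1) (e 3) = 0" "br (e 2) (e 3) = 0"
  by (simp_all add: heis_bracket_def del: One_nat_def)

lemma lc_proj [simp]: "lc u (proj v) = 0" "lc (proj v) u = 0" "br (proj v) u = 0" "br u (proj v) = 0"
  by (simp_all add: lc_def heis_bracket_def del: One_nat_def)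

text \<open>
  The factor of the symmetric product is absorbed into the linear form, so that elements of the
  representing space have a normal form with two parameters.
\<close>

lemma rep_space_iff:
  "C \<in> rep_space e n \<longleftrightarrow> (\<exists>a T. a \<in> S1_abelian e n \<and> T \<in> S3_abelian e n \<and>
     C = (\<lambda>X Y Z. w0 e X Y * a Z + w0 e X Z * a Y + w0 e Y Z * a X + T X Y Z))" (is "?l \<longleftrightarrow> ?r")
proof -
  have w: "w0 e X Y = w0 e Y X" for X Y by (simp add: w0_eq)
  have sp: "sym_prod21 (\<lambda>X Y. c * w0 e X Y) a X Y Z =
      w0 e X Y * (c / 3 * a Z) + w0 e X Z * (c / 3 * a Y) + w0 e Y Z * (c / 3 * a X)" for c a X Y Z
    by (simp add: sym_prod21_def w[of Y X] w[of Z X] w[of Z Y] field_simps)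
  have scale: "(\<lambda>X. c * a X) \<in> S1_abelian e n" if "a \<in> S1_abelian e n" for c a
    using that by (auto simp: S1_abelian_def linear_iff algebra_simps)
  show ?thesis
  proof
    assume ?l
    then obtain c a T where *: "a \<in> S1_abelian e n" "T \<in> S3_abelian e n"
      "C = (\<lambda>X Y Z. sym_prod21 (\<lambda>X Y. c * w0 e X Y) a X Y Z + T X Y Z)"
      by (auto simp: rep_space_def w0_S1_def)
    then show ?r
      unfolding sp using scale[OF *(1), of "c / 3"] by blast
  next
    assume ?r
    then obtain a T where *: "a \<in> S1_abelian e n" "T \<in> S3_abelian e n"
      "C = (\<lambda>X Y Z. w0 e X Y * a Z + w0 e X Z * a Y + w0 e Y Z * a X + T X Y Z)"
      by auto
    then have "C = (\<lambda>X Y Z. sym_prod21 (\<lambda>X Y. 3 * w0 e X Y) a X Y Z + T X Y Z)"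
      by (simp add: sp)
    then show ?l
      using *(1,2) unfolding rep_space_def w0_S1_def by blast
  qed
qed

lemma S1_abelianD: "a \<in> S1_abelian e n \<Longrightarrow> linear a" "a \<in> S1_abelian e n \<Longrightarrow> a X = a (proj X)"
  unfolding S1_abelian_def by blast+

lemma S3_abelianD: "T \<in> S3_abelian e n \<Longrightarrow> T \<in> sym_tensors3"
  "T \<in> S3_abelian e n \<Longrightarrow> T X Y Z = T (proj X) (proj Y) (proj Z)"
  unfolding S3_abelian_def by blast+

lemma abelian_vanish:
  assumes "proj X = 0"
  shows "a \<in> S1_abelian e n \<Longrightarrow> a X = 0"
    and "T \<in> S3_abelian e n \<Longrightarrow> T X Y Z = 0" "T \<in> S3_abelian e n \<Longrightarrow> T Y X Z = 0"
    "T \<in> S3_abelian e n \<Longrightarrow> T Y Z X = 0"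
proof -
  show "a \<in> S1_abelian e n \<Longrightarrow> a X = 0"
    using S1_abelianD[of a] assms by (metis linear_0)
  assume T: "T \<in> S3_abelian e n"
  show "T X Y Z = 0" "T Y X Z = 0" "T Y Z X = 0"
    using S3_abelianD(2)[OF T] assms sym_tensors3D(10-12)[OF S3_abelianD(1)[OF T]] by metis+
qed

lemma rep_space_sym:
  assumes "C \<in> rep_space e n"
  shows "C \<in> sym_tensors3"
proof -
  obtain a T where *: "a \<in> S1_abelian e n" "T \<in> S3_abelian e n"
    and C: "C = (\<lambda>X Y Z. w0 e X Y * a Z + w0 e X Z * a Y + w0 e Y Z * a X + T X Y Z)"
    using assms rep_space_iff by auto
  note T = sym_tensors3D[OF S3_abelianD(1)[OF *(2)]] and a = S1_abelianD(1)[OF *(1)]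
  have "linear (C u v)" for u v
    by (simp add: C linear_iff T linear_add[OF a] linear_scale[OF a] w0_eq inner_simps algebra_simps)
  moreover have "C u v w = C v u w \<and> C u v w = C u w v" for u v w
    using T(2,3)[of u v w] by (simp add: C w0_eq algebra_simps)
  ultimately show ?thesis
    by (simp add: sym_tensors3_def)
qed

lemma lc_components:
  "lc u x \<bullet> e 1 = ((x \<bullet> e 3) * (u \<bullet> e 2) + (u \<bullet> e 3) * (x \<bullet> e 2)) / 2"
  "lc u x \<bullet> e 2 = - ((x \<bullet> e 3) * (u \<bullet> e 1) + (u \<bullet> e 3) * (x \<bullet> e 1)) / 2"
  "lc u x \<bullet> e 3 = ((u \<bullet> e 1) * (x \<bullet> e 2) - (u \<bullet> e 2) * (x \<bullet> e 1)) / 2"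
  by (simp_all add: lc_def inner_simps field_simps del: One_nat_def)

lemma br_components:
  "br u x \<bullet> e 1 = 0" "br u x \<bullet> e 2 = 0"
  "br u x \<bullet> e 3 = (u \<bullet> e 1) * (x \<bullet> e 2) - (u \<bullet> e 2) * (x \<bullet> e 1)"
  by (simp_all add: heis_bracket_def del: One_nat_def)

text \<open>
  The linear form and the tensor \<open>T\<close> vanish on all values of \<open>lc\<close> and \<open>br\<close>. What remains are
  contractions of \<open>w0\<close>, for which \<open>lc u\<close> is skew and \<open>lc\<close> is torsion-free.
\<close>

lemma rep_space_codazzi:
  assumes "C \<in> rep_space e n"
  shows "codazzi C"
proof -
  obtain a T where *: "a \<in> S1_abelian e n" "T \<in> S3_abelian e n"
    and C: "C = (\<lambda>X Y Z. w0 e X Y * a Z + w0 e X Z * a Y + w0 e Y Z * a X + T X Y Z)"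
    using assms rep_space_iff by auto
  have [simp]: "a (lc u v) = 0" "a (br u v) = 0" for u v
    by (simp_all add: abelian_vanish(1)[OF _ *(1)])
  have [simp]: "T u v (lc w x) = 0" "T u (lc w x) v = 0" "T (br w x) u v = 0" for u v w x
    by (simp_all add: abelian_vanish(2-4)[OF _ *(2)])
  have "w0 e v (lc u x) - w0 e u (lc v x) + w0 e (br u v) x = 0" for u v x
    by (simp add: w0_eq lc_components br_components field_simps del: One_nat_def)
  moreover have "w0 e w (lc u x) + w0 e (lc u w) x = 0" for u w x
    by (simp add: w0_eq lc_components field_simps del: One_nat_def)
  moreover have "w0 e x y = w0 e y x" for x y by (simp add: w0_eq)
  ultimately have 1: "w0 e v (lc u x) = w0 e u (lc v x) - w0 e (br u v) x"
    and 2: "w0 e (lc u w) x = - w0 e w (lc u x)" for u v w x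
    by (simp add: algebra_simps eq_diff_eq, simp add: eq_neg_iff_add_eq_0 add.commute)
  show ?thesis
    unfolding codazzi_def
  proof (intro allI)
    fix u v w x
    show "C v w (lc u x) + C v (lc u w) x - C u w (lc v x) - C u (lc v w) x + C (br u v) w x = 0"
      using 1[of v u x] 1[of v u w] 2[of u w x] 2[of v w x]
      by (simp add: C algebra_simps flip: distrib_left distrib_right)
  qed
qed

text \<open>
  For a vector \<open>z\<close> of the abelian factor, \<open>lc z = 0\<close> and \<open>z\<close> is central, so the Codazzi equation
  says that the form \<open>C z\<close> is annihilated by all operators \<open>lc u\<close>. These span the rotations of the
  Heisenberg part and vanish on the abelian part, which leaves a multiple of \<open>w0\<close> and a form on the
  abelian part. The ten components with all arguments in the Heisenberg part satisfy a
  nonsingular linear system.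
\<close>

lemma codazzi_rep_space:
  assumes C: "C \<in> sym_tensors3" and cod: "codazzi C"
  shows "C \<in> rep_space e n"
proof -
  note S = sym_tensors3D[OF C]
  have neg: "C (- u) v w = - C u v w" "C u (- v) w = - C u v w" "C u v (- w) = - C u v w" for u v w
    using S(7-9)[where c = "-1"] by simp_all
  have eq: "C v w (lc u x) + C v (lc u w) x - C u w (lc v x) - C u (lc v w) x + C (br u v) w x = 0"
    for u v w x
    using cod unfolding codazzi_def by blast
  \<comment> \<open>The Codazzi equation with first derivative along the central vector \<open>proj z\<close>.\<close>
  have mixed: "C (proj z) w (lc u x) + C (proj z) (lc u w) x = 0" for z u w x
    using eq[of "proj z" w u x] by (simp add: S)
  note multilin = S(4-12) neg divide_minus_left
  have sort: "C (e 2) (e 1) x = C (e 1) (e 2) x" "C (e 3) (e 1) x = C (e 1) (e 3) x"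
    "C (e 3) (e 2) x = C (e 2) (e 3) x" "C x (e 2) (e 1) = C x (e 1) (e 2)"
    "C x (e 3) (e 1) = C x (e 1) (e 3)" "C x (e 3) (e 2) = C x (e 2) (e 3)"
    "C (proj z) (e i) x = C (e i) (proj z) x" "C x (proj z) (e i) = C x (e i) (proj z)" for x z i
    by (rule S(2,3))+
  have off: "C (e 1) (e 2) (proj z) = 0" "C (e 1) (e 3) (proj z) = 0" "C (e 2) (e 3) (proj z) = 0"
    and diag: "C (e 2) (e 2) (proj z) = C (e 1) (e 1) (proj z)" "C (e 3) (e 3) (proj z) = C (e 1) (e 1) (proj z)"
    for z
    using mixed[of z "e 1" "e 2" "e 2"] mixed[of z "e 3" "e 1" "e 1"] mixed[of z "e 2" "e 1" "e 1"]
      mixed[of z "e 1" "e 2" "e 3"] mixed[of z "e 3" "e 1" "e 2"]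
    by (simp_all add: multilin sort del: One_nat_def)
  have one: "C (e 1) (proj z) (proj z') = 0" "C (e 2) (proj z) (proj z') = 0" "C (e 3) (proj z) (proj z') = 0"
    for z z'
    using mixed[of z "e 1" "e 2" "proj z'"] mixed[of z "e 1" "e 3" "proj z'"] mixed[of z "e 2" "e 3" "proj z'"]
    by (simp_all add: multilin sort del: One_nat_def)
  have heis: "C (e 1) (e 1) (e 1) = 0" "C (e 1) (e 1) (e 2) = 0" "C (e 1) (e 1) (e 3) = 0"
    "C (e 1) (e 2) (e 2) = 0" "C (e 1) (e 2) (e 3) = 0" "C (e 1) (e 3) (e 3) = 0"
    "C (e 2) (e 2) (e 2) = 0" "C (e 2) (e 2) (e 3) = 0" "C (e 2) (e 3) (e 3) = 0" "C (e 3) (e 3) (e 3) = 0"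
    using eq[of "e 2" "e 1" "e 1" "e 1"] eq[of "e 2" "e 2" "e 1" "e 2"] eq[of "e 2" "e 3" "e 1" "e 3"]
      eq[of "e 2" "e 1" "e 1" "e 2"] eq[of "e 3" "e 1" "e 1" "e 1"] eq[of "e 3" "e 2" "e 1" "e 2"]
      eq[of "e 2" "e 2" "e 1" "e 3"] eq[of "e 3" "e 2" "e 2" "e 2"] eq[of "e 2" "e 1" "e 1" "e 3"]
      eq[of "e 3" "e 1" "e 1" "e 2"]
    by (simp_all add: multilin sort del: One_nat_def)
  define a where "a z = C (e 1) (e 1) (proj z)" for z
  define T where "T X Y Z = C (proj X) (proj Y) (proj Z)" for X Y Z
  have "a \<in> S1_abelian e n"
    by (simp add: S1_abelian_def a_def linear_iff S linear_add[OF linear_proj] linear_scale[OF linear_proj])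
  moreover have "T \<in> S3_abelian e n"
    using S(2,3) by (simp add: S3_abelian_def sym_tensors3_def T_def linear_iff S(4-12)
        linear_add[OF linear_proj] linear_scale[OF linear_proj])
  moreover have "C X Y Z = w0 e X Y * a Z + w0 e X Z * a Y + w0 e Y Z * a X + T X Y Z" for X Y Z
  proof -
    have "C X Y Z = C (heis_part X + proj X) (heis_part Y + proj Y) (heis_part Z + proj Z)"
      by (simp only: heis_part_plus_proj)
    also have "\<dots> = w0 e X Y * a Z + w0 e X Z * a Y + w0 e Y Z * a X + T X Y Z"
      unfolding heis_part_def
      by (simp add: multilin sort off diag one heis a_def T_def w0_eq algebra_simps del: One_nat_def)
    finally show ?thesis .
  qed
  ultimately show ?thesis
    unfolding rep_space_iff by blast
qed

lemma e_3_nonzero [simp]: "e 3 \<noteq> 0"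
  using e_inner_heis(3) by fastforce

text \<open>
  In the plane of \<open>e 1\<close> and \<open>e 3\<close> the Levi-Civita curvature is \<open>1 / 4\<close>, and \<open>C\<close> adds a quarter of
  \<open>A \<bullet> A\<close>, where \<open>A\<close> is the common value of \<open>raise C\<close> on \<open>(e 1, e 1)\<close> and \<open>(e 3, e 3)\<close>: a
  consequence of \<open>w0\<close> being invariant under rotations.
\<close>

lemma rep_space_not_flat:
  assumes "C \<in> rep_space e n"
  shows "alg_curv (prod_of C) (e 1) (e 3) (e 3) \<noteq> 0"
proof -
  obtain a T where *: "a \<in> S1_abelian e n" "T \<in> S3_abelian e n"
    and Cdef: "C = (\<lambda>X Y Z. w0 e X Y * a Z + w0 e X Z * a Y + w0 e Y Z * a X + T X Y Z)"
    using assms rep_space_iff by auto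
  have C: "C \<in> sym_tensors3" by (rule rep_space_sym[OF assms])
  have a: "a (e 1) = 0" "a (e 3) = 0" and T: "T (e 1) x y = 0" "T (e 3) x y = 0" for x y
    using abelian_vanish(1)[OF _ *(1)] abelian_vanish(2)[OF _ *(2)] by simp_all
  have C11: "C (e 1) (e 1) x = a x" and C33: "C (e 3) (e 3) x = a x"
    and C13: "C (e 1) (e 3) x = 0" and C31: "C (e 3) (e 1) x = 0" for x
    by (simp_all add: Cdef w0_eq a T del: One_nat_def)
  define A where "A = raise C (e 1) (e 1)"
  have A: "raise C (e 3) (e 3) = A" and zero: "raise C (e 3) (e 1) = 0"
    by (simp_all add: A_def raise_def C11 C33 C31 del: One_nat_def)
  have "alg_curv (prod_of C) (e 1) (e 3) (e 3) \<bullet> e 1 = A \<bullet> A / 4 + 1 / 4"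
  proof -
    have "prod_of C (e 1) (prod_of C (e 3) (e 3)) \<bullet> e 1 = A \<bullet> A / 4"
      unfolding prod_of_twice[OF C] A A_def[symmetric]
      by (simp add: sym_tensors3D[OF C] del: One_nat_def)
    moreover have "prod_of C (e 3) (prod_of C (e 1) (e 3)) \<bullet> e 1 = - 1 / 4"
      unfolding prod_of_twice[OF C] zero
      by (simp add: C13 C31 del: One_nat_def)
    moreover have "prod_of C (br (e 1) (e 3)) (e 3) = 0"
      by (simp add: bilinear_lzero[OF prod_of_bilinear[OF C]] del: One_nat_def)
    ultimately show ?thesis
      by (simp add: alg_curv_def inner_diff_left)
  qed
  moreover have "A \<bullet> A \<ge> 0" by simp
  ultimately show ?thesis
    by (metis add_nonneg_pos divide_nonneg_pos inner_zero_left less_irrefl zero_less_divide_1_iff zero_less_numeral)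
qed

lemma linear_heis_part: "linear heis_part"
  by (auto simp: linear_iff heis_part_def inner_simps scaleR_add_left scaleR_add_right)

lemma heis_part_e [simp]: "heis_part (e 1) = e 1" "heis_part (e 2) = e 2" "heis_part (e 3) = e 3"
  by (simp_all add: heis_part_def del: One_nat_def)

lemma heis_part_inner [simp]:
  "heis_part x \<bullet> e 1 = x \<bullet> e 1" "heis_part x \<bullet> e 2 = x \<bullet> e 2" "heis_part x \<bullet> e 3 = x \<bullet> e 3"
  by (simp_all add: heis_part_def inner_simps del: One_nat_def)

lemma heis_part_cong:
  "x \<bullet> e 1 = y \<bullet> e 1 \<Longrightarrow> x \<bullet> e 2 = y \<bullet> e 2 \<Longrightarrow> x \<bullet> e 3 = y \<bullet> e 3 \<Longrightarrow> heis_part x = heis_part y"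
  by (simp add: heis_part_def)

lemma proj_heis_part [simp]: "proj (heis_part x) = 0" and heis_part_proj [simp]: "heis_part (proj x) = 0"
proof -
  have "heis_part (heis_part x) = heis_part x" for x
    by (rule heis_part_cong) (rule heis_part_inner)+
  then show "proj (heis_part x) = 0" "heis_part (proj x) = 0"
    by (simp_all add: proj_eq linear_diff[OF linear_heis_part])
qed

lemma heis_part_inner_proj [simp]: "heis_part x \<bullet> proj y = 0" "proj y \<bullet> heis_part x = 0"
  by (simp_all add: heis_part_def inner_simps inner_commute[of _ "proj y"])

lemma proj_inner_swap: "proj x \<bullet> y = x \<bullet> proj y"
  by (metis add.left_neutral heis_part_inner_proj heis_part_plus_proj inner_add_left inner_add_right)

section \<open>Conformal automorphisms and the stabiliser\<close>

text \<open>
  An automorphism preserves the derived algebra, which is the line of \<open>e 3\<close>, and the centre. A conformal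
  one also preserves the orthogonal complement of the former in the latter, which is the abelian
  factor.
\<close>

lemma conformal_aut_center:
  assumes psi: "lie_aut \<psi>" and c: "c > 0" and conf: "\<And>u v. \<psi> u \<bullet> \<psi> v = c * (u \<bullet> v)"
  shows "\<exists>s. s \<noteq> 0 \<and> \<psi> (e 3) = s *\<^sub>R e 3" "heis_part (\<psi> (proj x)) = 0"
proof -
  note F = lie_autD[OF psi]
  have "\<psi> (e 3) = br (\<psi> (e 1)) (\<psi> (e 2))"
    using F(3)[of "e 1" "e 2"] unfolding br_heis(1) .
  then obtain s where s: "\<psi> (e 3) = s *\<^sub>R e 3"
    by (auto simp: heis_bracket_def)
  have "\<psi> (e 3) \<bullet> \<psi> (e 3) = c"
    by (simp add: conf)
  then have s0: "s \<noteq> 0"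
    using c s by auto
  show "\<exists>s. s \<noteq> 0 \<and> \<psi> (e 3) = s *\<^sub>R e 3"
    using s s0 by blast
  have "br (\<psi> (proj x)) y = 0" for y
    using F(3)[of "proj x" "inv \<psi> y"] by (simp add: F(6) linear_0[OF F(1)])
  from this[of "e 1"] this[of "e 2"] have "\<psi> (proj x) \<bullet> e 2 = 0" "\<psi> (proj x) \<bullet> e 1 = 0"
    by (simp_all add: heis_bracket_def del: One_nat_def)
  moreover have "\<psi> (proj x) \<bullet> e 3 = 0"
    using conf[of "proj x" "e 3"] s s0 by simp
  ultimately show "heis_part (\<psi> (proj x)) = 0"
    by (simp add: heis_part_def)
qed

text \<open>
  The abelian factor is preserved by \<open>\<psi>\<close> and by its inverse, hence so is its orthogonal
  complement.
\<close>

lemma conformal_aut_proj: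
  assumes psi: "lie_aut \<psi>" and c: "c > 0" and conf: "\<And>u v. \<psi> u \<bullet> \<psi> v = c * (u \<bullet> v)"
  shows "proj (\<psi> x) = \<psi> (proj x)"
proof -
  note F = lie_autD[OF psi]
  have heis0: "heis_part (\<psi> (proj x)) = 0" for x
    by (rule conformal_aut_center(2)[OF psi c conf])
  have conf': "inv \<psi> u \<bullet> inv \<psi> v = (1 / c) * (u \<bullet> v)" for u v
    using conf[of "inv \<psi> u" "inv \<psi> v"] c by (simp add: F(6) field_simps)
  have heis0': "heis_part (inv \<psi> (proj y)) = 0" for y
    by (rule conformal_aut_center(2)[OF lie_aut_inv[OF psi] _ conf']) (use c in simp)
  have "proj (\<psi> (heis_part x)) \<bullet> y = 0" for y
  proof -
    have "proj (\<psi> (heis_part x)) \<bullet> y = \<psi> (heis_part x) \<bullet> \<psi> (inv \<psi> (proj y))"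
      by (simp add: proj_inner_swap F(6))
    also have "\<dots> = c * (heis_part x \<bullet> proj (inv \<psi> (proj y)))"
      using heis0'[of y] by (simp add: conf proj_eq[of "inv \<psi> (proj y)"])
    finally show ?thesis by simp
  qed
  then have "proj (\<psi> (heis_part x)) = 0"
    by (metis inner_eq_zero_iff)
  moreover have "proj (\<psi> (proj x)) = \<psi> (proj x)"
    using heis0[of x] by (simp add: proj_eq)
  moreover have "\<psi> x = \<psi> (heis_part x) + \<psi> (proj x)"
    using heis_part_plus_proj[of x] by (simp flip: linear_add[OF F(1)])
  ultimately show ?thesis
    by (simp add: linear_add[OF linear_proj])
qed

text \<open>
  On the plane of \<open>e 1\<close> and \<open>e 2\<close> the map \<open>\<psi>\<close> has determinant \<open>s\<close> with \<open>s\<^sup>2 = c\<^sup>2\<close>, because it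
  scales lengths by the square root of \<open>c\<close>; but \<open>s\<close> is also the factor by which \<open>\<psi>\<close> multiplies
  \<open>e 3 = [e 1, e 2]\<close>, so that \<open>s\<^sup>2 = c\<close>.
\<close>

lemma conformal_aut_isometric:
  assumes psi: "lie_aut \<psi>" and c: "c > 0" and conf: "\<And>u v. \<psi> u \<bullet> \<psi> v = c * (u \<bullet> v)"
  shows "c = 1"
proof -
  note F = lie_autD[OF psi] and proj_psi = conformal_aut_proj[OF psi c conf]
  obtain s where s: "s \<noteq> 0" "\<psi> (e 3) = s *\<^sub>R e 3"
    using conformal_aut_center(1)[OF psi c conf] by blast
  have planar: "\<psi> v = (\<psi> v \<bullet> e 1) *\<^sub>R e 1 + (\<psi> v \<bullet> e 2) *\<^sub>R e 2" if "v \<in> {e 1, e 2}" for v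
  proof -
    have "proj (\<psi> v) = 0"
      using that proj_psi[of v] linear_0[OF F(1)] by auto
    moreover have "\<psi> v \<bullet> e 3 = 0"
      using conf[of v "e 3"] s that by auto
    ultimately show ?thesis
      using heis_part_plus_proj[of "\<psi> v"] by (simp add: heis_part_def)
  qed
  define p q p' q' where "p = \<psi> (e 1) \<bullet> e 1" "q = \<psi> (e 1) \<bullet> e 2"
    "p' = \<psi> (e 2) \<bullet> e 1" "q' = \<psi> (e 2) \<bullet> e 2"
  have e1: "\<psi> (e 1) = p *\<^sub>R e 1 + q *\<^sub>R e 2" and e2: "\<psi> (e 2) = p' *\<^sub>R e 1 + q' *\<^sub>R e 2"
    unfolding p_q_p'_q'_def by (rule planar; simp)+
  have "p * p + q * q = c" "p' * p' + q' * q' = c" "p * p' + q * q' = 0" "s * s = c"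
    using conf[of "e 1" "e 1"] conf[of "e 2" "e 2"] conf[of "e 1" "e 2"] conf[of "e 3" "e 3"]
    unfolding e1 e2 s(2) by (simp_all add: inner_simps mult.commute del: One_nat_def)
  moreover have "s = p * q' - q * p'"
  proof -
    have "s *\<^sub>R e 3 = (p * q' - q * p') *\<^sub>R e 3"
      using F(3)[of "e 1" "e 2"] unfolding s(2) p_q_p'_q'_def br_heis(1) by (simp add: heis_bracket_def)
    then show ?thesis by simp
  qed
  ultimately have "c * c - 0 * 0 = c"
  proof -
    assume *: "p * p + q * q = c" "p' * p' + q' * q' = c" "p * p' + q * q' = 0" "s * s = c"
      "s = p * q' - q * p'"
    have "(p * p + q * q) * (p' * p' + q' * q') - (p * p' + q * q') * (p * p' + q * q') =
        (p * q' - q * p') * (p * q' - q * p')"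
      by (simp add: algebra_simps)
    then show ?thesis
      using * by simp
  qed
  then show ?thesis
    using c by simp
qed

lemma orth_abelianD:
  assumes "k \<in> orth_abelian e"
  shows "linear k" "bij k" "k u \<bullet> k v = u \<bullet> v" "i \<in> {1, 2, 3} \<Longrightarrow> k v \<bullet> e i = v \<bullet> e i"
    "heis_part (k v) = heis_part v" "proj (k v) = k (proj v)" "k (e 1) = e 1" "k (e 2) = e 2" "k (e 3) = e 3"
proof -
  have k: "orthogonal_transformation k" and e: "\<And>i. i \<in> {1..3} \<Longrightarrow> k (e i) = e i"
    using assms by (auto simp: orth_abelian_def)
  show lin: "linear k" and inn: "k u \<bullet> k v = u \<bullet> v" for u v
    using k by (auto simp: orthogonal_transformation_def)
  show "bij k" by (rule orthogonal_transformation_bij[OF k])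
  show e': "k (e 1) = e 1" "k (e 2) = e 2" "k (e 3) = e 3"
    by (rule e, simp)+
  show c: "k v \<bullet> e i = v \<bullet> e i" if "i \<in> {1, 2, 3}" for v i
    using inn[of v "e i"] e[of i] that by auto
  show h: "heis_part (k v) = heis_part v" for v
    by (intro heis_part_cong c) auto
  have "k (heis_part v) = heis_part v"
    unfolding heis_part_def by (simp add: linear_add[OF lin] linear_scale[OF lin] e' del: One_nat_def)
  then show "proj (k v) = k (proj v)"
    by (simp add: proj_eq h linear_diff[OF lin])
qed

lemma orth_abelian_inv:
  assumes "k \<in> orth_abelian e"
  shows "inv k \<in> orth_abelian e"
proof -
  have "orthogonal_transformation (inv k)"
    using assms orthogonal_transformation_inv by (auto simp: orth_abelian_def)
  moreover have "inv k (e i) = e i" if "i \<in> {1..3}" for i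
  proof -
    have "k (e i) = e i"
      using assms that by (auto simp: orth_abelian_def)
    then show ?thesis
      by (metis orth_abelianD(1,2)[OF assms] linear_bij_inv(2))
  qed
  ultimately show ?thesis
    by (simp add: orth_abelian_def)
qed

lemma orth_abelian_comp:
  "k \<in> orth_abelian e \<Longrightarrow> l \<in> orth_abelian e \<Longrightarrow> k \<circ> l \<in> orth_abelian e"
  by (auto simp: orth_abelian_def orthogonal_transformation_compose)

lemma orth_abelian_id: "id \<in> orth_abelian e"
  by (simp add: orth_abelian_def orthogonal_transformation_def linear_id)

lemma orth_abelian_lie_aut:
  assumes "k \<in> orth_abelian e"
  shows "lie_aut k"
  unfolding lie_aut_def
  using orth_abelianD[OF assms] by (simp add: heis_bracket_def linear_scale del: One_nat_def)

definition pull3 :: "('a \<Rightarrow> 'a) \<Rightarrow> 'a tensor3 \<Rightarrow> 'a tensor3" where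
  "pull3 \<psi> C = (\<lambda>X Y Z. C (\<psi> X) (\<psi> Y) (\<psi> Z))"

lemma w0_orth_abelian: "k \<in> orth_abelian e \<Longrightarrow> w0 e (k X) (k Y) = w0 e X Y"
  by (simp add: w0_eq orth_abelianD(4))

text \<open>
  Since \<open>w0\<close> is invariant under \<open>O(n - 3)\<close>, the componentwise action in \<open>rep_orbit\<close> is the pull-back of
  the whole tensor.
\<close>

lemma rep_orbit_eq:
  assumes "A \<in> rep_space e n"
  shows "rep_orbit e n A = {pull3 k A |k. k \<in> orth_abelian e}"
proof -
  have pull: "(\<lambda>X Y Z. sym_prod21 (\<lambda>X Y. c * w0 e X Y) (\<lambda>X. a (k X)) X Y Z + T (k X) (k Y) (k Z)) =
      pull3 k (\<lambda>X Y Z. sym_prod21 (\<lambda>X Y. c * w0 e X Y) a X Y Z + T X Y Z)"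
    if "k \<in> orth_abelian e" for c a T k
    using w0_orth_abelian[OF that] by (simp add: pull3_def sym_prod21_def)
  show ?thesis
  proof (intro set_eqI iffI)
    fix A' assume "A' \<in> rep_orbit e n A"
    then obtain k c a T where k: "k \<in> orth_abelian e"
      and A: "A = (\<lambda>X Y Z. sym_prod21 (\<lambda>X Y. c * w0 e X Y) a X Y Z + T X Y Z)"
      and A': "A' = (\<lambda>X Y Z. sym_prod21 (\<lambda>X Y. c * w0 e X Y) (\<lambda>X. a (inv k X)) X Y Z +
               T (inv k X) (inv k Y) (inv k Z))"
      unfolding rep_orbit_def by blast
    have "A' = pull3 (inv k) A"
      unfolding A A' by (rule pull[OF orth_abelian_inv[OF k]])
    then show "A' \<in> {pull3 k A |k. k \<in> orth_abelian e}"
      using orth_abelian_inv[OF k] by blast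
  next
    fix A' assume "A' \<in> {pull3 k A |k. k \<in> orth_abelian e}"
    then obtain k where k: "k \<in> orth_abelian e" and A': "A' = pull3 k A" by blast
    obtain c a T where *: "a \<in> S1_abelian e n" "T \<in> S3_abelian e n"
      and A: "A = (\<lambda>X Y Z. sym_prod21 (\<lambda>X Y. c * w0 e X Y) a X Y Z + T X Y Z)"
      using assms unfolding rep_space_def w0_S1_def by blast
    have "inv (inv k) = k"
      by (rule inv_inv_eq[OF orth_abelianD(2)[OF k]])
    then have "A' = (\<lambda>X Y Z. sym_prod21 (\<lambda>X Y. c * w0 e X Y) (\<lambda>X. a (inv (inv k) X)) X Y Z +
               T (inv (inv k) X) (inv (inv k) Y) (inv (inv k) Z))"
      unfolding A' A using pull[OF k] by simp
    then show "A' \<in> rep_orbit e n A"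
      unfolding rep_orbit_def using orth_abelian_inv[OF k] * A by blast
  qed
qed

lemma rep_orbit_eq_iff:
  assumes "A \<in> rep_space e n" "A' \<in> rep_space e n"
  shows "rep_orbit e n A = rep_orbit e n A' \<longleftrightarrow> (\<exists>k\<in>orth_abelian e. A' = pull3 k A)"
proof
  assume "rep_orbit e n A = rep_orbit e n A'"
  moreover have "A' = pull3 id A'"
    by (simp add: pull3_def)
  ultimately show "\<exists>k\<in>orth_abelian e. A' = pull3 k A"
    unfolding rep_orbit_eq[OF assms(1)] rep_orbit_eq[OF assms(2)] using orth_abelian_id by blast
next
  assume "\<exists>k\<in>orth_abelian e. A' = pull3 k A"
  then obtain k where k: "k \<in> orth_abelian e" and A': "A' = pull3 k A" by blast
  have comp: "pull3 l (pull3 k A) = pull3 (k \<circ> l) A" for k l and A :: "'a tensor3"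
    by (simp add: pull3_def)
  have "A = pull3 (inv k) A'"
    using orth_abelianD(2)[OF k] by (simp add: A' pull3_def bij_is_surj surj_f_inv_f)
  have "pull3 l A = pull3 (inv k \<circ> l) A'" for l
    by (metis \<open>A = pull3 (inv k) A'\<close> comp)
  moreover have "pull3 l A' = pull3 (k \<circ> l) A" for l
    by (simp add: A' comp)
  ultimately show "rep_orbit e n A = rep_orbit e n A'"
    unfolding rep_orbit_eq[OF assms(1)] rep_orbit_eq[OF assms(2)]
    using orth_abelian_comp orth_abelian_inv k by blast
qed

text \<open>
  The stabiliser consists of isometric automorphisms. They respect the splitting into the Heisenberg
  and the abelian factor. Replacing the Heisenberg block by the identity, which gives \<open>k\<close> below, does
  not change the action on \<open>rep_space\<close>, because there the Heisenberg part enters only through \<open>w0\<close>.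
\<close>

lemma stabiliser:
  assumes phi: "lie_aut \<phi>" and r: "r > 0" and stab: "act_metric r \<phi> (\<bullet>) = (\<bullet>)"
  shows "r = 1 \<and> (\<exists>k\<in>orth_abelian e. \<forall>C\<in>rep_space e n. pull3 (inv \<phi>) C = pull3 k C)"
proof -
  define \<psi> where "\<psi> = inv \<phi>"
  have psi: "lie_aut \<psi>"
    unfolding \<psi>_def by (rule lie_aut_inv[OF phi])
  note F = lie_autD[OF psi]
  have "r * (\<psi> u \<bullet> \<psi> v) = u \<bullet> v" for u v
    using fun_cong[OF fun_cong[OF stab]] by (simp add: act_metric_def \<psi>_def)
  then have conf: "\<psi> u \<bullet> \<psi> v = (1 / r) * (u \<bullet> v)" for u v
    using r by (metis divide_eq_eq less_irrefl mult.commute times_divide_eq_right mult_1)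
  have c: "1 / r > 0" using r by simp
  have r1: "r = 1"
    using conformal_aut_isometric[OF psi c conf] by simp
  have iso: "\<psi> u \<bullet> \<psi> v = u \<bullet> v" for u v
    using conf r1 by simp
  note N = conformal_aut_center(2)[OF psi c conf] conformal_aut_proj[OF psi c conf]
  \<comment> \<open>The abelian block of \<open>\<psi>\<close>, extended by the identity.\<close>
  define k where "k x = heis_part x + \<psi> (proj x)" for x
  have pk: "proj (k x) = \<psi> (proj x)" and hk: "heis_part (k x) = heis_part x" for x
    using N(2)[of "proj x"] N(1)[of x]
    by (simp_all add: k_def linear_add[OF linear_proj] linear_add[OF linear_heis_part])
      (simp add: heis_part_def inner_simps del: One_nat_def)
  have "linear k"
    unfolding k_def
    by (intro linear_compose_add linear_heis_part linear_compose[OF linear_proj F(1), unfolded o_def])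
  moreover have "k u \<bullet> k v = u \<bullet> v" for u v
  proof -
    have "k u \<bullet> k v = heis_part u \<bullet> heis_part v + proj u \<bullet> proj v"
      using N(2)[of "proj u"] N(2)[of "proj v"] heis_part_inner_proj[of u "\<psi> (proj v)"]
        heis_part_inner_proj[of v "\<psi> (proj u)"] inner_commute[of "\<psi> (proj u)" "heis_part v"]
      by (simp add: k_def inner_add_left inner_add_right iso)
    also have "\<dots> = (heis_part u + proj u) \<bullet> (heis_part v + proj v)"
      by (simp add: inner_add_left inner_add_right)
    finally show ?thesis
      by (simp add: heis_part_plus_proj)
  qed
  moreover have "k (e i) = e i" if "i \<in> {1..3}" for i
  proof -
    have "i = 1 \<or> i = 2 \<or> i = 3" using that by auto
    then show ?thesis
      by (auto simp: k_def linear_0[OF F(1)] simp del: One_nat_def)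
  qed
  ultimately have k: "k \<in> orth_abelian e"
    by (simp add: orth_abelian_def orthogonal_transformation_def)
  have "pull3 \<psi> C = pull3 k C" if rep: "C \<in> rep_space e n" for C
  proof -
    obtain a T where *: "a \<in> S1_abelian e n" "T \<in> S3_abelian e n"
      and C: "C = (\<lambda>X Y Z. w0 e X Y * a Z + w0 e X Z * a Y + w0 e Y Z * a X + T X Y Z)"
      using rep rep_space_iff by auto
    have w: "w0 e (\<psi> X) (\<psi> Y) = w0 e (k X) (k Y)" for X Y
      by (simp add: w0_orth_abelian[OF k]) (simp add: w0_inner iso N)
    have ak: "a (\<psi> X) = a (k X)" for X
      by (metis S1_abelianD(2)[OF *(1)] N(2) pk)
    have Tk: "T (\<psi> X) (\<psi> Y) (\<psi> Z) = T (k X) (k Y) (k Z)" for X Y Z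
      by (metis S3_abelianD(2)[OF *(2)] N(2) pk)
    show ?thesis
      by (simp add: C pull3_def w ak Tk)
  qed
  then show ?thesis
    using k r1 unfolding \<psi>_def by blast
qed

lemma w0_S1_Int_S3: "w0_S1 e n \<inter> S3_abelian e n = {\<lambda>X Y Z. 0}"
proof -
  have zero: "(\<lambda>X Y Z. 0) \<in> S3_abelian e n"
    by (auto simp: S3_abelian_def sym_tensors3_def linear_iff)
  have zeroa: "(\<lambda>X. 0) \<in> S1_abelian e n"
    by (auto simp: S1_abelian_def linear_iff)
  have "(\<lambda>X Y Z. 0) \<in> w0_S1 e n"
    unfolding w0_S1_def using zeroa by (force simp: sym_prod21_def)
  moreover have "C = (\<lambda>X Y Z. 0)" if w: "C \<in> w0_S1 e n" and s: "C \<in> S3_abelian e n" for C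
  proof -
    obtain c a where a: "a \<in> S1_abelian e n" and C: "C = sym_prod21 (\<lambda>X Y. c * w0 e X Y) a"
      using w by (auto simp: w0_S1_def)
    have a1: "a (e 1) = 0"
      by (rule abelian_vanish(1)[OF _ a]) (rule proj_heis)
    have "c * a X = 0" for X
    proof -
      have "C (e 1) (e 1) X = 0"
        by (rule abelian_vanish(2)[OF _ s]) (rule proj_heis)
      then show ?thesis
        by (simp add: C sym_prod21_def w0_eq a1 del: One_nat_def)
    qed
    then have "c = 0 \<or> a = (\<lambda>X. 0)" by auto
    then show ?thesis
      by (auto simp: C sym_prod21_def fun_eq_iff)
  qed
  ultimately show ?thesis using zero by blast
qed

lemma rep_space_0: "(\<lambda>X Y Z. 0) \<in> rep_space e n"
  unfolding rep_space_iff
  by (intro exI[of _ "\<lambda>X. 0"] exI[of _ "\<lambda>X Y Z. 0"])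
    (auto simp: S1_abelian_def S3_abelian_def sym_tensors3_def linear_iff)

lemma rep_space_dim_3:
  assumes "n = 3"
  shows "rep_space e n = {\<lambda>X Y Z. 0}"
proof -
  have p: "proj v = 0" for v
    by (simp add: abelian_proj_def assms)
  have "C = (\<lambda>X Y Z. 0)" if "C \<in> rep_space e n" for C
  proof -
    obtain a T where *: "a \<in> S1_abelian e n" "T \<in> S3_abelian e n"
      and C: "C = (\<lambda>X Y Z. w0 e X Y * a Z + w0 e X Z * a Y + w0 e Y Z * a X + T X Y Z)"
      using \<open>C \<in> rep_space e n\<close> unfolding rep_space_iff by blast
    then show ?thesis
      using abelian_vanish(1)[OF p *(1)] abelian_vanish(2)[OF p *(2)] by (simp add: C)
  qed
  then show ?thesis using rep_space_0 by blast
qed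

section \<open>A continuous normalisation of inner products\<close>

text \<open>
  In the topology of pointwise convergence, evaluation is continuous in the form for fixed arguments
  only. For bilinear forms in finite dimension the basis expansion gives joint continuity.
\<close>

lemma continuous_on_bilinear_eval:
  assumes S: "S \<subseteq> {b. inner_product b}" and g: "continuous_on S g" and h: "continuous_on S h"
  shows "continuous_on S (\<lambda>b. b (g b) (h b))"
proof -
  have "b (g b) (h b) = (\<Sum>i\<in>Basis. \<Sum>j\<in>Basis. (g b \<bullet> i) * ((h b \<bullet> j) * b i j))" if "b \<in> S" for b
  proof -
    have b: "bilinear b"
      using S that by (auto simp: inner_product_def)
    have "b (g b) (h b) = b (\<Sum>i\<in>Basis. (g b \<bullet> i) *\<^sub>R i) (\<Sum>j\<in>Basis. (h b \<bullet> j) *\<^sub>R j)"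
      by (simp only: euclidean_representation)
    then show ?thesis
      by (simp add: bilinear_sum[OF b] sum.cartesian_product bilinear_lmul[OF b] bilinear_rmul[OF b]
          mult.left_commute)
  qed
  moreover have "continuous_on S (\<lambda>b. \<Sum>i\<in>Basis. \<Sum>j\<in>Basis. (g b \<bullet> i) * ((h b \<bullet> j) * b i j))"
  proof -
    have "continuous_on S (\<lambda>b. b i j)" for i j
      by (rule continuous_on_product_then_coordinatewise)
        (rule continuous_on_product_coordinates[THEN continuous_on_subset], simp)
    then show ?thesis
      by (intro continuous_intros g h)
  qed
  ultimately show ?thesis
    using continuous_on_eq by (metis (no_types, lifting))
qed

text \<open>
  The Gram-Schmidt vectors depend continuously on the inner product, and they are adapted to the flag
  of the given vectors.
\<close>

lemma gram_schmidt_continuous: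
  fixes v :: "nat \<Rightarrow> 'a"
  assumes inj: "inj_on v {..<N}" and ind: "independent (v ` {..<N})"
  shows "M \<le> N \<Longrightarrow> \<exists>f :: nat \<Rightarrow> ('a \<Rightarrow> 'a \<Rightarrow> real) \<Rightarrow> 'a.
    (\<forall>k<M. continuous_on {b. inner_product b} (f k)) \<and>
    (\<forall>b k l. inner_product b \<longrightarrow> k < M \<longrightarrow> l < M \<longrightarrow> b (f k b) (f l b) = (if k = l then 1 else 0)) \<and>
    (\<forall>b k. inner_product b \<longrightarrow> k < M \<longrightarrow> f k b \<in> span (v ` {..k}))"
proof (induction M)
  case 0
  then show ?case by simp
next
  case (Suc M)
  let ?I = "{b. inner_product b}"
  obtain f where cont: "\<And>k. k < M \<Longrightarrow> continuous_on ?I (f k)"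
    and on: "\<And>b k l. inner_product b \<Longrightarrow> k < M \<Longrightarrow> l < M \<Longrightarrow> b (f k b) (f l b) = (if k = l then 1 else 0)"
    and sp: "\<And>b k. inner_product b \<Longrightarrow> k < M \<Longrightarrow> f k b \<in> span (v ` {..k})"
    using Suc by (metis Suc_leD)
  define w where "w b = v M - (\<Sum>j<M. b (v M) (f j b) *\<^sub>R f j b)" for b
  define h where "h b = (1 / sqrt (b (w b) (w b))) *\<^sub>R w b" for b
  have spl: "f j b \<in> span (v ` {..<M})" if "inner_product b" "j < M" for b j
  proof -
    have "v ` {..j} \<subseteq> v ` {..<M}" using that(2) by auto
    then show ?thesis using sp[OF that] span_mono by blast
  qed
  have w0: "w b \<noteq> 0" if b: "inner_product b" for b
  proof
    assume "w b = 0"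
    then have "v M = (\<Sum>j<M. b (v M) (f j b) *\<^sub>R f j b)"
      by (simp add: w_def)
    also have "\<dots> \<in> span (v ` {..<M})"
      using spl[OF b] by (intro span_sum span_scale) auto
    finally have "v M \<in> span (v ` {..<M})" .
    moreover have "v ` {..<M} \<subseteq> v ` {..<N} - {v M}"
      using Suc.prems inj unfolding inj_on_def by fastforce
    ultimately have "v M \<in> span (v ` {..<N} - {v M})"
      using span_mono by blast
    moreover have "v M \<in> v ` {..<N}"
      using Suc.prems by auto
    ultimately show False
      using ind unfolding dependent_def by blast
  qed
  have wpos: "b (w b) (w b) > 0" if "inner_product b" for b
    using that w0[OF that] by (simp add: inner_product_def)
  have "continuous_on ?I w"
    unfolding w_def
    by (intro continuous_intros continuous_on_bilinear_eval cont) auto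
  then have conth: "continuous_on ?I h"
    unfolding h_def
    by (intro continuous_intros continuous_on_bilinear_eval) (use wpos in force)+
  have hh: "b (h b) (h b) = 1" if "inner_product b" for b
  proof -
    have bil: "bilinear b" using that by (simp add: inner_product_def)
    show ?thesis
      using wpos[OF that]
      by (simp add: h_def bilinear_lmul[OF bil] bilinear_rmul[OF bil] real_div_sqrt field_simps)
  qed
  have hf: "b (h b) (f k b) = 0" "b (f k b) (h b) = 0" if b: "inner_product b" and k: "k < M" for b k
  proof -
    have bil: "bilinear b" and sym: "\<And>x y. b x y = b y x" using b by (simp_all add: inner_product_def)
    have lin: "linear (\<lambda>x. b x (f k b))"
      using bil by (simp add: bilinear_def)
    have "b (w b) (f k b) = b (v M) (f k b) - (\<Sum>j<M. b (v M) (f j b) * b (f j b) (f k b))"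
      by (simp add: w_def linear_diff[OF lin] linear_sum[OF lin] linear_scale[OF lin])
    also have "(\<Sum>j<M. b (v M) (f j b) * b (f j b) (f k b)) = (\<Sum>j<M. if j = k then b (v M) (f j b) else 0)"
      using on[OF b _ k] by (intro sum.cong) auto
    finally have "b (w b) (f k b) = 0"
      using k by simp
    then show "b (h b) (f k b) = 0"
      by (simp add: h_def bilinear_lmul[OF bil])
    then show "b (f k b) (h b) = 0"
      by (simp add: sym)
  qed
  have hsp: "h b \<in> span (v ` {..M})" if b: "inner_product b" for b
  proof -
    have "f j b \<in> span (v ` {..M})" if "j < M" for j
    proof -
      have "v ` {..<M} \<subseteq> v ` {..M}" by auto
      then show ?thesis using spl[OF b that] span_mono by blast
    qed
    then show ?thesis
      unfolding h_def w_def by (intro span_scale span_diff span_sum) (auto intro: span_base)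
  qed
  show ?case
    by (rule exI[of _ "f(M := h)"]) (auto simp: less_Suc_eq cont conth on hh hf sp hsp)
qed

text \<open>
  The Gram-Schmidt process is run in the order \<open>e 3, e 4, \<dots>, e n, e 1, e 2\<close>. The resulting
  \<open>b\<close>-orthonormal vectors \<open>F i\<close> then satisfy \<open>F 3 \<in> \<real> e 3\<close> and are central for \<open>i \<ge> 3\<close>, so
  that \<open>[F 1, F 2] = c F 3\<close> is their only bracket up to sign. Dividing all of them by \<open>c\<close> restores the
  relation \<open>[e 1, e 2] = e 3\<close>, hence gives an automorphism, at the cost of the scale \<open>c\<^sup>2\<close>.
\<close>

lemma normalising_section:
  "\<exists>(\<psi> :: ('a \<Rightarrow> 'a \<Rightarrow> real) \<Rightarrow> 'a \<Rightarrow> 'a) r.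
    (\<forall>b. inner_product b \<longrightarrow> lie_aut (\<psi> b) \<and> r b > 0 \<and> (\<forall>u v. r b * b (\<psi> b u) (\<psi> b v) = u \<bullet> v)) \<and>
    (\<forall>u. continuous_on {b. inner_product b} (\<lambda>b. \<psi> b u)) \<and> continuous_on {b. inner_product b} r"
proof -
  let ?I = "{b. inner_product b}"
  \<comment> \<open>\<open>\<sigma>\<close> lists the indices in the order of the flag, counting from \<open>0\<close>; \<open>\<tau>\<close> is its inverse.\<close>
  define \<sigma> where "\<sigma> k = (if k < n - 2 then k + 3 else k - (n - 3))" for k
  define \<tau> where "\<tau> i = (if i < 3 then i + (n - 3) else i - 3)" for i :: nat
  have \<sigma>: "\<sigma> k \<in> {1..n}" if "k < n" for k
    using that n_ge_3 by (auto simp: \<sigma>_def)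
  have \<tau>: "\<tau> i < n" if "i \<in> {1..n}" for i
    using that n_ge_3 by (auto simp: \<tau>_def)
  have \<tau>_inj: "\<tau> i = \<tau> j \<longleftrightarrow> i = j" if "i \<in> {1..n}" "j \<in> {1..n}" for i j
    using that n_ge_3 by (auto simp: \<tau>_def split: if_splits)
  have \<sigma>_inj: "inj_on \<sigma> {..<n}"
    using n_ge_3 by (auto simp: inj_on_def \<sigma>_def split: if_splits)
  define v where "v k = e (\<sigma> k)" for k
  have inj: "inj_on v {..<n}"
    unfolding v_def using \<sigma>_inj e_independent(1) \<sigma> unfolding inj_on_def by (meson lessThan_iff)
  have "v ` {..<n} \<subseteq> e ` {1..n}"
    using \<sigma> by (auto simp: v_def)
  then have ind: "independent (v ` {..<n})"
    using e_independent(2) independent_mono by blast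
  obtain f where cont: "\<And>k. k < n \<Longrightarrow> continuous_on ?I (f k)"
    and on: "\<And>b k l. inner_product b \<Longrightarrow> k < n \<Longrightarrow> l < n \<Longrightarrow> b (f k b) (f l b) = (if k = l then 1 else 0)"
    and sp: "\<And>b k. inner_product b \<Longrightarrow> k < n \<Longrightarrow> f k b \<in> span (v ` {..k})"
    using gram_schmidt_continuous[OF inj ind order_refl] by metis
  define F where "F i = f (\<tau> i)" for i
  have contF: "continuous_on ?I (F i)" if "i \<in> {1..n}" for i
    using cont \<tau>[OF that] by (simp add: F_def)
  have onF: "b (F i b) (F j b) = (if i = j then 1 else 0)"
    if "inner_product b" "i \<in> {1..n}" "j \<in> {1..n}" for b i j
    using on[OF that(1) \<tau>[OF that(2)] \<tau>[OF that(3)]] \<tau>_inj[OF that(2,3)] by (simp add: F_def)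
  have central: "F i b \<bullet> e 1 = 0 \<and> F i b \<bullet> e 2 = 0" if b: "inner_product b" and i: "i \<in> {3..n}" for b i
  proof -
    have "F i b \<in> span (v ` {..i - 3})"
      using sp[OF b, of "\<tau> i"] \<tau>[of i] i n_ge_3 by (simp add: F_def \<tau>_def)
    moreover have "v ` {..i - 3} \<subseteq> {x. x \<bullet> e 1 = 0 \<and> x \<bullet> e 2 = 0}"
      using i n_ge_3 by (auto simp: v_def \<sigma>_def e_inner)
    moreover have "subspace {x. x \<bullet> e 1 = 0 \<and> x \<bullet> e 2 = 0}"
      by (auto simp: subspace_def inner_simps)
    ultimately show ?thesis
      using span_minimal by blast
  qed
  have F3: "F 3 b = (F 3 b \<bullet> e 3) *\<^sub>R e 3" if b: "inner_product b" for b
  proof -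
    have "F 3 b \<in> span (v ` {..0})"
      using sp[OF b, of 0] n_ge_3 by (simp add: F_def \<tau>_def)
    then have "F 3 b \<in> span {e 3}"
      using n_ge_3 by (simp add: v_def \<sigma>_def)
    then obtain c where "F 3 b = c *\<^sub>R e 3"
      by (auto simp: span_singleton)
    then show ?thesis by simp
  qed
  have F30: "F 3 b \<bullet> e 3 \<noteq> 0" if b: "inner_product b" for b
  proof
    assume "F 3 b \<bullet> e 3 = 0"
    then have "F 3 b = 0" using F3[OF b] by simp
    then show False
      using onF[OF b, of 3 3] n_ge_3 b by (simp add: inner_product_def bilinear_lzero)
  qed
  define \<omega> where "\<omega> x y = (x \<bullet> e 1) * (y \<bullet> e 2) - (x \<bullet> e 2) * (y \<bullet> e 1)" for x y :: 'a
  have br\<omega>: "br x y = \<omega> x y *\<^sub>R e 3" for x y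
    by (simp add: heis_bracket_def \<omega>_def)
  \<comment> \<open>\<open>G b\<close> maps the standard basis to the \<open>b\<close>-orthonormal one; \<open>c b\<close> is the structure constant in the latter.\<close>
  define G where "G b u = (\<Sum>i=1..n. (u \<bullet> e i) *\<^sub>R F i b)" for b u
  define c where "c b = \<omega> (F 1 b) (F 2 b) / (F 3 b \<bullet> e 3)" for b
  define \<psi> where "\<psi> b u = (1 / c b) *\<^sub>R G b u" for b u
  define r where "r b = (c b)\<^sup>2" for b
  have linG: "linear (G b)" for b
    by (auto simp: linear_iff G_def inner_simps scaleR_add_left sum.distrib scaleR_sum_right)
  have isoG: "b (G b u) (G b w) = u \<bullet> w" if b: "inner_product b" for b u w
  proof -
    have bil: "bilinear b" using b by (simp add: inner_product_def)
    have "b (G b u) (G b w) = (\<Sum>i=1..n. \<Sum>j=1..n. (u \<bullet> e i) * ((w \<bullet> e j) * b (F i b) (F j b)))"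
      by (simp add: G_def bilinear_sum[OF bil] sum.cartesian_product bilinear_lmul[OF bil]
          bilinear_rmul[OF bil] mult.left_commute)
    also have "\<dots> = (\<Sum>i=1..n. \<Sum>j=1..n. if j = i then (u \<bullet> e i) * (w \<bullet> e i) else 0)"
      using onF[OF b] by (intro sum.cong) auto
    also have "\<dots> = (\<Sum>i=1..n. (u \<bullet> e i) * (w \<bullet> e i))"
      by (intro sum.cong) auto
    also have "\<dots> = (\<Sum>i=1..n. (u \<bullet> e i) *\<^sub>R e i) \<bullet> w"
      by (simp add: inner_sum_left) (simp add: inner_commute)
    finally show ?thesis
      by (simp only: e_expansion[of u, symmetric])
  qed
  have bijG: "bij (G b)" if b: "inner_product b" for b
  proof -
    have "inj (G b)"
    proof (rule linear_injective_0[OF linG, THEN iffD2], intro allI impI)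
      fix u assume "G b u = 0"
      then show "u = 0"
        using isoG[OF b, of u u] b by (simp add: inner_product_def bilinear_lzero)
    qed
    then show ?thesis
      using linear_injective_imp_surjective[OF linG] by (simp add: bij_def)
  qed
  have brG: "br (G b u) (G b w) = \<omega> u w *\<^sub>R br (F 1 b) (F 2 b)" if b: "inner_product b" for b u w
  proof -
    have G12: "G b u \<bullet> x = (u \<bullet> e 1) * (F 1 b \<bullet> x) + (u \<bullet> e 2) * (F 2 b \<bullet> x)"
      if x: "x \<in> {e 1, e 2}" for u x
    proof -
      have "{1..n} = {1, 2} \<union> {3..n}" using n_ge_3 by auto
      moreover have "(u \<bullet> e i) * (F i b \<bullet> x) = 0" if "i \<in> {3..n}" for i
        using central[OF b that] x by auto
      moreover have "G b u \<bullet> x = (\<Sum>i=1..n. (u \<bullet> e i) * (F i b \<bullet> x))"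
        by (simp add: G_def inner_sum_left)
      moreover have "(\<Sum>i=3..n. (u \<bullet> e i) * (F i b \<bullet> x)) = 0"
        using calculation(2) by (intro sum.neutral) blast
      ultimately show ?thesis
        by (simp add: sum.union_disjoint)
    qed
    have "\<omega> (G b u) (G b w) = \<omega> u w * \<omega> (F 1 b) (F 2 b)"
      unfolding \<omega>_def G12[OF insertI1] G12[OF insertI2[OF singletonI]] by (simp add: algebra_simps)
    then show ?thesis
      by (simp add: br\<omega>)
  qed
  have c0: "c b \<noteq> 0" if b: "inner_product b" for b
  proof
    assume "c b = 0"
    then have "br (F 1 b) (F 2 b) = 0"
      using F30[OF b] by (simp add: c_def br\<omega>)
    moreover obtain u w where "e 1 = G b u" "e 2 = G b w"
      using bijG[OF b] by (metis bij_pointE)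
    ultimately have "br (e 1) (e 2) = 0"
      using brG[OF b, of u w] by simp
    then show False
      using e_inner_heis(3) unfolding br_heis(1) by simp
  qed
  have aut: "lie_aut (\<psi> b)" if b: "inner_product b" for b
    unfolding lie_aut_def
  proof (intro conjI allI)
    show lin: "linear (\<psi> b)"
      unfolding \<psi>_def using linear_compose_scale_right[OF linG] by blast
    have "inj (\<psi> b)"
      using bijG[OF b] c0[OF b] by (auto simp: \<psi>_def inj_on_def bij_def)
    then show "bij (\<psi> b)"
      using linear_injective_imp_surjective[OF lin] by (simp add: bij_def)
    fix u w
    have G3: "G b (e 3) = F 3 b"
    proof -
      have "G b (e 3) = (\<Sum>i=1..n. if i = 3 then F i b else 0)"
        unfolding G_def using n_ge_3 by (intro sum.cong) (auto simp: e_inner)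
      then show ?thesis using n_ge_3 by simp
    qed
    have "br (\<psi> b u) (\<psi> b w) = ((1 / c b) * (1 / c b) * \<omega> u w * \<omega> (F 1 b) (F 2 b)) *\<^sub>R e 3"
      by (simp add: \<psi>_def br_simps brG[OF b]) (simp add: br\<omega>)
    also have "\<omega> (F 1 b) (F 2 b) = c b * (F 3 b \<bullet> e 3)"
      using F30[OF b] by (simp add: c_def)
    also have "((1 / c b) * (1 / c b) * \<omega> u w * (c b * (F 3 b \<bullet> e 3))) *\<^sub>R e 3 =
        ((1 / c b) * \<omega> u w) *\<^sub>R ((F 3 b \<bullet> e 3) *\<^sub>R e 3)"
      using c0[OF b] by simp
    also have "\<dots> = \<psi> b (br u w)"
      unfolding F3[OF b, symmetric] by (simp add: br\<omega> \<psi>_def linear_scale[OF linG] G3)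
    finally show "\<psi> b (br u w) = br (\<psi> b u) (\<psi> b w)" by simp
  qed
  have iso: "r b * b (\<psi> b u) (\<psi> b w) = u \<bullet> w" if b: "inner_product b" for b u w
  proof -
    have bil: "bilinear b" using b by (simp add: inner_product_def)
    show ?thesis
      using c0[OF b] by (simp add: r_def \<psi>_def bilinear_lmul[OF bil] bilinear_rmul[OF bil] isoG[OF b] power2_eq_square)
  qed
  have in123: "1 \<in> {1..n}" "2 \<in> {1..n}" "3 \<in> {1..n}" using n_ge_3 by auto
  have contc: "continuous_on ?I c"
    unfolding c_def \<omega>_def using F30
    by (intro continuous_intros contF in123) auto
  have "continuous_on ?I (\<lambda>b. \<psi> b u)" for u
    unfolding \<psi>_def G_def using c0
    by (intro continuous_intros contc contF) auto
  moreover have "continuous_on ?I r"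
    unfolding r_def by (intro continuous_intros contc)
  moreover have "r b > 0" if "inner_product b" for b
    using c0[OF that] by (simp add: r_def)
  ultimately show ?thesis
    using aut iso by blast
qed

end

section \<open>Orbit spaces\<close>

lemma openin_quotient_topology:
  "openin (quotient_topology T f) U \<longleftrightarrow> U \<subseteq> f ` topspace T \<and> openin T {x \<in> topspace T. f x \<in> U}"
proof -
  have "istopology (\<lambda>U. U \<subseteq> f ` topspace T \<and> openin T {x \<in> topspace T. f x \<in> U})"
    unfolding istopology_def
  proof (rule conjI; intro allI impI)
    fix S U assume S: "S \<subseteq> f ` topspace T \<and> openin T {x \<in> topspace T. f x \<in> S}"
      and U: "U \<subseteq> f ` topspace T \<and> openin T {x \<in> topspace T. f x \<in> U}"
    have "{x \<in> topspace T. f x \<in> S \<inter> U} = {x \<in> topspace T. f x \<in> S} \<inter> {x \<in> topspace T. f x \<in> U}"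
      by auto
    then show "S \<inter> U \<subseteq> f ` topspace T \<and> openin T {x \<in> topspace T. f x \<in> S \<inter> U}"
      using S U by auto
  next
    fix K assume K: "\<forall>U\<in>K. U \<subseteq> f ` topspace T \<and> openin T {x \<in> topspace T. f x \<in> U}"
    have "{x \<in> topspace T. f x \<in> \<Union>K} = (\<Union>U\<in>K. {x \<in> topspace T. f x \<in> U})"
      by auto
    then show "\<Union>K \<subseteq> f ` topspace T \<and> openin T {x \<in> topspace T. f x \<in> \<Union>K}"
      using K by auto
  qed
  then show ?thesis
    by (simp add: quotient_topology_def topology_inverse')
qed

lemma topspace_quotient_topology: "topspace (quotient_topology T f) = f ` topspace T"
proof
  have "{x \<in> topspace T. f x \<in> f ` topspace T} = topspace T" by auto
  then have "openin (quotient_topology T f) (f ` topspace T)"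
    by (simp add: openin_quotient_topology)
  then show "f ` topspace T \<subseteq> topspace (quotient_topology T f)"
    by (rule openin_subset)
  show "topspace (quotient_topology T f) \<subseteq> f ` topspace T"
    using openin_quotient_topology[of T f "topspace (quotient_topology T f)"] by simp
qed

lemma quotient_map_quotient_topology: "quotient_map T (quotient_topology T f) f"
  by (auto simp: quotient_map_def topspace_quotient_topology openin_quotient_topology)

text \<open>
  Both maps descend to the quotients by the universal property, and the last two hypotheses say that
  the induced maps are inverse to each other.
\<close>

lemma quotient_topologies_homeomorphic:
  assumes i: "continuous_map T2 T1 i" and \<rho>: "continuous_map T1 T2 \<rho>"
    and i_cong: "\<And>y y'. y \<in> topspace T2 \<Longrightarrow> y' \<in> topspace T2 \<Longrightarrow> q y = q y' \<Longrightarrow> p (i y) = p (i y')"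
    and \<rho>_cong: "\<And>x x'. x \<in> topspace T1 \<Longrightarrow> x' \<in> topspace T1 \<Longrightarrow> p x = p x' \<Longrightarrow> q (\<rho> x) = q (\<rho> x')"
    and i\<rho>: "\<And>x. x \<in> topspace T1 \<Longrightarrow> p (i (\<rho> x)) = p x"
    and \<rho>i: "\<And>y. y \<in> topspace T2 \<Longrightarrow> q (\<rho> (i y)) = q y"
  shows "quotient_topology T1 p homeomorphic_space quotient_topology T2 q"
proof -
  note Q1 = quotient_map_quotient_topology[of T1 p] and Q2 = quotient_map_quotient_topology[of T2 q]
  have "continuous_map T1 (quotient_topology T2 q) (q \<circ> \<rho>)"
    by (rule continuous_map_compose[OF \<rho> quotient_imp_continuous_map[OF Q2]])
  then obtain F where F: "continuous_map (quotient_topology T1 p) (quotient_topology T2 q) F"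
    and Fp: "\<And>x. x \<in> topspace T1 \<Longrightarrow> F (p x) = q (\<rho> x)"
    using quotient_map_lift_exists[OF Q1, of "quotient_topology T2 q" "q \<circ> \<rho>"] \<rho>_cong by (metis comp_apply)
  have "continuous_map T2 (quotient_topology T1 p) (p \<circ> i)"
    by (rule continuous_map_compose[OF i quotient_imp_continuous_map[OF Q1]])
  then obtain G where G: "continuous_map (quotient_topology T2 q) (quotient_topology T1 p) G"
    and Gq: "\<And>y. y \<in> topspace T2 \<Longrightarrow> G (q y) = p (i y)"
    using quotient_map_lift_exists[OF Q2, of "quotient_topology T1 p" "p \<circ> i"] i_cong by (metis comp_apply)
  have "\<rho> x \<in> topspace T2" if "x \<in> topspace T1" for x
    using continuous_map_image_subset_topspace[OF \<rho>] that by blast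
  moreover have "i y \<in> topspace T1" if "y \<in> topspace T2" for y
    using continuous_map_image_subset_topspace[OF i] that by blast
  ultimately have "homeomorphic_maps (quotient_topology T1 p) (quotient_topology T2 q) F G"
    using F G by (auto simp: homeomorphic_maps_def topspace_quotient_topology Fp Gq i\<rho> \<rho>i)
  then show ?thesis
    using homeomorphic_space_def by blast
qed

context heisenberg_frame
begin

definition stat_of :: "'a tensor3 \<Rightarrow> 'a metric \<times> 'a connection" where
  "stat_of C = (linv (\<bullet>), conn (prod_of C))"

text \<open>
  The map that induces the topology of the space of left-invariant structures.
\<close>

definition invariants :: "'a metric \<times> 'a connection \<Rightarrow> ('a \<Rightarrow> 'a \<Rightarrow> real) \<times> 'a tensor3" where
  "invariants = (\<lambda>(g, D). (g 0, cubic_at g D 0))"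

lemma invariants_eq: "alg_stat b B \<Longrightarrow> invariants (linv b, conn B) = (b, cubic b B)"
  by (simp add: invariants_def alg_stat_def inner_product_def cubic_at_conn)

lemma stat_of_LStatCS: "C \<in> rep_space e n \<Longrightarrow> stat_of C \<in> LStatCS m"
  unfolding LStatCS_eq stat_of_def
  using alg_stat_prod_of alg_cs_iff_codazzi rep_space_sym rep_space_codazzi by blast

lemma invariants_stat_of: "C \<in> rep_space e n \<Longrightarrow> invariants (stat_of C) = ((\<bullet>), C)"
  unfolding stat_of_def by (simp add: invariants_eq alg_stat_prod_of cubic_prod_of rep_space_sym)

text \<open>
  Acting with the automorphism \<open>inv \<psi>\<close> and the scale \<open>r\<close> moves the metric to the standard one, where
  conjugate symmetry puts the cubic form into \<open>rep_space\<close>.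
\<close>

lemma normal_form:
  assumes psi: "lie_aut \<psi>" and r: "r > 0" and iso: "\<And>u v. r * b (\<psi> u) (\<psi> v) = u \<bullet> v"
    and st: "alg_stat b B" and cs: "alg_cs b B"
  defines "C \<equiv> \<lambda>X Y Z. r * cubic b B (\<psi> X) (\<psi> Y) (\<psi> Z)"
  shows "C \<in> rep_space e n" "stat_orbit m (stat_of C) = stat_orbit m (linv b, conn B)"
    "prod_of C = act_product (inv \<psi>) B"
proof -
  define \<phi> where "\<phi> = inv \<psi>"
  have phi: "lie_aut \<phi>"
    unfolding \<phi>_def by (rule lie_aut_inv[OF psi])
  have inv: "inv \<phi> = \<psi>"
    unfolding \<phi>_def by (rule inv_inv_eq[OF lie_autD(2)[OF psi]])
  have met: "act_metric r \<phi> b = (\<bullet>)"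
    by (intro ext) (simp add: act_metric_def inv iso)
  have st': "alg_stat (\<bullet>) (act_product \<phi> B)" and cs': "alg_cs (\<bullet>) (act_product \<phi> B)"
    using alg_stat_act[OF phi r st] alg_cs_act[OF phi cs, of r] by (simp_all add: met)
  have "cubic (\<bullet>) (act_product \<phi> B) = C"
    unfolding met[symmetric] by (intro ext) (simp only: cubic_act[OF phi] inv C_def)
  then have eq: "act_product \<phi> B = prod_of C" and sym: "C \<in> sym_tensors3"
    using alg_stat_inner_eq[OF st'] cubic_sym_tensor[OF st'] by simp_all
  show "C \<in> rep_space e n"
    using cs' alg_cs_iff_codazzi[OF sym] codazzi_rep_space[OF sym] by (simp add: eq)
  show "prod_of C = act_product (inv \<psi>) B"
    using eq by (simp add: \<phi>_def)
  show "stat_orbit m (stat_of C) = stat_orbit m (linv b, conn B)"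
    using stat_orbit_act[OF phi r, of b B] by (simp add: met eq stat_of_def)
qed

text \<open>
  An element of the group that relates two structures over the standard metric stabilises that metric,
  so \<open>stabiliser\<close> applies. Conversely, elements of \<open>O(n - 3)\<close> are isometric automorphisms.
\<close>

lemma stat_orbit_eq_iff_rep_orbit_eq:
  assumes C: "C \<in> rep_space e n" and C': "C' \<in> rep_space e n"
  shows "stat_orbit m (stat_of C) = stat_orbit m (stat_of C') \<longleftrightarrow> rep_orbit e n C = rep_orbit e n C'"
proof
  note s = rep_space_sym[OF C] and s' = rep_space_sym[OF C']
  assume "stat_orbit m (stat_of C) = stat_orbit m (stat_of C')"
  then have "stat_of C' \<in> stat_orbit m (stat_of C)"
    using stat_orbit_self by (simp add: stat_of_def)
  then obtain r \<phi> where r: "r > 0" and phi: "lie_aut \<phi>" and "linv (\<bullet>) = linv (act_metric r \<phi> (\<bullet>))"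
    and conn: "conn (prod_of C') = conn (act_product \<phi> (prod_of C))"
    unfolding stat_of_def stat_orbit_eq by auto
  then have stab: "act_metric r \<phi> (\<bullet>) = (\<bullet>)"
    using linv_inj by metis
  have "bilinear (act_product \<phi> (prod_of C))"
    using alg_stat_act[OF phi r alg_stat_prod_of[OF s]] by (simp add: alg_stat_def)
  then have "prod_of C' = act_product \<phi> (prod_of C)"
    using conn_inj[OF prod_of_bilinear[OF s'] _ conn] by blast
  then have "C' = cubic (act_metric r \<phi> (\<bullet>)) (act_product \<phi> (prod_of C))"
    using cubic_prod_of[OF s'] by (simp add: stab)
  also have "\<dots> = (\<lambda>u v w. r * pull3 (inv \<phi>) C u v w)"
    by (intro ext) (simp add: cubic_act[OF phi] cubic_prod_of[OF s] pull3_def)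
  finally show "rep_orbit e n C = rep_orbit e n C'"
    using stabiliser[OF phi r stab] C unfolding rep_orbit_eq_iff[OF C C'] by auto
next
  note s = rep_space_sym[OF C] and s' = rep_space_sym[OF C']
  assume "rep_orbit e n C = rep_orbit e n C'"
  then obtain k where k: "k \<in> orth_abelian e" and C'k: "C' = pull3 k C"
    unfolding rep_orbit_eq_iff[OF C C'] by blast
  have phi: "lie_aut (inv k)"
    by (rule lie_aut_inv[OF orth_abelian_lie_aut[OF k]])
  have inv: "inv (inv k) = k"
    by (rule inv_inv_eq[OF orth_abelianD(2)[OF k]])
  have met: "act_metric 1 (inv k) (\<bullet>) = (\<bullet>)"
    by (intro ext) (simp add: act_metric_def inv orth_abelianD(3)[OF k])
  have "cubic (\<bullet>) (act_product (inv k) (prod_of C)) = C'"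
    using cubic_act[OF phi, of 1 "(\<bullet>)" "prod_of C"]
    by (simp add: fun_eq_iff met inv C'k pull3_def cubic_prod_of[OF s])
  moreover have "alg_stat (\<bullet>) (act_product (inv k) (prod_of C))"
    using alg_stat_act[OF phi zero_less_one alg_stat_prod_of[OF s]] by (simp add: met)
  ultimately have "act_product (inv k) (prod_of C) = prod_of C'"
    using alg_stat_inner_eq by metis
  then show "stat_orbit m (stat_of C) = stat_orbit m (stat_of C')"
    using stat_orbit_act[OF phi zero_less_one, of "(\<bullet>)" "prod_of C"] by (simp add: met stat_of_def)
qed

lemma continuous_on_tensor_eval:
  assumes W: "\<And>b C. (b, C) \<in> W \<Longrightarrow> C \<in> sym_tensors3"
    and f: "continuous_on W f" "continuous_on W g" "continuous_on W h"
  shows "continuous_on (W :: ('b::topological_space \<times> 'a tensor3) set) (\<lambda>s. snd s (f s) (g s) (h s))"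
proof -
  have "snd s (f s) (g s) (h s) = (\<Sum>i\<in>Basis. \<Sum>j\<in>Basis. \<Sum>k\<in>Basis.
      (f s \<bullet> i) * ((g s \<bullet> j) * ((h s \<bullet> k) * snd s i j k)))" if "s \<in> W" for s
  proof -
    have "snd s \<in> sym_tensors3"
      using W[of "fst s" "snd s"] that by simp
    note S = sym_tensors3D[OF this]
    have lin: "linear (snd s x y)" "linear (\<lambda>z. snd s x z y)" "linear (\<lambda>z. snd s z x y)" for x y
      by (simp_all add: linear_iff S(4-9))
    have e1: "snd s (f s) y z = (\<Sum>i\<in>Basis. (f s \<bullet> i) * snd s i y z)" for y z
      using linear_eq_sum_Basis[OF lin(3)[of y z], of "f s"] by simp
    have e2: "snd s i (g s) z = (\<Sum>j\<in>Basis. (g s \<bullet> j) * snd s i j z)" for i z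
      using linear_eq_sum_Basis[OF lin(2)[of i z], of "g s"] by simp
    have e3: "snd s i j (h s) = (\<Sum>k\<in>Basis. (h s \<bullet> k) * snd s i j k)" for i j
      using linear_eq_sum_Basis[OF lin(1)[of i j], of "h s"] by simp
    show ?thesis
      unfolding e1 unfolding e2 unfolding e3 by (simp only: sum_distrib_left)
  qed
  moreover have coord: "continuous_on W (\<lambda>s. snd s i j k)" for i j k
    by (rule continuous_on_product_then_coordinatewise[OF continuous_on_product_then_coordinatewise[OF
            continuous_on_product_then_coordinatewise[OF continuous_on_snd[OF continuous_on_id]]]])
  have "continuous_on W (\<lambda>s. \<Sum>i\<in>Basis. \<Sum>j\<in>Basis. \<Sum>k\<in>Basis.
      (f s \<bullet> i) * ((g s \<bullet> j) * ((h s \<bullet> k) * snd s i j k)))"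
    by (intro continuous_on_sum continuous_on_mult continuous_on_inner continuous_on_const f coord)
  ultimately show ?thesis
    using continuous_on_cong[OF refl] by (metis (no_types, lifting))
qed

abbreviation LStatCS_space :: "('a metric \<times> 'a connection) topology" where
  "LStatCS_space \<equiv> subtopology (LStat_topology m) (LStatCS m)"

lemma topspace_LStatCS_space: "topspace LStatCS_space = LStatCS m"
  by (auto simp: LStat_topology_def topspace_pullback_topology LStatCS_def)

lemma continuous_map_stat_of: "continuous_map (top_of_set (rep_space e n)) LStatCS_space stat_of"
proof (rule continuous_map_into_subtopology)
  show "stat_of \<in> topspace (top_of_set (rep_space e n)) \<rightarrow> LStatCS m"
    using stat_of_LStatCS by auto
  show "continuous_map (top_of_set (rep_space e n)) (LStat_topology m) stat_of"
    unfolding LStat_topology_def invariants_def[symmetric]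
  proof (rule continuous_map_pullback')
    have "continuous_on (rep_space e n) (\<lambda>C. ((\<bullet>) :: 'a \<Rightarrow> 'a \<Rightarrow> real, C))"
      by (intro continuous_intros)
    then show "continuous_map (top_of_set (rep_space e n)) euclidean (invariants \<circ> stat_of)"
      unfolding continuous_map_iff_continuous
      by (rule continuous_on_cong[THEN iffD1, rotated -1]) (simp_all add: invariants_stat_of)
    show "topspace (top_of_set (rep_space e n)) \<subseteq> stat_of -` LStat m"
      using stat_of_LStatCS by (auto simp: LStatCS_def)
  qed
qed

text \<open>
  The continuous section \<open>\<psi>\<close> of \<open>normalising_section\<close> selects, continuously, a representative of
  the orbit of each structure.
\<close>

lemma retraction_exists:
  "\<exists>\<rho>. continuous_map LStatCS_space (top_of_set (rep_space e n)) \<rho> \<and>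
    (\<forall>s\<in>LStatCS m. stat_orbit m (stat_of (\<rho> s)) = stat_orbit m s)"
proof -
  obtain \<psi> :: "('a \<Rightarrow> 'a \<Rightarrow> real) \<Rightarrow> 'a \<Rightarrow> 'a" and r where
    *: "\<And>b. inner_product b \<Longrightarrow> lie_aut (\<psi> b)" "\<And>b. inner_product b \<Longrightarrow> r b > 0"
      "\<And>b u v. inner_product b \<Longrightarrow> r b * b (\<psi> b u) (\<psi> b v) = u \<bullet> v"
      "\<And>u. continuous_on {b. inner_product b} (\<lambda>b. \<psi> b u)" "continuous_on {b. inner_product b} r"
    using normalising_section by blast
  define \<rho> where "\<rho> s = (\<lambda>X Y Z. r (fst s) * snd s (\<psi> (fst s) X) (\<psi> (fst s) Y) (\<psi> (fst s) Z))" for s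
  define W where "W = {b. inner_product b} \<times> (sym_tensors3 :: 'a tensor3 set)"
  have cont: "continuous_on W \<rho>"
    unfolding \<rho>_def
  proof (intro continuous_on_coordinatewise_then_product continuous_on_mult continuous_on_tensor_eval)
    have fst: "continuous_on W fst" "fst ` W \<subseteq> {b. inner_product b}"
      by (auto simp: W_def intro: continuous_on_fst)
    show "continuous_on W (\<lambda>s. r (fst s))"
      by (rule continuous_on_compose2[OF *(5) fst])
    show "continuous_on W (\<lambda>s. \<psi> (fst s) X)" for X
      by (rule continuous_on_compose2[OF *(4) fst])
    then show "continuous_on W (\<lambda>s. \<psi> (fst s) X)" "continuous_on W (\<lambda>s. \<psi> (fst s) X)" for X
      by blast+
    show "\<And>b C. (b, C) \<in> W \<Longrightarrow> C \<in> sym_tensors3"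
      by (simp add: W_def)
  qed
  have nf: "\<rho> (invariants s) \<in> rep_space e n \<and> stat_orbit m (stat_of (\<rho> (invariants s))) = stat_orbit m s"
    and inW: "invariants s \<in> W" if s_in: "s \<in> LStatCS m" for s
  proof -
    obtain b B where s: "s = (linv b, conn B)" and st: "alg_stat b B" and cs: "alg_cs b B"
      using s_in unfolding LStatCS_eq by blast
    have b: "inner_product b" using st by (simp add: alg_stat_def)
    have eq: "\<rho> (invariants s) = (\<lambda>X Y Z. r b * cubic b B (\<psi> b X) (\<psi> b Y) (\<psi> b Z))"
      by (simp add: s invariants_eq[OF st] \<rho>_def)
    show "\<rho> (invariants s) \<in> rep_space e n \<and> stat_orbit m (stat_of (\<rho> (invariants s))) = stat_orbit m s"
      unfolding eq unfolding s using normal_form(1,2)[OF *(1-3)[OF b] st cs] by blast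
    show "invariants s \<in> W"
      by (simp add: s invariants_eq[OF st] W_def b cubic_sym_tensor[OF st])
  qed
  have "continuous_map LStatCS_space (top_of_set W) invariants"
  proof (rule continuous_map_into_subtopology)
    have "continuous_map (LStat_topology m) euclidean (id \<circ> invariants)"
      unfolding LStat_topology_def invariants_def[symmetric]
      by (rule continuous_map_pullback) (rule continuous_map_id)
    then show "continuous_map LStatCS_space euclidean invariants"
      by (simp add: continuous_map_from_subtopology)
    show "invariants \<in> topspace LStatCS_space \<rightarrow> W"
      using inW topspace_LStatCS_space by blast
  qed
  then have "continuous_map LStatCS_space euclidean (\<rho> \<circ> invariants)"
    using cont continuous_map_compose by (metis continuous_map_iff_continuous)
  then have "continuous_map LStatCS_space (top_of_set (rep_space e n)) (\<rho> \<circ> invariants)"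
    by (rule continuous_map_into_subtopology) (use nf topspace_LStatCS_space in auto)
  then show ?thesis
    using nf by (metis comp_apply)
qed

lemma topspace_MLStatCS: "topspace (MLStatCS m) = stat_orbit m ` LStatCS m"
  by (simp only: MLStatCS_def topspace_quotient_topology topspace_LStatCS_space)

lemma stat_orbits_represented:
  "stat_orbit m ` LStatCS m = (\<lambda>C. stat_orbit m (stat_of C)) ` rep_space e n"
proof -
  obtain \<rho> where \<rho>: "continuous_map LStatCS_space (top_of_set (rep_space e n)) \<rho>"
    "\<And>s. s \<in> LStatCS m \<Longrightarrow> stat_orbit m (stat_of (\<rho> s)) = stat_orbit m s"
    using retraction_exists by blast
  have rep: "\<rho> s \<in> rep_space e n" if "s \<in> LStatCS m" for s
    using continuous_map_funspace[OF \<rho>(1)] that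
    unfolding topspace_LStatCS_space topspace_euclidean_subtopology by blast
  show ?thesis
  proof
    show "stat_orbit m ` LStatCS m \<subseteq> (\<lambda>C. stat_orbit m (stat_of C)) ` rep_space e n"
    proof
      fix Q assume "Q \<in> stat_orbit m ` LStatCS m"
      then obtain s where s: "s \<in> LStatCS m" and Q: "Q = stat_orbit m s" by blast
      show "Q \<in> (\<lambda>C. stat_orbit m (stat_of C)) ` rep_space e n"
        unfolding Q \<rho>(2)[OF s, symmetric] using rep[OF s] by blast
    qed
    show "(\<lambda>C. stat_orbit m (stat_of C)) ` rep_space e n \<subseteq> stat_orbit m ` LStatCS m"
      using stat_of_LStatCS by blast
  qed
qed

theorem rep_space_set_of_representatives:
  "set_of_representatives m (linv (\<bullet>)) (rep_space e n)"
proof -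
  have "connection_of (linv (\<bullet>)) (left_inv_tensor3 m C) = conn (prod_of C)" if "C \<in> rep_space e n" for C
    using connection_of_eq[OF alg_stat_prod_of] cubic_prod_of rep_space_sym[OF that] by metis
  then show ?thesis
    unfolding set_of_representatives_def topspace_MLStatCS stat_orbits_represented
    using rep_space_sym by (auto simp: stat_of_def)
qed

text \<open>
  The embedding \<open>stat_of\<close> and the retraction onto \<open>rep_space\<close> are continuous and inverse to each other
  up to orbits.
\<close>

theorem MLStatCS_homeomorphic:
  "MLStatCS m homeomorphic_space quotient_topology (top_of_set (rep_space e n)) (rep_orbit e n)"
proof -
  obtain \<rho> where \<rho>: "continuous_map LStatCS_space (top_of_set (rep_space e n)) \<rho>"
    "\<And>s. s \<in> LStatCS m \<Longrightarrow> stat_orbit m (stat_of (\<rho> s)) = stat_orbit m s"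
    using retraction_exists by blast
  have rep: "\<rho> s \<in> rep_space e n" if "s \<in> LStatCS m" for s
    using continuous_map_funspace[OF \<rho>(1)] that
    unfolding topspace_LStatCS_space topspace_euclidean_subtopology by blast
  show ?thesis
    unfolding MLStatCS_def
  proof (rule quotient_topologies_homeomorphic[OF continuous_map_stat_of \<rho>(1)];
      unfold topspace_LStatCS_space topspace_euclidean_subtopology)
    fix y y' assume "y \<in> rep_space e n" "y' \<in> rep_space e n" "rep_orbit e n y = rep_orbit e n y'"
    then show "stat_orbit m (stat_of y) = stat_orbit m (stat_of y')"
      using stat_orbit_eq_iff_rep_orbit_eq by blast
  next
    fix x x' assume "x \<in> LStatCS m" "x' \<in> LStatCS m" "stat_orbit m x = stat_orbit m x'"
    then show "rep_orbit e n (\<rho> x) = rep_orbit e n (\<rho> x')"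
      using stat_orbit_eq_iff_rep_orbit_eq[OF rep rep] \<rho>(2) by simp
  next
    fix x assume "x \<in> LStatCS m"
    then show "stat_orbit m (stat_of (\<rho> x)) = stat_orbit m x"
      by (rule \<rho>(2))
  next
    fix y assume "y \<in> rep_space e n"
    then show "rep_orbit e n (\<rho> (stat_of y)) = rep_orbit e n y"
      using stat_orbit_eq_iff_rep_orbit_eq[OF rep] \<rho>(2) stat_of_LStatCS by blast
  qed
qed

theorem dimension_3_levi_civita:
  assumes n: "n = 3" and s: "(g, D) \<in> LStatCS m"
  shows "levi_civita g D"
proof -
  obtain b B where eq: "g = linv b" "D = conn B" and st: "alg_stat b B" and cs: "alg_cs b B"
    using s unfolding LStatCS_eq by blast
  have b: "inner_product b" using st by (simp add: alg_stat_def)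
  obtain \<psi> r where psi: "lie_aut \<psi>" and r: "r > 0" and iso: "\<And>u v. r * b (\<psi> u) (\<psi> v) = u \<bullet> v"
    using normalising_section b by metis
  have vanish: "(\<lambda>X Y Z. r * cubic b B (\<psi> X) (\<psi> Y) (\<psi> Z)) = (\<lambda>X Y Z. 0)"
    using normal_form(1)[OF psi r iso st cs] rep_space_dim_3[OF n] by simp
  have zero: "cubic b B (\<psi> X) (\<psi> Y) (\<psi> Z) = 0" for X Y Z
    using fun_cong[OF fun_cong[OF fun_cong[OF vanish, of X], of Y], of Z] r by simp
  have "cubic b B u v w = 0" for u v w
    using zero[of "inv \<psi> u" "inv \<psi> v" "inv \<psi> w"] by (simp add: lie_autD(6)[OF psi])
  then show ?thesis
    unfolding eq by (intro levi_civita_conn st ext)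
qed

text \<open>
  Flatness is invariant under the action and implies conjugate symmetry, so a flat structure could be
  normalised to an element of \<open>rep_space\<close>.
\<close>

theorem no_dually_flat:
  assumes s: "(g, D) \<in> LStat m"
  shows "\<not> dually_flat g D"
proof
  assume flat: "dually_flat g D"
  obtain b B where eq: "g = linv b" "D = conn B" and st: "alg_stat b B"
    using s unfolding LStat_eq by blast
  have b: "inner_product b" and bil: "bilinear b" and B: "bilinear B"
    using st by (simp_all add: alg_stat_def inner_product_def)
  have curv: "alg_curv B u v w = 0" for u v w
    using dually_flat_imp[OF B] flat by (simp add: eq)
  then have cs: "alg_cs b B"
    by (simp add: alg_cs_def bilinear_lzero[OF bil] bilinear_rzero[OF bil])
  obtain \<psi> r where psi: "lie_aut \<psi>" and r: "r > 0" and iso: "\<And>u v. r * b (\<psi> u) (\<psi> v) = u \<bullet> v"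
    using normalising_section b by metis
  note N = normal_form(1,3)[OF psi r iso st cs]
  have phi: "lie_aut (inv \<psi>)" by (rule lie_aut_inv[OF psi])
  show False
    using rep_space_not_flat[OF N(1)] unfolding N(2) alg_curv_act[OF phi] curv
    by (simp add: linear_0[OF lie_autD(1)[OF phi]])
qed

end

theorem theorem1p3:
  fixes e :: "nat \<Rightarrow> 'a::euclidean_space" and n :: nat
  assumes "n \<ge> 3" and "DIM('a) = n"
    and "\<forall>i\<in>{1..n}. \<forall>j\<in>{1..n}. e i \<bullet> e j = (if i = j then 1 else 0)"
  shows
    "(w0_S1 e n \<inter> S3_abelian e n = {\<lambda>X Y Z. 0} \<and>
      set_of_representatives (heis_mult e) (left_inv_metric (heis_mult e) (\<bullet>)) (rep_space e n) \<and>
      (n = 3 \<longrightarrow>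
         rep_space e n = {\<lambda>X Y Z. 0} \<and>
         (\<exists>x. topspace (MLStatCS (heis_mult e)) = {x}) \<and>
         (\<forall>(g, D) \<in> LStatCS (heis_mult e). levi_civita g D)) \<and>
      (n \<ge> 4 \<longrightarrow>
         MLStatCS (heis_mult e) homeomorphic_space
           quotient_topology (top_of_set (rep_space e n)) (rep_orbit e n))) \<and>
     \<not> (\<exists>(g, D) \<in> LStat (heis_mult e). dually_flat g D)"
proof -
  interpret heisenberg_frame e n
    by unfold_locales (rule assms)+
  have point: "\<exists>x. topspace (MLStatCS (heis_mult e)) = {x}" if "n = 3"
    by (simp only: topspace_MLStatCS stat_orbits_represented rep_space_dim_3[OF that]
        image_insert image_empty) blast
  show ?thesis
  proof (intro conjI impI)
    show "\<forall>(g, D) \<in> LStatCS (heis_mult e). levi_civita g D" if "n = 3"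
      using dimension_3_levi_civita[OF that] by auto
    show "\<not> (\<exists>(g, D) \<in> LStat (heis_mult e). dually_flat g D)"
      using no_dually_flat by auto
  qed (rule w0_S1_Int_S3 rep_space_set_of_representatives rep_space_dim_3 MLStatCS_homeomorphic point
      | assumption)+
qed

end
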